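(* Let $n\ge2$ and let $\psi:\mathbb{R}_+\to\mathbb{R}_+$ be a non-increasing continuous function. If $$\sum_{x=1}^\infty(\log x)^{n-2}\psi(x)$$ diverges, then almost every unimodular lattice $\Lambda$ in $k^n$ is $\psi$-multiplicatively approximable.
   Context: Let $\mathbb{F}_s$ be the finite field with $s$ elements ($s$ a prime power), $Z=\mathbb{F}_s[X]$, $k=\mathbb{F}_s((X^{-1}))$ with absolute value $|a|=s^{-v(a)}$, where for $a=\sum_i a_iX^{-i}$, $v(a)=\sup\{j\in\mathbb{Z}: a_i=0\ \forall i<j\}$. The space of unimodular (covolume $1$) lattices (discrete free $Z$-modules of maximal rank) in $k^n$ is identified with $\mathrm{SL}_n(k)/\mathrm{SL}_n(Z)$ via $g\mapsto gZ^n$; "almost every" is with respect to the $\mathrm{SL}_n(k)$-invariant probability measure. For $\mathbf{v}=(v_1,\dots,v_n)\in k^n$ put $$\textstyle\prod(\mathbf{v})=\prod_{i=1}^n|v_i|,\qquad\|\mathbf{v}\|=\max_i|v_i|.$$ A unimodular lattice $\Lambda$ in $k^n$ is $\psi$-multiplicatively approximable if there exist infinitely many $\mathbf{v}\in\Lambda$ such that $\prod(\mathbf{v})\le\|\mathbf{v}\|\,\psi(\|\mathbf{v}\|)$. *)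

theory Defs
  imports
    "HOL-Probability.Probability"
    "HOL-Computational_Algebra.Computational_Algebra"
begin

text \<open>
  The field \<open>k = F\<^sub>s((X\<^sup>-\<^sup>1))\<close> is the type \<open>'a fls\<close> for a finite field \<open>'a\<close> with \<open>s = CARD('a)\<close>
  elements. The formal variable of \<open>'a fls\<close> plays the role of \<open>X\<^sup>-\<^sup>1\<close>, so that
  \<^const>\<open>fls_subdegree\<close> is the valuation \<open>v\<close> (except at 0) and \<^const>\<open>fls_X_inv\<close> is \<open>X\<close>.
  The library metric on \<open>'a fls\<close> is \<open>2 powi (- v (a - b))\<close>, which induces the same topology as
  the absolute value below.
\<close>

definition abs_k :: "'a::{field,finite} fls \<Rightarrow> real" where
  "abs_k a = (if a = 0 then 0 else real CARD('a) powi (- fls_subdegree a))"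

definition ring_Z :: "'a::{field,finite} fls set" where
  "ring_Z = range (\<lambda>p. poly (map_poly fls_const p) fls_X_inv)"

definition prod_k :: "'a::{field,finite} fls ^ 'n \<Rightarrow> real" where
  "prod_k v = (\<Prod>i\<in>UNIV. abs_k (v $ i))"

definition norm_k :: "'a::{field,finite} fls ^ 'n \<Rightarrow> real" where
  "norm_k v = Max (range (\<lambda>i. abs_k (v $ i)))"

definition SL_k :: "('a::{field,finite} fls ^ 'n ^ 'n) set" where
  "SL_k = {g. det g = 1}"

definition lattice_of :: "'a::{field,finite} fls ^ 'n ^ 'n \<Rightarrow> ('a fls ^ 'n) set" where
  "lattice_of g = (*v) g ` {v. \<forall>i. v $ i \<in> ring_Z}"

text \<open>
  The coset space \<open>SL\<^sub>n(k)/SL\<^sub>n(Z)\<close>, a coset \<open>g SL\<^sub>n(Z)\<close> being represented by the lattice \<open>g Z\<^sup>n\<close>.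
\<close>
definition unimodular_lattices :: "('a::{field,finite} fls ^ 'n) set set" where
  "unimodular_lattices = lattice_of ` SL_k"

text \<open>The Borel sets of the quotient topology on \<open>SL\<^sub>n(k)/SL\<^sub>n(Z)\<close>.\<close>
definition borel_lattices :: "('a::{field,finite} fls ^ 'n) set measure" where
  "borel_lattices = sigma unimodular_lattices
     {U. U \<subseteq> unimodular_lattices \<and> openin (top_of_set SL_k) {g \<in> SL_k. lattice_of g \<in> U}}"

definition invariant_probability :: "('a::{field,finite} fls ^ 'n) set measure \<Rightarrow> bool" where
  "invariant_probability \<mu> \<longleftrightarrow>
     prob_space \<mu> \<and> sets \<mu> = sets borel_lattices \<and>
     (\<forall>h\<in>SL_k. \<forall>A\<in>sets \<mu>. emeasure \<mu> ((\<lambda>\<Lambda>. (*v) h ` \<Lambda>) ` A) = emeasure \<mu> A)"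

definition mult_approximable ::
    "(real \<Rightarrow> real) \<Rightarrow> ('a::{field,finite} fls ^ 'n) set \<Rightarrow> bool" where
  "mult_approximable \<psi> \<Lambda> \<longleftrightarrow>
     infinite {v \<in> \<Lambda>. prod_k v \<le> norm_k v * \<psi> (norm_k v)}"

end

theory Submission
  imports Defs
begin

text \<open>
  Let \<open>B\<close> be the set of lattices without a good vector of norm at least \<open>T\<close>. By invariance of \<open>\<mu>\<close>, the
  measure of \<open>B\<close> is the integral over \<open>\<Lambda>\<close> of the fraction of \<open>h\<close> with \<open>h \<Lambda> \<in> B\<close>, where \<open>h\<close> runs through
  representatives of \<open>SL\<^sub>n(O)\<close> modulo \<open>X^(-i)\<close>, so it suffices that this fraction tends to 0 for each
  \<open>\<Lambda> = g Z\<^sup>n\<close>. Averaging further over \<open>h g u(y)\<close> with \<open>u(y)\<close> unipotent and small turns one coordinate of the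
  vector \<open>h g u(y) (p, q)\<close> into \<open>p + y \<cdot> q\<close> up to a bounded factor, while the other coordinates are
  a fixed linear image \<open>D q\<close> up to negligible terms. One needs \<open>|p + y \<cdot> q|\<close> to be at most
  \<open>|D q| \<psi>(|D q|)\<close> divided by the product of the \<open>|(D q)\<^sub>i|\<close>, and the series of these probabilities over \<open>q\<close>
  diverges by assumption.

  If \<open>n \<ge> 3\<close>, the conditions for non-proportional \<open>q\<close> are independent, and Chebyshev's inequality shows that with
  probability close to 1 one of them holds. If \<open>n = 2\<close>, the balls around reduced fractions whose denominators
  have distinct degrees are pairwise negatively correlated, by an exact count of coprime pairs, and
  Chebyshev's inequality applies again.
\<close>

text \<open>Haar measure is never computed with: everything is counting in finite sets of digit
  strings, and \<open>\<mu>\<close> enters only through its invariance under finitely many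
  translates at a time. Hence a hit must be witnessed by vectors of bounded size \<open>S\<close>,
  chosen before the matrix, so that it survives truncation of the unipotent parameter to
  \<open>N\<close> digits and the replacement of \<open>h\<close> by another member of its class. A
  spare factor s^(e+1) in the target pays for all matrices bounded by s^e at once and does not
  affect divergence.

  A mean tending to infinity is not enough: unless the variance is of smaller order than the squared
  mean, only a positive proportion results. Dependence comes from multiples of one vector and, for
  scalar \<open>q\<close>, from all pairs. Hence nearly primitive vectors in the first case, and
  counting without loss of constants in the second.

  The weight (log x)^(n-2) counts shells: for x of order s^\<tau> it becomes \<tau>^(n-2), up to
  constants the number of exponent vectors of the n - 1 free coordinates with maximum
  \<tau>.\<close>

no_notation fps_nth (infixl "$" 75)
notation fls_nth (infixl "$$" 75)

section \<open>Valuations of Laurent series\<close>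

text \<open>
  The predicates \<open>vge m x\<close> and \<open>veq m x\<close> say \<open>|x| \<le> s^(-m)\<close> and \<open>|x| = s^(-m)\<close>.
\<close>

definition vge :: "int \<Rightarrow> 'a::zero fls \<Rightarrow> bool" where
  "vge m x \<longleftrightarrow> (\<forall>n<m. x $$ n = 0)"

definition veq :: "int \<Rightarrow> 'a::zero fls \<Rightarrow> bool" where
  "veq m x \<longleftrightarrow> vge m x \<and> x $$ m \<noteq> 0"

text \<open>\<open>cut 1 M x\<close> is the fractional part of \<open>x\<close> to \<open>M\<close>
  digits; if it vanishes, \<open>x\<close> is within s^(-M-1) of a polynomial.\<close>

definition cut :: "int \<Rightarrow> int \<Rightarrow> 'a::zero fls \<Rightarrow> 'a fls" where
  "cut a b x = Abs_fls (\<lambda>n. if a \<le> n \<and> n \<le> b then x $$ n else 0)"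

text \<open>Finite windows of coefficients: \<open>seg 1 N\<close> is the sample space of
  \<open>N\<close> random digits, \<open>seg (-b) 0\<close> the polynomials of degree at most
  \<open>b\<close>.\<close>

definition seg :: "int \<Rightarrow> int \<Rightarrow> 'a::zero fls set" where
  "seg a b = {x. \<forall>n. x $$ n \<noteq> 0 \<longrightarrow> a \<le> n \<and> n \<le> b}"

text \<open>The series variable is X^(-1), so polynomials in X have no coefficient at a positive
  index; \<open>ring_Z_eq\<close> links this to \<open>ring_Z\<close>.\<close>

definition Zint :: "'a::zero fls set" where
  "Zint = {x. \<forall>n>0. x $$ n = 0}"

definition ipart :: "'a::zero fls \<Rightarrow> 'a fls" where
  "ipart x = cut (min 0 (fls_subdegree x)) 0 x"

lemma cut_nth [simp]: "cut a b x $$ n = (if a \<le> n \<and> n \<le> b then x $$ n else 0)"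
  unfolding cut_def
  by (rule nth_Abs_fls_lower_bound[of a]) auto

lemma ipart_nth: "ipart x $$ n = (if n \<le> 0 then x $$ n else 0)"
  by (auto simp: ipart_def)

lemma ipart_Zint: "ipart x \<in> Zint"
  by (auto simp: Zint_def ipart_nth)

lemma vge_fpart:
  fixes x :: "'a::group_add fls"
  shows "vge 1 (x - ipart x)"
  by (auto simp: vge_def ipart_nth)

lemma vge_mono: "vge b x \<Longrightarrow> a \<le> b \<Longrightarrow> vge a x"
  by (auto simp: vge_def)

lemma vge_zero [simp]: "vge m 0"
  by (simp add: vge_def)

lemma vge_one: "vge 0 (1::'a::{zero,one} fls)"
  by (simp add: vge_def)

lemma vge_iff: "vge m x \<longleftrightarrow> x = 0 \<or> m \<le> fls_subdegree x"
proof
  assume "vge m x"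
  then show "x = 0 \<or> m \<le> fls_subdegree x"
    by (metis vge_def nth_fls_subdegree_nonzero not_le)
qed (auto simp: vge_def)

lemma veq_iff: "veq m x \<longleftrightarrow> x \<noteq> 0 \<and> fls_subdegree x = m"
proof
  assume "veq m x"
  then show "x \<noteq> 0 \<and> fls_subdegree x = m"
    by (auto simp: veq_def vge_def intro!: fls_subdegree_eqI)
qed (auto simp: veq_def vge_def)

lemma vge_add:
  fixes x :: "'a::comm_ring_1 fls" shows "vge m x \<Longrightarrow> vge m y \<Longrightarrow> vge m (x + y)"
  by (auto simp: vge_def)

lemma vge_diff:
  fixes x :: "'a::comm_ring_1 fls" shows "vge m x \<Longrightarrow> vge m y \<Longrightarrow> vge m (x - y)"
  by (auto simp: vge_def)

lemma vge_uminus: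
  fixes x :: "'a::comm_ring_1 fls" shows "vge m x \<Longrightarrow> vge m (- x)"
  by (auto simp: vge_def)

lemma vge_sum:
  fixes f :: "'b \<Rightarrow> 'a::comm_ring_1 fls"
  shows "(\<And>i. i \<in> A \<Longrightarrow> vge m (f i)) \<Longrightarrow> vge m (sum f A)"
  by (auto simp: vge_def fls_nth_sum)

lemma vge_mult:
  fixes x y :: "'a::idom fls"
  assumes "vge a x" "vge b y" shows "vge (a + b) (x * y)"
proof (cases "x = 0 \<or> y = 0")
  case False
  then have "fls_subdegree (x * y) = fls_subdegree x + fls_subdegree y" by simp
  with assms False show ?thesis unfolding vge_iff by linarith
qed auto

lemma vge_mult':
  fixes x y :: "'a::idom fls"
  assumes "vge a x" "vge b y" "c \<le> a + b" shows "vge c (x * y)"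
  using vge_mono[OF vge_mult] assms by blast

lemma veq_mult:
  fixes x y :: "'a::idom fls"
  assumes "veq a x" "veq b y" shows "veq (a + b) (x * y)"
  using assms by (auto simp: veq_iff)

lemma veq_vge: "veq a x \<Longrightarrow> vge a x" by (simp add: veq_def)

lemma veq_unique: "veq a x \<Longrightarrow> veq b x \<Longrightarrow> a = b" by (simp add: veq_iff)

lemma veq_vge_le: "veq a x \<Longrightarrow> vge b x \<Longrightarrow> b \<le> a" by (auto simp: veq_iff vge_iff)

lemma veq_add:
  fixes x :: "'a::comm_ring_1 fls"
  assumes "veq a x" "vge b y" "a < b" shows "veq a (x + y)"
  using assms by (auto simp: veq_def vge_def)

lemma veq_diff:
  fixes x :: "'a::comm_ring_1 fls"
  assumes "veq a x" "vge b y" "a < b" shows "veq a (x - y)"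
  using assms by (auto simp: veq_def vge_def)

lemma veq_exists: "x \<noteq> 0 \<Longrightarrow> \<exists>m. veq m x"
  by (simp add: veq_iff)

lemma veq_divide:
  fixes x y :: "'a::field fls"
  assumes "veq a x" "veq b y" shows "veq (a - b) (x / y)"
proof -
  have "y \<noteq> 0" "x \<noteq> 0" using assms by (auto simp: veq_iff)
  then have nz: "x / y \<noteq> 0" by simp
  have "fls_subdegree (x / y * y) = fls_subdegree (x / y) + fls_subdegree y"
    using nz \<open>y \<noteq> 0\<close> by (subst fls_subdegree_mult) auto
  moreover have "x / y * y = x" using \<open>y \<noteq> 0\<close> by simp
  ultimately show ?thesis using assms nz \<open>y \<noteq> 0\<close> by (auto simp: veq_iff)
qed

lemma vge_divide:
  fixes x y :: "'a::field fls"
  assumes "vge a x" "veq b y" shows "vge (a - b) (x / y)"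
proof (cases "x = 0")
  case False
  then obtain c where c: "veq c x" using veq_exists by blast
  have "a \<le> c" using c assms veq_vge_le by blast
  with veq_divide[OF c assms(2)] show ?thesis
    by (meson diff_right_mono veq_vge vge_mono)
qed auto

lemma vge_mult_cancel:
  fixes x y :: "'a::idom fls"
  assumes "veq a x" "vge b (x * y)" shows "vge (b - a) y"
proof (cases "y = 0")
  case False
  then have "fls_subdegree (x * y) = fls_subdegree x + fls_subdegree y"
    using assms(1) by (simp add: veq_iff)
  with assms False show ?thesis unfolding vge_iff veq_iff by auto
qed auto

lemma Zint_zero [simp]: "0 \<in> Zint" by (simp add: Zint_def)
lemma Zint_one [simp]: "(1::'a::{zero,one} fls) \<in> Zint" by (simp add: Zint_def)
lemma Zint_add: "x \<in> Zint \<Longrightarrow> y \<in> Zint \<Longrightarrow> (x::'a::comm_ring_1 fls) + y \<in> Zint" by (simp add: Zint_def)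
lemma Zint_diff: "x \<in> Zint \<Longrightarrow> y \<in> Zint \<Longrightarrow> (x::'a::comm_ring_1 fls) - y \<in> Zint" by (simp add: Zint_def)
lemma Zint_uminus: "x \<in> Zint \<Longrightarrow> - (x::'a::comm_ring_1 fls) \<in> Zint" by (simp add: Zint_def)

lemma Zint_mult:
  fixes x y :: "'a::comm_ring_1 fls"
  assumes "x \<in> Zint" "y \<in> Zint" shows "x * y \<in> Zint"
proof -
  have "(x * y) $$ n = 0" if "n > 0" for n
    unfolding fls_times_nth(2)
  proof (rule sum.neutral, intro ballI)
    fix i assume "i \<in> {fls_subdegree x..n - fls_subdegree y}"
    show "x $$ i * y $$ (n - i) = 0"
      using assms that by (cases "i > 0") (auto simp: Zint_def)
  qed
  then show ?thesis by (simp add: Zint_def)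
qed

lemma Zint_sum:
  fixes f :: "'b \<Rightarrow> 'a::comm_ring_1 fls"
  shows "(\<And>i. i \<in> A \<Longrightarrow> f i \<in> Zint) \<Longrightarrow> sum f A \<in> Zint"
  by (simp add: Zint_def fls_nth_sum)

text \<open>No index is both at most 0 and at least 1. This discreteness of the polynomial ring ends
  most uniqueness arguments below.\<close>

lemma Zint_vge_eq_0: "x \<in> Zint \<Longrightarrow> vge 1 x \<Longrightarrow> x = 0"
proof (rule fls_eqI)
  fix n assume "x \<in> Zint" "vge 1 x"
  then show "x $$ n = 0 $$ n" by (cases "n > 0") (auto simp: Zint_def vge_def)
qed

lemma Zint_veq_nonpos: "x \<in> Zint \<Longrightarrow> veq m x \<Longrightarrow> m \<le> 0"
  by (auto simp: Zint_def veq_def not_less)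

lemma Zint_vge_seg: "x \<in> Zint \<Longrightarrow> vge (-m) x \<Longrightarrow> x \<in> seg (-m) 0"
  by (force simp: Zint_def vge_def seg_def not_less[symmetric])

lemma seg_Zint: "x \<in> seg a 0 \<Longrightarrow> x \<in> Zint"
  by (force simp: Zint_def seg_def not_less[symmetric])

lemma seg_vge: "x \<in> seg a b \<Longrightarrow> vge a x"
  by (auto simp: vge_def seg_def)

lemma seg_diff: "x \<in> seg a b \<Longrightarrow> y \<in> seg a b \<Longrightarrow> (x::'a::comm_ring_1 fls) - y \<in> seg a b"
  by (auto simp: seg_def) (metis diff_0_right diff_self)+

lemma seg_add: "x \<in> seg a b \<Longrightarrow> y \<in> seg a b \<Longrightarrow> (x::'a::comm_ring_1 fls) + y \<in> seg a b"
  by (auto simp: seg_def) (metis add_0_right)+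

lemma seg_zero [simp]: "0 \<in> seg a b" by (simp add: seg_def)

lemma cut_seg [simp]: "cut a b x \<in> seg a b"
  by (auto simp: seg_def split: if_splits)

lemma cut_seg_eq: "x \<in> seg a b \<Longrightarrow> cut a b x = x"
  by (rule fls_eqI) (auto simp: seg_def)

lemma cut_add: "cut a b ((x::'a::comm_ring_1 fls) + y) = cut a b x + cut a b y"
  by (rule fls_eqI) auto

lemma cut_eq_0_Zint: "x \<in> Zint \<Longrightarrow> cut 1 b x = 0"
  by (rule fls_eqI) (auto simp: Zint_def)

lemma cut_eq_0_vge: "vge (b + 1) x \<Longrightarrow> cut a b x = 0"
  by (rule fls_eqI) (auto simp: vge_def)

lemma seg_card:
  "finite (seg a b :: 'a::{zero,finite} fls set) \<and>
   card (seg a b :: 'a::{zero,finite} fls set) = CARD('a) ^ nat (b - a + 1)"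
proof -
  let ?G = "\<lambda>f::int \<Rightarrow> 'a. Abs_fls (\<lambda>n. if a \<le> n \<and> n \<le> b then f n else 0)"
  have nth: "?G f $$ n = (if a \<le> n \<and> n \<le> b then f n else 0)" for f n
    by (rule nth_Abs_fls_lower_bound[of a]) auto
  let ?P = "PiE {a..b} (\<lambda>_. UNIV :: 'a set)"
  have bij: "bij_betw ?G ?P (seg a b)"
  proof (rule bij_betwI')
    fix f g assume fg: "f \<in> ?P" "g \<in> ?P"
    show "?G f = ?G g \<longleftrightarrow> f = g"
    proof
      assume eq: "?G f = ?G g"
      show "f = g"
      proof (rule PiE_ext[OF fg])
        fix n assume n: "n \<in> {a..b}"
        have "?G f $$ n = ?G g $$ n" using eq by simp
        then show "f n = g n" using n by (simp add: nth)
      qed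
    next
      assume "f = g"
      then show "?G f = ?G g" by (rule arg_cong[where f = ?G])
    qed
  next
    fix f assume "f \<in> ?P" show "?G f \<in> seg a b" by (auto simp: seg_def nth split: if_splits)
  next
    fix y :: "'a fls" assume y: "y \<in> seg a b"
    have "restrict (fls_nth y) {a..b} \<in> ?P" by auto
    moreover have "y = ?G (restrict (fls_nth y) {a..b})"
      by (rule fls_eqI) (use y in \<open>auto simp: nth seg_def\<close>)
    ultimately show "\<exists>f\<in>?P. y = ?G f" by blast
  qed
  have "finite ?P" by (rule finite_PiE) auto
  moreover have "card ?P = CARD('a) ^ nat (b - a + 1)"
    by (simp add: card_PiE algebra_simps)
  ultimately show ?thesis using bij_betw_finite[OF bij] bij_betw_same_card[OF bij] by simp
qed

lemmas finite_seg = seg_card[THEN conjunct1]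
lemmas card_seg = seg_card[THEN conjunct2]

section \<open>Comparison with the ring and the absolute value of the statement\<close>

lemma ring_Z_eq: "(ring_Z :: 'a::{field,finite} fls set) = Zint"
proof (intro set_eqI iffI)
  fix x :: "'a fls" assume "x \<in> ring_Z"
  then obtain p where p: "x = poly (map_poly fls_const p) fls_X_inv" by (auto simp: ring_Z_def)
  have "x \<in> Zint" unfolding p
  proof (induction p)
    case (pCons a p)
    have "fls_const a \<in> Zint" "(fls_X_inv::'a fls) \<in> Zint" by (auto simp: Zint_def)
    with pCons show ?case by (auto simp: map_poly_pCons intro!: Zint_add Zint_mult)
  qed simp
  then show "x \<in> Zint" .
next
  fix x :: "'a fls" assume x: "x \<in> Zint"
  let ?p = "\<Sum>i\<le>nat (- fls_subdegree x). monom (x $$ (- int i)) i"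
  have "poly (map_poly fls_const (\<Sum>i\<in>I. monom (x $$ (- int i)) i)) fls_X_inv =
     (\<Sum>i\<in>I. fls_const (x $$ (- int i)) * fls_X_inv ^ i)" if "finite I" for I
    using that
  proof (induction I)
    case (insert j I)
    have "map_poly fls_const (p + q) = map_poly fls_const p + map_poly fls_const q" for p q :: "'a poly"
      by (rule poly_eqI) (simp add: coeff_map_poly fls_plus_const)
    with insert show ?case by (simp add: map_poly_monom poly_monom)
  qed simp
  then have eq: "poly (map_poly fls_const ?p) fls_X_inv =
     (\<Sum>i\<le>nat (- fls_subdegree x). fls_const (x $$ (- int i)) * fls_X_inv ^ i)" by simp
  have "x = poly (map_poly fls_const ?p) fls_X_inv"
    unfolding eq
  proof (rule fls_eqI)
    fix n
    have "(\<Sum>i\<le>nat (- fls_subdegree x). fls_const (x $$ (- int i)) * fls_X_inv ^ i) $$ n =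
       (\<Sum>i\<le>nat (- fls_subdegree x). if i = nat (-n) then (if n \<le> 0 then x $$ n else 0) else 0)"
      unfolding fls_nth_sum by (rule sum.cong) auto
    also have "\<dots> = (if nat (-n) \<le> nat (- fls_subdegree x) then (if n \<le> 0 then x $$ n else 0) else 0)"
      by simp
    also have "\<dots> = x $$ n"
      using x by (auto simp: Zint_def)
    finally show "x $$ n = (\<Sum>i\<le>nat (- fls_subdegree x). fls_const (x $$ (- int i)) * fls_X_inv ^ i) $$ n"
      by simp
  qed
  then show "x \<in> ring_Z" by (auto simp: ring_Z_def)
qed

lemma card_field_ge_2: "CARD('a::{field,finite}) \<ge> 2"
proof -
  have "card {0::'a, 1} \<le> CARD('a)" by (rule card_mono) auto
  then show ?thesis by simp
qed

lemma abs_k_veq: "veq m x \<Longrightarrow> abs_k (x::'a::{field,finite} fls) = real CARD('a) powi (- m)"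
  by (auto simp: veq_iff abs_k_def)

lemma abs_k_vge: "vge m x \<Longrightarrow> abs_k (x::'a::{field,finite} fls) \<le> real CARD('a) powi (- m)"
proof (cases "x = 0")
  case False
  assume "vge m x"
  with False have "m \<le> fls_subdegree x" by (simp add: vge_iff)
  with False show ?thesis using card_field_ge_2[where 'a='a]
    by (auto simp: abs_k_def intro!: power_int_increasing)
qed (auto simp: abs_k_def)

text \<open>This is X^m: the series variable is X^(-1), so the exponent \<open>m\<close> sits at
  index \<open>-m\<close>.\<close>

definition Xpow :: "int \<Rightarrow> 'a::{zero,one} fls" where "Xpow m = fls_shift m 1"

lemma Xpow_nth: "Xpow m $$ n = (if n = - m then 1 else 0)"
  by (auto simp: Xpow_def)

lemma veq_Xpow: "veq (- m) (Xpow m :: 'a::zero_neq_one fls)"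
  by (auto simp: veq_def vge_def Xpow_nth)

lemma Xpow_Zint: "m \<ge> 0 \<Longrightarrow> Xpow m \<in> Zint"
  by (auto simp: Zint_def Xpow_nth)

lemma Xpow_mult: "Xpow m * Xpow k = (Xpow (m + k) :: 'a::comm_ring_1 fls)"
  unfolding Xpow_def by (simp add: fls_shifted_times_simps)

lemma Xpow_0 [simp]: "Xpow 0 = 1" by (simp add: Xpow_def)

section \<open>Slabs and their second moments\<close>

text \<open>All fibres of \<open>\<phi>\<close> are translates of the zero fibre, hence equally
  large. Translations are given as bijections \<open>\<tau>\<close> instead of a group law because
  \<open>\<Omega>\<close> will consist of extensional functions, which are added on their domain
  only.\<close>

lemma card_kernel:
  fixes \<phi> :: "'z \<Rightarrow> 'v::ab_group_add"
  assumes fin: "finite \<Omega>" and V: "\<phi> ` \<Omega> = V"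
    and transl: "\<And>w. w \<in> \<Omega> \<Longrightarrow> \<exists>\<tau>. bij_betw \<tau> \<Omega> \<Omega> \<and> (\<forall>z\<in>\<Omega>. \<phi> (\<tau> z) = \<phi> z + \<phi> w)"
  shows "card {z\<in>\<Omega>. \<phi> z = 0} * card V = card \<Omega>"
proof -
  have fib: "card {z\<in>\<Omega>. \<phi> z = v} = card {z\<in>\<Omega>. \<phi> z = 0}" if "v \<in> V" for v
  proof -
    from that V obtain w where w: "w \<in> \<Omega>" "v = \<phi> w" by blast
    from transl[OF w(1)] obtain \<tau> where \<tau>: "bij_betw \<tau> \<Omega> \<Omega>" "\<And>z. z \<in> \<Omega> \<Longrightarrow> \<phi> (\<tau> z) = \<phi> z + v"
      using w by auto
    have "bij_betw \<tau> {z\<in>\<Omega>. \<phi> z = 0} {z\<in>\<Omega>. \<phi> z = v}"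
    proof (rule bij_betw_subset[OF \<tau>(1), of "{z\<in>\<Omega>. \<phi> z = 0}", simplified])
      show "\<tau> ` {z \<in> \<Omega>. \<phi> z = 0} = {z \<in> \<Omega>. \<phi> z = v}"
      proof (intro set_eqI iffI)
        fix y assume y: "y \<in> {z \<in> \<Omega>. \<phi> z = v}"
        then obtain z where "z \<in> \<Omega>" "y = \<tau> z" using \<tau>(1) by (auto simp: bij_betw_def)
        with y \<tau>(2) show "y \<in> \<tau> ` {z \<in> \<Omega>. \<phi> z = 0}" by auto
      qed (use \<tau> in \<open>auto simp: bij_betw_def\<close>)
    qed
    then show ?thesis by (simp add: bij_betw_same_card)
  qed
  have "card \<Omega> = (\<Sum>v\<in>V. card {z\<in>\<Omega>. \<phi> z = v})"
    using sum.image_gen[OF fin, of "\<lambda>_. 1::nat" \<phi>] V by simp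
  also have "\<dots> = card V * card {z\<in>\<Omega>. \<phi> z = 0}"
    using fib by simp
  finally show ?thesis by simp
qed

text \<open>Chebyshev's inequality by counting. With \<open>S z\<close> the number of events
  containing \<open>z\<close>, the pair sum bounds the total of \<open>(S z - M)^2\<close> over
  \<open>\<Omega>\<close> by \<open>L * M * card \<Omega>\<close>, and every point outside all
  events contributes \<open>M^2\<close> to that total.\<close>

lemma second_moment_bound:
  fixes P :: "'i \<Rightarrow> real"
  assumes fin: "finite \<Omega>" "finite I" and M: "M = sum P I" "M > 0"
    and E: "\<And>i. i \<in> I \<Longrightarrow> E i \<subseteq> \<Omega>" "\<And>i. i \<in> I \<Longrightarrow> real (card (E i)) = P i * real (card \<Omega>)"
    and pair: "(\<Sum>i\<in>I. \<Sum>j\<in>I. real (card (E i \<inter> E j))) \<le> (M\<^sup>2 + L * M) * real (card \<Omega>)"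
  shows "real (card {z\<in>\<Omega>. \<forall>i\<in>I. z \<notin> E i}) * M \<le> L * real (card \<Omega>)"
proof -
  define S :: "'a \<Rightarrow> real" where "S z = (\<Sum>i\<in>I. of_bool (z \<in> E i))" for z
  have card_eq: "(\<Sum>z\<in>\<Omega>. of_bool (z \<in> A)) = real (card A)" if "A \<subseteq> \<Omega>" for A
  proof -
    have "{x \<in> \<Omega>. x \<in> A} = A" using that by blast
    then show ?thesis using fin by (simp add: of_bool_def sum.If_cases Int_def)
  qed
  have S1: "(\<Sum>z\<in>\<Omega>. S z) = M * real (card \<Omega>)"
    unfolding S_def by (subst sum.swap) (simp add: card_eq E M sum_distrib_right)
  have "(\<Sum>z\<in>\<Omega>. (S z)\<^sup>2) = (\<Sum>z\<in>\<Omega>. \<Sum>i\<in>I. \<Sum>j\<in>I. of_bool (z \<in> E i \<inter> E j))"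
    unfolding S_def power2_eq_square sum_product by (simp add: of_bool_conj)
  also have "\<dots> = (\<Sum>i\<in>I. \<Sum>j\<in>I. \<Sum>z\<in>\<Omega>. of_bool (z \<in> E i \<inter> E j))"
    by (subst sum.swap, rule sum.cong[OF refl], subst sum.swap, rule refl)
  also have "\<dots> = (\<Sum>i\<in>I. \<Sum>j\<in>I. real (card (E i \<inter> E j)))"
    by (intro sum.cong refl card_eq) (use E in blast)
  finally have S2: "(\<Sum>z\<in>\<Omega>. (S z)\<^sup>2) \<le> (M\<^sup>2 + L * M) * real (card \<Omega>)" using pair by simp
  have "(\<Sum>z\<in>\<Omega>. (S z - M)\<^sup>2) = (\<Sum>z\<in>\<Omega>. (S z)\<^sup>2) - 2 * M * (\<Sum>z\<in>\<Omega>. S z) + M\<^sup>2 * real (card \<Omega>)"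
    by (simp add: power2_diff sum.distrib sum_subtractf sum_distrib_left[symmetric] sum_distrib_right[symmetric] algebra_simps)
  also have "\<dots> \<le> L * M * real (card \<Omega>)"
    using S2 by (simp add: S1 power2_eq_square algebra_simps)
  finally have up: "(\<Sum>z\<in>\<Omega>. (S z - M)\<^sup>2) \<le> L * M * real (card \<Omega>)" .
  let ?B = "{z\<in>\<Omega>. \<forall>i\<in>I. z \<notin> E i}"
  have "real (card ?B) * M\<^sup>2 = (\<Sum>z\<in>?B. (S z - M)\<^sup>2)"
    by (simp add: S_def)
  also have "\<dots> \<le> (\<Sum>z\<in>\<Omega>. (S z - M)\<^sup>2)"
    by (rule sum_mono2) (use fin in auto)
  finally have "(real (card ?B) * M) * M \<le> (L * real (card \<Omega>)) * M"
    using up by (simp add: power2_eq_square algebra_simps)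
  then show ?thesis using M(2) by (simp add: mult_le_cancel_right)
qed

section \<open>Linear forms and their fractional digits\<close>

definition dot :: "'i set \<Rightarrow> ('i \<Rightarrow> 'a::comm_ring_1 fls) \<Rightarrow> ('i \<Rightarrow> 'a fls) \<Rightarrow> 'a fls" where
  "dot J x y = (\<Sum>l\<in>J. x l * y l)"

lemma dot_cong: "(\<And>l. l \<in> J \<Longrightarrow> y l = y' l) \<Longrightarrow> dot J x y = dot J x y'"
  unfolding dot_def by (rule sum.cong) auto

lemma dot_cong1: "(\<And>l. l \<in> J \<Longrightarrow> x l = x' l) \<Longrightarrow> dot J x y = dot J x' y"
  unfolding dot_def by (rule sum.cong) auto

lemma dot_diff: "dot J x (\<lambda>l. y l - y' l) = dot J x y - dot J x y'"
  by (simp add: dot_def sum_subtractf algebra_simps)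

lemma dot_add1: "dot J (\<lambda>l. x l + x' l) y = dot J x y + dot J x' y"
  by (simp add: dot_def sum.distrib algebra_simps)

lemma dot_scale: "dot J x (\<lambda>l. f * y l) = f * dot J x y"
  by (simp add: dot_def sum_distrib_left mult_ac)

lemma dot_vge:
  fixes x :: "'i \<Rightarrow> 'a::idom fls"
  assumes "\<And>l. l \<in> J \<Longrightarrow> vge a (x l)" "\<And>l. l \<in> J \<Longrightarrow> vge b (y l)" "c \<le> a + b"
  shows "vge c (dot J x y)"
  unfolding dot_def using assms by (intro vge_sum) (auto intro: vge_mult')

lemma cut_sum: "finite A \<Longrightarrow> cut a b (\<Sum>i\<in>A. f i) = (\<Sum>i\<in>A. cut a b (f i :: 'a::comm_ring_1 fls))"
proof (induction A rule: finite_induct)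
  case empty
  show ?case by (simp, rule fls_eqI) simp
qed (simp add: cut_add)

text \<open>Split \<open>x\<close> into its polynomial part, its first \<open>N\<close> digits and
  the rest. The polynomial part contributes a polynomial to the product, and the rest, enlarged by
  at most s^S, stays beyond digit \<open>M\<close>. Thus finitely many digits of the coefficients
  determine the digits of a linear form.\<close>

lemma cut_cut_mult:
  fixes q :: "'a::idom fls"
  assumes "q \<in> Zint" "vge (- int S) q" "M + S \<le> N"
  shows "cut 1 (int M) (cut 1 (int N) x * q) = cut 1 (int M) (x * q)"
proof -
  have 1: "ipart x * q \<in> Zint" by (intro Zint_mult ipart_Zint assms)
  have 2: "vge (int M + 1) ((x - ipart x - cut 1 (int N) x) * q)"
  proof (rule vge_mult')
    show "vge (int N + 1) (x - ipart x - cut 1 (int N) x)"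
      by (auto simp: vge_def ipart_nth)
  qed (use assms in auto)
  have "x * q = cut 1 (int N) x * q + ipart x * q + (x - ipart x - cut 1 (int N) x) * q"
    by (simp add: algebra_simps)
  then have "cut 1 (int M) (x * q) = cut 1 (int M) (cut 1 (int N) x * q) +
      cut 1 (int M) (ipart x * q) + cut 1 (int M) ((x - ipart x - cut 1 (int N) x) * q)"
    by (metis cut_add)
  then show ?thesis using cut_eq_0_Zint[OF 1] cut_eq_0_vge[OF 2] by simp
qed

lemma cut_dot:
  fixes q :: "'i \<Rightarrow> 'a::idom fls"
  assumes "finite J" "\<And>l. l \<in> J \<Longrightarrow> q l \<in> Zint" "\<And>l. l \<in> J \<Longrightarrow> vge (- int S) (q l)" "M + S \<le> N"
  shows "cut 1 (int M) (dot J (\<lambda>l\<in>J. cut 1 (int N) (x l)) q) = cut 1 (int M) (dot J x q)"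
  unfolding dot_def cut_sum[OF assms(1)]
  by (rule sum.cong) (use assms in \<open>auto intro!: cut_cut_mult\<close>)

lemma PiE_seg_transl:
  fixes w :: "'i \<Rightarrow> 'a::{comm_ring_1,finite} fls"
  assumes "finite J" "w \<in> J \<rightarrow>\<^sub>E seg a b"
  shows "bij_betw (\<lambda>z. \<lambda>l\<in>J. z l + w l) (J \<rightarrow>\<^sub>E seg a b) (J \<rightarrow>\<^sub>E seg a b)"
proof (rule bij_betwI[where g = "\<lambda>z. \<lambda>l\<in>J. z l - w l"])
  show "(\<lambda>z. \<lambda>l\<in>J. z l + w l) \<in> (J \<rightarrow>\<^sub>E seg a b) \<rightarrow> (J \<rightarrow>\<^sub>E seg a b)"
    using assms by (auto intro!: seg_add)
  show "(\<lambda>z. \<lambda>l\<in>J. z l - w l) \<in> (J \<rightarrow>\<^sub>E seg a b) \<rightarrow> (J \<rightarrow>\<^sub>E seg a b)"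
    using assms by (auto intro!: seg_diff)
next
  fix x assume x: "x \<in> J \<rightarrow>\<^sub>E (seg a b :: 'a fls set)"
  show "(\<lambda>l\<in>J. (\<lambda>l\<in>J. x l + w l) l - w l) = x"
    using x by (auto simp: PiE_def extensional_def fun_eq_iff)
  show "(\<lambda>l\<in>J. (\<lambda>l\<in>J. x l - w l) l + w l) = x"
    using x by (auto simp: PiE_def extensional_def fun_eq_iff)
qed

text \<open>The event that the linear form at \<open>q\<close> comes within s^(-M-1) of a
  polynomial.\<close>

definition slab :: "'i set \<Rightarrow> nat \<Rightarrow> ('i \<Rightarrow> 'a::comm_ring_1 fls) \<Rightarrow> nat \<Rightarrow> ('i \<Rightarrow> 'a fls) set" where
  "slab J N q M = {z \<in> J \<rightarrow>\<^sub>E seg 1 (int N). cut 1 (int M) (dot J z q) = 0}"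

text \<open>Taking the first \<open>M\<close> digits of \<open>dot J z q\<close> is additive in
  \<open>z\<close>, and onto because the coefficient at \<open>l0\<close> alone produces any value
  \<open>v\<close>, namely as \<open>v / q l0\<close>. So a slab has density exactly s^(-M).\<close>

lemma card_slab:
  fixes q :: "'i \<Rightarrow> 'a::{field,finite} fls"
  assumes J: "finite J" and q: "\<And>l. l \<in> J \<Longrightarrow> q l \<in> Zint" "\<And>l. l \<in> J \<Longrightarrow> vge (- int S) (q l)"
    and N: "M + S \<le> N" and nz: "l0 \<in> J" "q l0 \<noteq> 0"
  shows "card (slab J N q M) * CARD('a) ^ M = card (J \<rightarrow>\<^sub>E (seg 1 (int N) :: 'a fls set))"
proof -
  let ?\<Omega> = "J \<rightarrow>\<^sub>E (seg 1 (int N) :: 'a fls set)"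
  let ?f = "\<lambda>z. cut 1 (int M) (dot J z q)"
  have "card {z\<in>?\<Omega>. ?f z = 0} * card (seg 1 (int M) :: 'a fls set) = card ?\<Omega>"
  proof (rule card_kernel)
    show "finite ?\<Omega>" by (intro finite_PiE J finite_seg)
    show "?f ` ?\<Omega> = seg 1 (int M)"
    proof (intro set_eqI iffI)
      fix v :: "'a fls" assume v: "v \<in> seg 1 (int M)"
      define x where "x l = (if l = l0 then v / q l0 else 0)" for l
      have "dot J x q = (\<Sum>l\<in>J. if l = l0 then v else 0)"
        unfolding dot_def by (rule sum.cong) (use nz in \<open>auto simp: x_def\<close>)
      then have "dot J x q = v" using nz J by simp
      then have "?f (\<lambda>l\<in>J. cut 1 (int N) (x l)) = v"
        using cut_dot[OF J q N, where x = x] cut_seg_eq[OF v] by simp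
      then show "v \<in> ?f ` ?\<Omega>" by (intro image_eqI[where x = "\<lambda>l\<in>J. cut 1 (int N) (x l)"]) auto
    qed auto
    fix w assume "w \<in> ?\<Omega>"
    then show "\<exists>\<tau>. bij_betw \<tau> ?\<Omega> ?\<Omega> \<and> (\<forall>z\<in>?\<Omega>. ?f (\<tau> z) = ?f z + ?f w)"
      using PiE_seg_transl[OF J, of w]
      by (intro exI[of _ "\<lambda>z. \<lambda>l\<in>J. z l + w l"])
         (auto simp: cut_add[symmetric] dot_add1[symmetric] intro!: arg_cong[where f = "cut _ _"] dot_cong1)
  qed
  then show ?thesis by (simp add: slab_def card_seg)
qed

text \<open>Exact independence: with a nonzero minor, Cramer's rule prescribes both linear forms
  through the coordinates \<open>l0\<close> and \<open>l1\<close>, so the pair of digit strings is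
  equidistributed too.\<close>

lemma card_slab_pair:
  fixes q q' :: "'i \<Rightarrow> 'a::{field,finite} fls"
  assumes J: "finite J" and q: "\<And>l. l \<in> J \<Longrightarrow> q l \<in> Zint" "\<And>l. l \<in> J \<Longrightarrow> vge (- int S) (q l)"
    and q': "\<And>l. l \<in> J \<Longrightarrow> q' l \<in> Zint" "\<And>l. l \<in> J \<Longrightarrow> vge (- int S) (q' l)"
    and N: "M + S \<le> N" "M' + S \<le> N"
    and nz: "l0 \<in> J" "l1 \<in> J" "q l0 * q' l1 \<noteq> q l1 * q' l0"
  shows "card (slab J N q M \<inter> slab J N q' M') * (CARD('a) ^ M * CARD('a) ^ M') = card (J \<rightarrow>\<^sub>E (seg 1 (int N) :: 'a fls set))"
proof -
  let ?\<Omega> = "J \<rightarrow>\<^sub>E (seg 1 (int N) :: 'a fls set)"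
  let ?f = "\<lambda>z. (cut 1 (int M) (dot J z q), cut 1 (int M') (dot J z q'))"
  let ?V = "(seg 1 (int M) :: 'a fls set) \<times> (seg 1 (int M') :: 'a fls set)"
  define \<Delta> where "\<Delta> = q l0 * q' l1 - q l1 * q' l0"
  have \<Delta>: "\<Delta> \<noteq> 0" using nz by (simp add: \<Delta>_def)
  have ne: "l0 \<noteq> l1" using nz by auto
  have "card {z\<in>?\<Omega>. ?f z = 0} * card ?V = card ?\<Omega>"
  proof (rule card_kernel)
    show "finite ?\<Omega>" by (intro finite_PiE J finite_seg)
    show "?f ` ?\<Omega> = ?V"
    proof (intro set_eqI iffI)
      fix vw assume "vw \<in> ?V"
      then obtain v w where vw: "vw = (v, w)" "v \<in> seg 1 (int M)" "w \<in> seg 1 (int M')" by auto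
      define x where "x l = (if l = l0 then (v * q' l1 - w * q l1) / \<Delta> else if l = l1 then (w * q l0 - v * q' l0) / \<Delta> else 0)" for l
      have dx: "dot J x y = (v * q' l1 - w * q l1) / \<Delta> * y l0 + (w * q l0 - v * q' l0) / \<Delta> * y l1" for y
      proof -
        have "dot J x y = dot {l0, l1} x y"
          unfolding dot_def using nz J by (intro sum.mono_neutral_right) (auto simp: x_def)
        then show ?thesis using ne by (simp add: dot_def x_def)
      qed
      have "dot J x q * \<Delta> = v * \<Delta>" "dot J x q' * \<Delta> = w * \<Delta>"
        unfolding dx using \<Delta> by (simp_all add: distrib_right) (simp_all add: \<Delta>_def algebra_simps)
      then have "dot J x q = v" "dot J x q' = w" using \<Delta> by auto
      then have "?f (\<lambda>l\<in>J. cut 1 (int N) (x l)) = vw"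
        using cut_dot[OF J q N(1), where x = x] cut_dot[OF J q' N(2), where x = x] cut_seg_eq[OF vw(2)] cut_seg_eq[OF vw(3)]
          vw(1) by simp
      then show "vw \<in> ?f ` ?\<Omega>" by (intro image_eqI[where x = "\<lambda>l\<in>J. cut 1 (int N) (x l)"]) auto
    qed auto
    fix w assume "w \<in> ?\<Omega>"
    then show "\<exists>\<tau>. bij_betw \<tau> ?\<Omega> ?\<Omega> \<and> (\<forall>z\<in>?\<Omega>. ?f (\<tau> z) = ?f z + ?f w)"
      using PiE_seg_transl[OF J, of w]
      by (intro exI[of _ "\<lambda>z. \<lambda>l\<in>J. z l + w l"])
         (auto simp: cut_add[symmetric] dot_add1[symmetric] intro!: arg_cong[where f = "cut _ _"] dot_cong1)
  qed
  moreover have "{z\<in>?\<Omega>. ?f z = 0} = slab J N q M \<inter> slab J N q' M'" by (auto simp: slab_def zero_prod_def)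
  ultimately show ?thesis by (simp add: card_seg card_cartesian_product)
qed

text \<open>Subtracting the polynomial part clears the indices up to 0 and the slab clears 1 to
  \<open>M\<close>; the first index left is \<open>Suc M\<close>.\<close>

lemma slab_imp_near:
  assumes "z \<in> slab J N q M"
  shows "\<exists>p\<in>Zint. vge (int (Suc M)) (p + dot J z q)"
proof (intro bexI)
  show "vge (int (Suc M)) (- ipart (dot J z q) + dot J z q)"
    unfolding vge_def
  proof (intro allI impI)
    fix n assume n: "n < int (Suc M)"
    have "cut 1 (int M) (dot J z q) $$ n = 0" using assms by (simp add: slab_def)
    then show "(- ipart (dot J z q) + dot J z q) $$ n = 0"
      using n by (auto simp: ipart_nth split: if_splits)
  qed
qed (intro Zint_uminus ipart_Zint)

section \<open>Lattice points in shells\<close>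

text \<open>Mutually inverse matrices on a subset \<open>J\<close> of the index type. Bounding both
  by s^e makes \<open>D\<close> distort sizes by at most s^e in either direction.\<close>

definition inv_pair :: "nat \<Rightarrow> 'i set \<Rightarrow> ('i \<Rightarrow> 'i \<Rightarrow> 'a::comm_ring_1 fls) \<Rightarrow> ('i \<Rightarrow> 'i \<Rightarrow> 'a fls) \<Rightarrow> bool" where
  "inv_pair e J D D' \<longleftrightarrow>
     (\<forall>i\<in>J. \<forall>l\<in>J. vge (- int e) (D i l) \<and> vge (- int e) (D' i l)) \<and>
     (\<forall>i\<in>J. \<forall>k\<in>J. (\<Sum>l\<in>J. D i l * D' l k) = of_bool (i = k)) \<and>
     (\<forall>i\<in>J. \<forall>k\<in>J. (\<Sum>l\<in>J. D' i l * D l k) = of_bool (i = k))"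

lemma inv_pair_sym: "inv_pair e J D D' \<Longrightarrow> inv_pair e J D' D"
  by (auto simp: inv_pair_def)

lemma inv_pair_vge: "inv_pair e J D D' \<Longrightarrow> i \<in> J \<Longrightarrow> l \<in> J \<Longrightarrow> vge (- int e) (D i l)"
  by (auto simp: inv_pair_def)

lemma inv_pair_app:
  assumes "inv_pair e J D D'" "finite J" "i \<in> J"
  shows "dot J (D i) (\<lambda>l. dot J (D' l) u) = u i"
proof -
  have "dot J (D i) (\<lambda>l. dot J (D' l) u) = (\<Sum>l\<in>J. \<Sum>k\<in>J. D i l * D' l k * u k)"
    unfolding dot_def by (simp add: sum_distrib_left mult.assoc)
  also have "\<dots> = (\<Sum>k\<in>J. (\<Sum>l\<in>J. D i l * D' l k) * u k)"
    by (subst sum.swap) (simp add: sum_distrib_right)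
  also have "\<dots> = (\<Sum>k\<in>J. if k = i then u k else 0)"
    by (rule sum.cong) (use assms in \<open>auto simp: inv_pair_def\<close>)
  also have "\<dots> = u i" using assms by simp
  finally show ?thesis .
qed

text \<open>w = D' (D w), and the entries of \<open>D'\<close> are at most s^e.\<close>

lemma inv_pair_vge_arg:
  fixes w :: "'i \<Rightarrow> 'a::idom fls"
  assumes "inv_pair e J D D'" "finite J" "\<And>i. i \<in> J \<Longrightarrow> vge b (dot J (D i) w)" "l \<in> J"
  shows "vge (b - int e) (w l)"
proof -
  have "vge (b - int e) (dot J (D' l) (\<lambda>i. dot J (D i) w))"
    by (rule dot_vge[where a = "- int e" and b = b])
       (use assms inv_pair_vge[OF inv_pair_sym[OF assms(1)]] in auto)
  then show ?thesis using inv_pair_app[OF inv_pair_sym[OF assms(1)] assms(2,4)] by simp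
qed

text \<open>The exponents are integers because dividing a vector by a polynomial of large degree
  makes them negative.\<close>

definition box :: "'i set \<Rightarrow> ('i \<Rightarrow> 'i \<Rightarrow> 'a::comm_ring_1 fls) \<Rightarrow> ('i \<Rightarrow> int) \<Rightarrow> ('i \<Rightarrow> 'a fls) set" where
  "box J D a = {w \<in> J \<rightarrow>\<^sub>E Zint. \<forall>i\<in>J. vge (- a i) (dot J (D i) w)}"

definition shell :: "'i set \<Rightarrow> ('i \<Rightarrow> 'i \<Rightarrow> 'a::comm_ring_1 fls) \<Rightarrow> ('i \<Rightarrow> nat) \<Rightarrow> ('i \<Rightarrow> 'a fls) set" where
  "shell J D t = {w \<in> J \<rightarrow>\<^sub>E Zint. \<forall>i\<in>J. veq (- int (t i)) (dot J (D i) w)}"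

text \<open>The digits of \<open>D w\<close> up to index \<open>e\<close> determine
  \<open>w\<close>: two vectors that agree there differ by a polynomial vector of absolute value at
  most 1/s, hence by 0.\<close>

lemma card_box:
  fixes D :: "'i \<Rightarrow> 'i \<Rightarrow> 'a::{field,finite} fls"
  assumes D: "inv_pair e J D D'" and J: "finite J"
  shows "finite (box J D a)" "card (box J D a) \<le> (\<Prod>i\<in>J. CARD('a) ^ nat (a i + int e + 1))"
proof -
  let ?f = "\<lambda>w. \<lambda>i\<in>J. cut (- a i) (int e) (dot J (D i) w)"
  let ?R = "PiE J (\<lambda>i. seg (- a i) (int e) :: 'a fls set)"
  have inj: "inj_on ?f (box J D a)"
  proof (rule inj_onI)
    fix w w' assume w: "w \<in> box J D a" "w' \<in> box J D a" and eq: "?f w = ?f w'"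
    have "vge (int e + 1) (dot J (D i) (\<lambda>l. w l - w' l))" if i: "i \<in> J" for i
      unfolding vge_def
    proof (intro allI impI)
      fix n assume n: "n < int e + 1"
      have "cut (- a i) (int e) (dot J (D i) w) = cut (- a i) (int e) (dot J (D i) w')"
        using fun_cong[OF eq, of i] i by simp
      then have "cut (- a i) (int e) (dot J (D i) w) $$ n = cut (- a i) (int e) (dot J (D i) w') $$ n" by simp
      then show "dot J (D i) (\<lambda>l. w l - w' l) $$ n = 0"
        using n w i by (cases "n < - a i") (auto simp: dot_diff box_def vge_def)
    qed
    then have "vge (int e + 1 - int e) (w l - w' l)" if "l \<in> J" for l
      using inv_pair_vge_arg[OF D J, of "int e + 1" "\<lambda>l. w l - w' l"] that by blast
    moreover have "w l - w' l \<in> Zint" if "l \<in> J" for l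
      using w that by (auto simp: box_def intro!: Zint_diff)
    ultimately have "w l - w' l = 0" if "l \<in> J" for l
      using that Zint_vge_eq_0 by force
    then show "w = w'"
      using w by (intro PiE_ext[of w J "\<lambda>_. Zint" w']) (auto simp: box_def)
  qed
  have im: "?f ` box J D a \<subseteq> ?R" by auto
  have fin: "finite ?R" by (intro finite_PiE J finite_seg)
  show "finite (box J D a)" using inj im fin by (meson finite_imageD finite_subset)
  have "card (box J D a) \<le> card ?R" by (rule card_inj_on_le[OF inj im fin])
  also have "card ?R = (\<Prod>i\<in>J. CARD('a) ^ nat (a i + int e + 1))"
    using J by (simp add: card_PiE card_seg algebra_simps)
  finally show "card (box J D a) \<le> (\<Prod>i\<in>J. CARD('a) ^ nat (a i + int e + 1))" .
qed

lemma shell_box: "shell J D t \<subseteq> box J D (\<lambda>i. int (t i))"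
  by (auto simp: shell_def box_def veq_def)

text \<open>Rounding \<open>D' u\<close> to a polynomial vector \<open>w\<close> moves
  \<open>D w\<close> away from \<open>u\<close> by at most s^(e-1). If \<open>u i\<close> has
  leading term X^(t i) and free digits at indices up to -e, rounding spoils neither, so distinct
  \<open>u\<close> yield distinct vectors of the shell.\<close>

lemma card_shell_ge:
  fixes D :: "'i \<Rightarrow> 'i \<Rightarrow> 'a::{field,finite} fls"
  assumes D: "inv_pair e J D D'" and J: "finite J" and t: "\<And>i. i \<in> J \<Longrightarrow> e \<le> t i"
  shows "(\<Prod>i\<in>J. CARD('a) ^ (t i - e)) \<le> card (shell J D t)"
proof -
  let ?U = "PiE J (\<lambda>i. (\<lambda>g. Xpow (int (t i)) + g) ` (seg (1 - int (t i)) (- int e) :: 'a fls set))"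
  let ?W = "\<lambda>u. \<lambda>l\<in>J. ipart (dot J (D' l) u)"
  define F where "F u = (\<lambda>l. dot J (D' l) u - ipart (dot J (D' l) u))" for u
  have app: "dot J (D i) (?W u) = u i - dot J (D i) (F u)" if "i \<in> J" for i u
  proof -
    have "dot J (D i) (?W u) = dot J (D i) (\<lambda>l. dot J (D' l) u - F u l)"
      by (rule dot_cong) (simp add: F_def)
    then show ?thesis using inv_pair_app[OF D J that] by (simp add: dot_diff)
  qed
  have small: "vge (1 - int e) (dot J (D i) (F u))" if "i \<in> J" for i u
    by (rule dot_vge[where a = "- int e" and b = 1])
       (use that inv_pair_vge[OF D] in \<open>auto simp: F_def vge_fpart\<close>)
  have inj: "inj_on ?W ?U"
  proof (rule inj_onI)
    fix u u' assume u: "u \<in> ?U" "u' \<in> ?U" and eq: "?W u = ?W u'"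
    have "u i = u' i" if i: "i \<in> J" for i
    proof -
      obtain g g' where g: "u i = Xpow (int (t i)) + g" "u' i = Xpow (int (t i)) + g'"
        "g \<in> seg (1 - int (t i)) (- int e)" "g' \<in> seg (1 - int (t i)) (- int e)"
        using u i by (blast dest: PiE_mem)
      have "u i - u' i = dot J (D i) (F u) - dot J (D i) (F u')"
        using app[OF i, of u] app[OF i, of u'] eq by (simp add: algebra_simps)
      then have v: "vge (1 - int e) (u i - u' i)" using small[OF i] by (simp add: vge_diff)
      have "u i - u' i \<in> seg (1 - int (t i)) (- int e)"
        using g by (simp add: seg_diff)
      then have "cut (1 - int (t i)) (- int e) (u i - u' i) = u i - u' i" by (rule cut_seg_eq)
      moreover have "cut (1 - int (t i)) (- int e) (u i - u' i) = 0"
        by (rule cut_eq_0_vge) (use v in \<open>simp add: algebra_simps\<close>)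
      ultimately show ?thesis by simp
    qed
    then show "u = u'" using u by (intro PiE_ext[OF u]) auto
  qed
  have im: "?W ` ?U \<subseteq> shell J D t"
  proof
    fix w assume "w \<in> ?W ` ?U"
    then obtain u where u: "u \<in> ?U" and w: "w = ?W u" by blast
    have "w \<in> J \<rightarrow>\<^sub>E Zint" unfolding w by (auto simp: ipart_Zint)
    moreover have "veq (- int (t i)) (dot J (D i) w)" if i: "i \<in> J" for i
    proof -
      obtain g where g: "u i = Xpow (int (t i)) + g" "g \<in> seg (1 - int (t i)) (- int e)"
        using u i by (blast dest: PiE_mem)
      have "veq (- int (t i)) (u i)"
        unfolding g(1) by (rule veq_add[OF veq_Xpow seg_vge[OF g(2)]]) simp
      then show ?thesis unfolding w app[OF i]
        by (rule veq_diff[OF _ small[OF i]]) (use t[OF i] in simp)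
    qed
    ultimately show "w \<in> shell J D t" by (simp add: shell_def)
  qed
  have "card ?U = (\<Prod>i\<in>J. CARD('a) ^ (t i - e))"
    unfolding card_PiE[OF J]
  proof (rule prod.cong[OF refl])
    fix i assume "i \<in> J"
    have "card ((\<lambda>g. Xpow (int (t i)) + g) ` (seg (1 - int (t i)) (- int e) :: 'a fls set)) =
       card (seg (1 - int (t i)) (- int e) :: 'a fls set)"
      by (rule card_image) (auto simp: inj_on_def)
    also have "\<dots> = CARD('a) ^ (t i - e)"
      unfolding card_seg by (rule arg_cong[where f = "\<lambda>n. _ ^ n"]) linarith
    finally show "card ((\<lambda>g. Xpow (int (t i)) + g) ` (seg (1 - int (t i)) (- int e) :: 'a fls set)) = CARD('a) ^ (t i - e)" .
  qed
  moreover have "card ?U \<le> card (shell J D t)"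
    by (rule card_inj_on_le[OF inj im finite_subset[OF shell_box card_box(1)[OF D J]]])
  ultimately show ?thesis by simp
qed

text \<open>
  Vectors with a polynomial divisor of degree larger than \<open>b0\<close>. Once they are discarded, every line
  contains boundedly many of the remaining vectors, so the slabs that are not independent of a given
  one contribute only a bounded multiple of the mean to the variance.
\<close>

definition nonprim :: "'i set \<Rightarrow> ('i \<Rightarrow> 'i \<Rightarrow> 'a::comm_ring_1 fls) \<Rightarrow> nat \<Rightarrow> ('i \<Rightarrow> nat) \<Rightarrow> ('i \<Rightarrow> 'a fls) set" where
  "nonprim J D b0 t = {q \<in> shell J D t. \<exists>f\<in>Zint. \<exists>w\<in>J \<rightarrow>\<^sub>E Zint. \<exists>b>b0. veq (- int b) f \<and> q = (\<lambda>l\<in>J. f * w l)}"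

text \<open>Division by a factor of degree \<open>b\<close> shrinks every coordinate of
  \<open>D q\<close> by s^b. For \<open>b\<close> beyond \<open>\<tau> + e\<close> the quotient
  would be a polynomial vector smaller than 1, that is 0, although \<open>q\<close> is not.\<close>

lemma nonprim_subset:
  fixes D :: "'i \<Rightarrow> 'i \<Rightarrow> 'a::{field,finite} fls"
  assumes D: "inv_pair e J D D'" and J: "finite J" "J \<noteq> {}" and t: "\<And>i. i \<in> J \<Longrightarrow> t i \<le> \<tau>"
  shows "nonprim J D b0 t \<subseteq> (\<Union>b\<in>{b0<..\<tau> + e}. (\<lambda>(f,w). \<lambda>l\<in>J. f * w l) `
            (seg (- int b) 0 \<times> box J D (\<lambda>i. int (t i) - int b)))"
proof
  fix q assume q: "q \<in> nonprim J D b0 t"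
  then obtain f w b where fw: "f \<in> Zint" "w \<in> J \<rightarrow>\<^sub>E Zint" "b > b0" "veq (- int b) f" "q = (\<lambda>l\<in>J. f * w l)"
    and qt: "q \<in> shell J D t" by (auto simp: nonprim_def)
  have dq: "dot J (D i) q = f * dot J (D i) w" for i
    unfolding fw(5) dot_scale[symmetric] by (rule dot_cong) simp
  have w: "vge (int b - int (t i)) (dot J (D i) w)" if i: "i \<in> J" for i
    using vge_mult_cancel[OF fw(4), of "- int (t i)" "dot J (D i) w"] qt i veq_vge
    by (auto simp: shell_def dq)
  have wb: "w \<in> box J D (\<lambda>i. int (t i) - int b)"
    using w fw(2) by (simp add: box_def)
  have "b \<le> \<tau> + e"
  proof (rule ccontr)
    assume b: "\<not> b \<le> \<tau> + e"
    have "vge (int b - int \<tau> - int e) (w l)" if "l \<in> J" for l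
    proof (rule inv_pair_vge_arg[OF D J(1) _ that])
      fix i assume i: "i \<in> J"
      show "vge (int b - int \<tau>) (dot J (D i) w)"
        by (rule vge_mono[OF w[OF i]]) (use t[OF i] in simp)
    qed
    then have "vge 1 (w l)" if "l \<in> J" for l
      using that b by (force intro: vge_mono)
    then have "w l = 0" if "l \<in> J" for l
      using that fw(2) by (intro Zint_vge_eq_0) auto
    then have "dot J (D i) q = 0" for i by (simp add: dq) (simp add: dot_def)
    then show False using qt J(2) by (auto simp: shell_def veq_def)
  qed
  then show "q \<in> (\<Union>b\<in>{b0<..\<tau> + e}. (\<lambda>(f,w). \<lambda>l\<in>J. f * w l) `
            (seg (- int b) 0 \<times> box J D (\<lambda>i. int (t i) - int b)))"
    using fw wb Zint_vge_seg[OF fw(1) veq_vge[OF fw(4)]] by (intro UN_I[of b]) force+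
qed

text \<open>At most s^(b+1) factors have degree \<open>b\<close>. The largest coordinate
  \<open>i0\<close> saves s^(b-e-1), which offsets their number up to a constant; the coordinate
  \<open>i1\<close> has to save once more to make the sum over b > b0 small. It does, unless its
  range has become trivial, and then it saves at least s^(\<tau>/2).\<close>

lemma card_nonprim:
  fixes D :: "'i \<Rightarrow> 'i \<Rightarrow> 'a::{field,finite} fls"
  defines "s \<equiv> real CARD('a)"
  assumes D: "inv_pair e J D D'" and J: "finite J" and t: "\<And>i. i \<in> J \<Longrightarrow> t i \<le> \<tau>"
    and i01: "i0 \<in> J" "i1 \<in> J" "i0 \<noteq> i1" "t i0 = \<tau>" "\<tau> div 2 \<le> t i1" and b0: "b0 \<ge> e + 1"
  shows "real (card (nonprim J D b0 t)) \<le>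
     s ^ (\<Sum>i\<in>J. t i) * (s ^ (e + 2) * real (\<tau> + e) * (1/s) ^ (\<tau> div 2) + s ^ (2*e+3) * (1/s) ^ b0)"
proof -
  have s2: "s \<ge> 2" using card_field_ge_2[where 'a='a] by (simp add: s_def)
  have Jne: "J \<noteq> {}" using i01 by auto
  let ?B = "\<lambda>b. box J D (\<lambda>i. int (t i) - int b)"
  have fin: "finite (?B b)" for b by (rule card_box(1)[OF D J])
  have "card (nonprim J D b0 t) \<le> card (\<Union>b\<in>{b0<..\<tau> + e}. (\<lambda>(f,w). \<lambda>l\<in>J. f * w l) `
            (seg (- int b) 0 \<times> ?B b))"
    by (rule card_mono[OF _ nonprim_subset[OF D J Jne t]]) (auto intro!: finite_seg fin)
  also have "\<dots> \<le> (\<Sum>b\<in>{b0<..\<tau> + e}. card ((\<lambda>(f,w). \<lambda>l\<in>J. f * w l) ` ((seg (- int b) 0 :: 'a fls set) \<times> ?B b)))"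
    by (rule card_UN_le) simp
  also have "\<dots> \<le> (\<Sum>b\<in>{b0<..\<tau> + e}. card ((seg (- int b) 0 :: 'a fls set) \<times> ?B b))"
    by (intro sum_mono card_image_le finite_cartesian_product finite_seg fin)
  also have "\<dots> \<le> (\<Sum>b\<in>{b0<..\<tau> + e}. CARD('a) ^ (b + 1) * (\<Prod>i\<in>J. CARD('a) ^ nat (int (t i) - int b + int e + 1)))"
    using card_box(2)[OF D J] by (intro sum_mono) (auto simp: card_cartesian_product card_seg nat_add_distrib)
  finally have "real (card (nonprim J D b0 t)) \<le>
      real (\<Sum>b\<in>{b0<..\<tau> + e}. CARD('a) ^ (b + 1) * (\<Prod>i\<in>J. CARD('a) ^ nat (int (t i) - int b + int e + 1)))"
    by (rule of_nat_mono)
  also have "\<dots> = (\<Sum>b\<in>{b0<..\<tau> + e}. s ^ (b + 1) * (\<Prod>i\<in>J. s ^ nat (int (t i) - int b + int e + 1)))"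
    by (simp add: s_def)
  also have "\<dots> \<le> (\<Sum>b\<in>{b0<..\<tau> + e}. s ^ (\<Sum>i\<in>J. t i) * (s ^ (e+2) * (1/s) ^ (\<tau> div 2) + s ^ (2*e+3) * (1/s) ^ b))"
  proof (rule sum_mono)
    fix b assume b: "b \<in> {b0<..\<tau> + e}"
    let ?g = "\<lambda>i. s ^ nat (int (t i) - int b + int e + 1)"
    define r where "r = s ^ (e+1) * (1/s) ^ b"
    have rpos: "r > 0" using s2 by (simp add: r_def)
    have Js: "J = insert i0 (insert i1 (J - {i0, i1}))" using i01 by auto
    have split: "prod f J = f i0 * f i1 * prod f (J - {i0,i1})" for f :: "'i \<Rightarrow> real"
      by (subst Js, subst prod.insert, use J i01 in simp, use i01 in simp, subst prod.insert) (use J in auto)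
    \<comment> \<open>Since b <= \<tau> + e, the difference is positive and \<open>nat\<close> does
      not truncate.\<close>
    have g0: "?g i0 = s ^ t i0 * r"
    proof -
      have "nat (int (t i0) - int b + int e + 1) + b = t i0 + (e + 1)"
        using b i01 by auto
      then have "?g i0 * s ^ b = s ^ t i0 * s ^ (e+1)"
        by (metis power_add)
      then show ?thesis using s2 by (simp add: r_def power_divide field_simps)
    qed
    have g1: "?g i1 \<le> s ^ t i1 * ((1/s) ^ (\<tau> div 2) + r)"
    proof (cases "int (t i1) - int b + int e + 1 \<ge> 0")
      case True
      then have "nat (int (t i1) - int b + int e + 1) + b = t i1 + (e + 1)" by auto
      then have "?g i1 * s ^ b = s ^ t i1 * s ^ (e+1)"
        by (metis power_add)
      then have "?g i1 = s ^ t i1 * r" using s2 by (simp add: r_def power_divide field_simps)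
      then show ?thesis using s2 by (simp add: distrib_left)
    next
      case False
      then have "?g i1 = 1" by simp
      also have "1 \<le> s ^ t i1 * (1/s) ^ (\<tau> div 2)"
      proof -
        have "s ^ (\<tau> div 2) \<le> s ^ t i1" using s2 i01 by (intro power_increasing) auto
        then show ?thesis using s2 by (simp add: power_divide field_simps)
      qed
      also have "\<dots> \<le> s ^ t i1 * ((1/s) ^ (\<tau> div 2) + r)" using rpos s2 by (intro mult_left_mono) auto
      finally show ?thesis .
    qed
    have g2: "prod ?g (J - {i0,i1}) \<le> prod (\<lambda>i. s ^ t i) (J - {i0,i1})"
      using s2 b b0 by (intro prod_mono conjI power_increasing) auto
    have "prod ?g J \<le> (s ^ t i0 * r) * (s ^ t i1 * ((1/s) ^ (\<tau> div 2) + r)) * prod (\<lambda>i. s ^ t i) (J - {i0,i1})"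
      unfolding split[of ?g] g0 using g1 g2 s2 rpos
      by (intro mult_mono mult_nonneg_nonneg prod_nonneg) auto
    also have "\<dots> = s ^ (\<Sum>i\<in>J. t i) * (r * ((1/s) ^ (\<tau> div 2) + r))"
      unfolding power_sum split[of "\<lambda>i. s ^ t i"] by (simp add: mult_ac)
    finally have "s ^ (b+1) * prod ?g J \<le> s ^ (b+1) * (s ^ (\<Sum>i\<in>J. t i) * (r * ((1/s) ^ (\<tau> div 2) + r)))"
      using s2 by (intro mult_left_mono) auto
    also have "\<dots> = s ^ (\<Sum>i\<in>J. t i) * ((s ^ (b+1) * r) * ((1/s) ^ (\<tau> div 2) + r))"
      by (simp add: mult_ac)
    also have "s ^ (b+1) * r = s ^ (e+2)" using s2 by (simp add: r_def power_divide field_simps power_add)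
    also have "s ^ (e+2) * ((1/s) ^ (\<tau> div 2) + r) = s ^ (e+2) * (1/s) ^ (\<tau> div 2) + s ^ (2*e+3) * (1/s) ^ b"
    proof -
      have "s ^ (e+2) * s ^ (e+1) = s ^ (2*e+3)"
      proof -
        have "(e + 2) + (e + 1) = 2 * e + 3" by simp
        then show ?thesis by (metis power_add)
      qed
      then show ?thesis by (simp add: r_def distrib_left mult.assoc[symmetric])
    qed
    finally show "s ^ (b+1) * prod ?g J \<le> s ^ (\<Sum>i\<in>J. t i) * (s ^ (e+2) * (1/s) ^ (\<tau> div 2) + s ^ (2*e+3) * (1/s) ^ b)" .
  qed
  also have "\<dots> = s ^ (\<Sum>i\<in>J. t i) * (s ^ (e+2) * real (card {b0<..\<tau> + e}) * (1/s) ^ (\<tau> div 2) + s ^ (2*e+3) * (\<Sum>b\<in>{b0<..\<tau> + e}. (1/s) ^ b))"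
    by (simp only: sum_distrib_left[symmetric] sum.distrib sum_constant) (simp only: mult_ac)
  also have "\<dots> \<le> s ^ (\<Sum>i\<in>J. t i) * (s ^ (e + 2) * real (\<tau> + e) * (1/s) ^ (\<tau> div 2) + s ^ (2*e+3) * (1/s) ^ b0)"
  proof (intro mult_left_mono add_mono mult_right_mono)
    have "(\<Sum>b\<in>{b0<..n}. (1/s) ^ b) \<le> (1/s) ^ b0 - (1/s) ^ n" if "b0 \<le> n" for n
      using that
    proof (induction n rule: dec_induct)
      case (step n)
      have "{b0<..Suc n} = insert (Suc n) {b0<..n}" using step by auto
      then have "(\<Sum>b\<in>{b0<..Suc n}. (1/s) ^ b) \<le> (1/s) ^ Suc n + ((1/s) ^ b0 - (1/s) ^ n)"
        using step by simp
      moreover have "2 * (1/s) ^ Suc n \<le> (1/s) ^ n" using s2 by (simp add: field_simps)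
      ultimately show ?case by simp
    qed simp
    note * = this
    show "(\<Sum>b\<in>{b0<..\<tau> + e}. (1/s) ^ b) \<le> (1/s) ^ b0"
    proof (cases "b0 \<le> \<tau> + e")
      case True
      have "(1/s) ^ (\<tau> + e) \<ge> 0" using s2 by simp
      with *[OF True] show ?thesis by linarith
    qed (use s2 in auto)
  qed (use s2 in auto)
  finally show ?thesis .
qed

section \<open>Vectors on a common line\<close>

definition proportional :: "'i set \<Rightarrow> ('i \<Rightarrow> 'a::comm_ring_1 fls) \<Rightarrow> ('i \<Rightarrow> 'a fls) \<Rightarrow> bool" where
  "proportional J q q' \<longleftrightarrow> (\<forall>l\<in>J. \<forall>k\<in>J. q l * q' k = q k * q' l)"

text \<open>The polynomial vectors on a line form a module of rank one over a Euclidean ring. A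
  vector \<open>w\<close> on it with \<open>w l0\<close> nonzero of least degree generates it: the
  remainder of a division in coordinate \<open>l0\<close> vanishes by minimality, and
  proportionality carries this to the other coordinates.\<close>

lemma line_generator:
  fixes q :: "'i \<Rightarrow> 'a::{field,finite} fls"
  assumes q: "q \<in> J \<rightarrow>\<^sub>E Zint" and l0: "l0 \<in> J" "q l0 \<noteq> 0"
  shows "\<exists>w\<in>J \<rightarrow>\<^sub>E Zint. \<forall>q'\<in>J \<rightarrow>\<^sub>E Zint. proportional J q q' \<longrightarrow> (\<exists>c\<in>Zint. q' = (\<lambda>l\<in>J. c * w l))"
proof -
  let ?W = "\<lambda>w. w \<in> J \<rightarrow>\<^sub>E Zint \<and> proportional J q w \<and> w l0 \<noteq> 0"
  define \<mu> where "\<mu> w = nat (- fls_subdegree (w l0))" for w :: "'i \<Rightarrow> 'a fls"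
  have "?W q" using q l0 by (auto simp: proportional_def)
  then obtain w where w: "?W w" and min: "\<And>w'. ?W w' \<Longrightarrow> \<mu> w \<le> \<mu> w'"
    using ex_has_least_nat[of ?W q \<mu>] by blast
  have "\<exists>c\<in>Zint. q' = (\<lambda>l\<in>J. c * w l)" if q': "q' \<in> J \<rightarrow>\<^sub>E Zint" and pr: "proportional J q q'" for q'
  proof -
    define c where "c = ipart (q' l0 / w l0)"
    have cZ: "c \<in> Zint" by (simp add: c_def ipart_Zint)
    define r where "r = (\<lambda>l\<in>J. q' l - c * w l)"
    have rZ: "r \<in> J \<rightarrow>\<^sub>E Zint" using q' w cZ by (auto simp: r_def intro!: Zint_diff Zint_mult)
    have rp: "proportional J q r"
      unfolding proportional_def
    proof (intro ballI)
      fix l k assume lk: "l \<in> J" "k \<in> J"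
      have "q l * q' k = q k * q' l" "q l * w k = q k * w l"
        using pr w lk by (auto simp: proportional_def)
      then have "q l * q' k - c * (q l * w k) = q k * q' l - c * (q k * w l)" by simp
      then show "q l * r k = q k * r l" using lk by (simp add: r_def algebra_simps)
    qed
    have r0: "r l0 = (q' l0 / w l0 - c) * w l0"
      using w l0 by (simp add: r_def algebra_simps)
    have "r l0 = 0"
    proof (rule ccontr)
      assume nz: "r l0 \<noteq> 0"
      obtain m where m: "veq m (w l0)" using w veq_exists by blast
      have "vge (1 + m) (r l0)" unfolding r0 c_def by (intro vge_mult vge_fpart veq_vge[OF m])
      moreover obtain k where k: "veq k (r l0)" using nz veq_exists by blast
      ultimately have "m < k" using veq_vge_le by force
      moreover have "k \<le> 0" "m \<le> 0" using k m rZ w l0 Zint_veq_nonpos by (blast dest: PiE_mem)+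
      ultimately have "\<mu> r < \<mu> w" using k m by (auto simp: \<mu>_def veq_iff)
      with min[of r] rZ rp nz show False by auto
    qed
    then have "r l = 0" if "l \<in> J" for l
      using rp l0 that unfolding proportional_def by (metis mult_eq_0_iff mult_zero_right)
    then have "q' l = c * w l" if "l \<in> J" for l using that by (force simp: r_def)
    then have "q' = (\<lambda>l\<in>J. c * w l)"
      using q' by (intro extensionalityI[of _ J]) (auto simp: PiE_def)
    with cZ show ?thesis by blast
  qed
  with w show ?thesis by blast
qed

text \<open>Every vector counted is \<open>c * w\<close> for a generator \<open>w\<close> of the
  line, and lying outside \<open>nonprim\<close> bounds the degree of \<open>c\<close> by
  \<open>b0\<close>. A vector determines its shell exponents, so counting pairs costs
  nothing.\<close>

lemma card_proportional:
  fixes q :: "'i \<Rightarrow> 'a::{field,finite} fls" and D :: "'i \<Rightarrow> 'i \<Rightarrow> 'a fls"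
  assumes q: "q \<in> J \<rightarrow>\<^sub>E Zint" and l0: "l0 \<in> J" "q l0 \<noteq> 0"
    and I: "\<And>j. j \<in> I \<Longrightarrow> proportional J q (snd j) \<and> snd j \<in> shell J D (fst j) - nonprim J D b0 (fst j) \<and> fst j \<in> extensional J"
  shows "finite I" "card I \<le> CARD('a) ^ (b0 + 1)"
proof -
  obtain w where w: "w \<in> J \<rightarrow>\<^sub>E Zint"
    "\<And>q'. q'\<in>J \<rightarrow>\<^sub>E Zint \<Longrightarrow> proportional J q q' \<Longrightarrow> \<exists>c\<in>Zint. q' = (\<lambda>l\<in>J. c * w l)"
    using line_generator[OF q l0] by blast
  have inj: "inj_on snd I"
  proof (rule inj_onI)
    fix i j assume ij: "i \<in> I" "j \<in> I" "snd i = snd j"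
    have "fst i k = fst j k" if "k \<in> J" for k
    proof -
      have "veq (- int (fst i k)) (dot J (D k) (snd i))" "veq (- int (fst j k)) (dot J (D k) (snd i))"
        using I[OF ij(1)] I[OF ij(2)] ij(3) that by (auto simp: shell_def)
      then show ?thesis using veq_unique by force
    qed
    then have "fst i = fst j" using I ij by (intro extensionalityI[of _ J]) auto
    then show "i = j" using ij by (simp add: prod_eq_iff)
  qed
  have sub: "snd ` I \<subseteq> (\<lambda>c. \<lambda>l\<in>J. c * w l) ` (seg (- int b0) 0 :: 'a fls set)"
  proof
    fix q' assume "q' \<in> snd ` I"
    then obtain j where j: "j \<in> I" "q' = snd j" by blast
    then have q': "q' \<in> shell J D (fst j)" "q' \<notin> nonprim J D b0 (fst j)" "proportional J q q'" using I by auto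
    then have "q' \<in> J \<rightarrow>\<^sub>E Zint" by (auto simp: shell_def)
    then obtain c where c: "c \<in> Zint" "q' = (\<lambda>l\<in>J. c * w l)" using w(2) q'(3) by blast
    have "vge (- int b0) c"
    proof (cases "c = 0")
      case False
      then obtain m where m: "veq m c" using veq_exists by blast
      have "m \<le> 0" using m c Zint_veq_nonpos by blast
      then have m': "veq (- int (nat (- m))) c" using m by simp
      have "\<not> nat (- m) > b0"
        using q'(1,2) c w(1) m' unfolding nonprim_def by blast
      then show ?thesis using m by (auto intro: vge_mono[OF veq_vge])
    qed auto
    then show "q' \<in> (\<lambda>c. \<lambda>l\<in>J. c * w l) ` (seg (- int b0) 0)" using c Zint_vge_seg by blast
  qed
  have fs: "finite (snd ` I)" using sub finite_subset finite_seg by blast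
  then show "finite I" using inj finite_imageD by blast
  have "card I = card (snd ` I)" using inj by (simp add: card_image)
  also have "\<dots> \<le> card ((\<lambda>c. \<lambda>l\<in>J. c * w l) ` (seg (- int b0) 0 :: 'a fls set))"
    by (rule card_mono[OF _ sub]) (simp add: finite_seg)
  also have "\<dots> \<le> card (seg (- int b0) 0 :: 'a fls set)" by (rule card_image_le[OF finite_seg])
  also have "\<dots> = CARD('a) ^ (b0 + 1)" by (simp add: card_seg nat_add_distrib)
  finally show "card I \<le> CARD('a) ^ (b0 + 1)" .
qed

section \<open>Hits in dimension at least two\<close>

text \<open>
  Here \<open>z\<close> plays the role of the coefficients of the linear form that is made small, while \<open>D\<close> gives the
  remaining coordinates of the lattice vector. The factor \<open>(1/s)^(e+1)\<close> pays for the constants lost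
  because the matrices are only known to be bounded by \<open>s^e\<close>.
\<close>

definition hit :: "nat \<Rightarrow> nat \<Rightarrow> nat \<Rightarrow> (nat \<Rightarrow> real) \<Rightarrow> 'i set \<Rightarrow> ('i \<Rightarrow> 'i \<Rightarrow> 'a::{field,finite} fls) \<Rightarrow> ('i \<Rightarrow> 'a fls) \<Rightarrow> bool" where
  "hit S e T a J D z \<longleftrightarrow> (\<exists>q\<in>J \<rightarrow>\<^sub>E Zint. \<exists>p\<in>Zint. \<exists>m t. m \<le> S \<and>
     (\<forall>i\<in>J. t i \<le> S \<and> veq (- int (t i)) (dot J (D i) q)) \<and>
     vge (int m) (p + dot J z q) \<and> T \<le> Max (t ` J) \<and>
     (1 / real CARD('a)) ^ m * real CARD('a) ^ (\<Sum>i\<in>J. t i) \<le> (1 / real CARD('a)) ^ (e + 1) * a (Max (t ` J)))"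

lemma divergent_tail:
  fixes f :: "nat \<Rightarrow> real"
  assumes "\<And>n. f n \<ge> 0" "\<not> summable f"
  shows "\<exists>m\<ge>n. R \<le> sum f {n..m}"
proof (rule ccontr)
  assume "\<not> ?thesis"
  then have *: "sum f {n..m} < R" if "m \<ge> n" for m using that by (meson not_le)
  have "sum f {..<k} \<le> sum f {..<n} + max R 0" for k
  proof -
    have "sum f {..<k} \<le> sum f ({..<n} \<union> {n..max n k})"
      using assms by (intro sum_mono2) auto
    also have "\<dots> = sum f {..<n} + sum f {n..max n k}"
      by (rule sum.union_disjoint) auto
    also have "\<dots> \<le> sum f {..<n} + max R 0" using *[of "max n k"] by simp
    finally show ?thesis .
  qed
  then have "summable f" using assms(1) by (intro summableI_nonneg_bounded) auto
  with assms show False by blast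
qed

lemma linear_times_geometric_small:
  fixes s C \<delta> :: real
  assumes "s \<ge> 2" "\<delta> > 0" "C \<ge> 0"
  shows "\<exists>\<tau>0. \<forall>\<tau>\<ge>\<tau>0. C * real (\<tau> + e) * (1/s) ^ (\<tau> div 2) \<le> \<delta>"
proof -
  have "(\<lambda>k. real k * (1/s) ^ k) \<longlonglongrightarrow> 0"
  proof (rule powser_times_n_limit_0)
    have "\<bar>1/s\<bar> = 1/s" using assms by simp
    also have "\<dots> < 1" using assms by (simp add: divide_less_eq)
    finally show "norm (1/s) < 1" by simp
  qed
  moreover have "(\<lambda>k. (1/s) ^ k) \<longlonglongrightarrow> 0" by (rule LIMSEQ_realpow_zero) (use assms in auto)
  ultimately have "(\<lambda>k. 2 * C * (real k * (1/s) ^ k) + C * real (1 + e) * (1/s) ^ k) \<longlonglongrightarrow> 2 * C * 0 + C * real (1 + e) * 0"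
    by (intro tendsto_add tendsto_mult_left)
  then have "eventually (\<lambda>k. 2 * C * (real k * (1/s) ^ k) + C * real (1 + e) * (1/s) ^ k < \<delta>) sequentially"
    by (rule order_tendstoD(2)) (use assms in simp)
  then obtain k0 where k0: "\<And>k. k \<ge> k0 \<Longrightarrow> 2 * C * (real k * (1/s) ^ k) + C * real (1 + e) * (1/s) ^ k < \<delta>"
    by (auto simp: eventually_sequentially)
  show ?thesis
  proof (intro exI allI impI)
    fix \<tau> assume "\<tau> \<ge> 2 * k0"
    then have k: "\<tau> div 2 \<ge> k0" by simp
    have "real (\<tau> + e) \<le> 2 * real (\<tau> div 2) + real (1 + e)"
    proof -
      have "real (\<tau> + e) \<le> real (2 * (\<tau> div 2) + (1 + e))" by (rule of_nat_mono) simp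
      then show ?thesis by simp
    qed
    then have "C * real (\<tau> + e) * (1/s) ^ (\<tau> div 2) \<le> C * (2 * real (\<tau> div 2) + real (1 + e)) * (1/s) ^ (\<tau> div 2)"
      using assms by (intro mult_right_mono mult_left_mono) auto
    also have "\<dots> < \<delta>" using k0[OF k] by (simp add: algebra_simps)
    finally show "C * real (\<tau> + e) * (1/s) ^ (\<tau> div 2) \<le> \<delta>" by simp
  qed
qed

lemma least_power_below:
  fixes s r :: real
  assumes "s \<ge> 2" "0 < r" "r < 1"
  shows "\<exists>m. (1/s) ^ Suc m \<le> r \<and> r < (1/s) ^ m"
proof -
  obtain n where n: "(1/s) ^ n < r" using real_arch_pow_inv[of r "1/s"] assms by auto
  define k where "k = (LEAST n. (1/s) ^ n \<le> r)"
  have k: "(1/s) ^ k \<le> r" unfolding k_def by (rule LeastI[of _ n]) (use n in simp)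
  have "k \<noteq> 0" using k assms by (cases k) auto
  then obtain m where m: "k = Suc m" by (cases k) auto
  have "\<not> (1/s) ^ m \<le> r" using not_less_Least[of m "\<lambda>n. (1/s) ^ n \<le> r"] m by (simp add: k_def)
  with k m show ?thesis by auto
qed

text \<open>Each of the two error terms of \<open>card_nonprim\<close> is at most a quarter of the
  lower bound for the shell: the first because \<open>\<tau>\<close> is large, the second by the
  choice of \<open>b0\<close>.\<close>

lemma card_shell_diff_nonprim:
  fixes D :: "'i \<Rightarrow> 'i \<Rightarrow> 'a::{field,finite} fls"
  defines "s \<equiv> real CARD('a)"
  assumes D: "inv_pair e J D D'" and J: "finite J" and t: "\<And>i. i \<in> J \<Longrightarrow> t i \<le> \<tau>" "\<And>i. i \<in> J \<Longrightarrow> (\<tau> + 1) div 2 \<le> t i"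
    and i01: "i0 \<in> J" "i1 \<in> J" "i0 \<noteq> i1" "t i0 = \<tau>"
    and b0: "b0 = 2 * e + e * card J + 5" and \<tau>: "2 * e \<le> \<tau>"
    "s ^ (e + 2) * real (\<tau> + e) * (1/s) ^ (\<tau> div 2) \<le> (1/s) ^ (e * card J) / 4"
  shows "s ^ (\<Sum>i\<in>J. t i) * (1/s) ^ (e * card J) / 2 \<le> real (card (shell J D t - nonprim J D b0 t))"
proof -
  have s2: "s \<ge> 2" using card_field_ge_2[where 'a='a] by (simp add: s_def)
  have et: "e \<le> t i" if "i \<in> J" for i using t(2)[OF that] \<tau> by linarith
  have "s ^ (\<Sum>i\<in>J. t i) * (1/s) ^ (e * card J) = (\<Prod>i\<in>J. s ^ t i * (1/s) ^ e)"
    by (simp add: power_sum prod.distrib power_mult)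
  also have "\<dots> = (\<Prod>i\<in>J. s ^ (t i - e))"
    by (rule prod.cong) (use et s2 in \<open>auto simp: power_diff power_divide\<close>)
  also have "\<dots> = real (\<Prod>i\<in>J. CARD('a) ^ (t i - e))" by (simp add: s_def)
  also have "\<dots> \<le> real (card (shell J D t))" by (rule of_nat_mono[OF card_shell_ge[OF D J et]])
  finally have 1: "s ^ (\<Sum>i\<in>J. t i) * (1/s) ^ (e * card J) \<le> real (card (shell J D t))" .
  have "\<tau> div 2 \<le> t i1" using t(2)[OF i01(2)] by linarith
  then have "real (card (nonprim J D b0 t)) \<le>
     s ^ (\<Sum>i\<in>J. t i) * (s ^ (e + 2) * real (\<tau> + e) * (1/s) ^ (\<tau> div 2) + s ^ (2*e+3) * (1/s) ^ b0)"
    using card_nonprim[where t = t and \<tau> = \<tau> and ?b0.0 = b0, OF D J t(1) i01] b0 by (simp add: s_def)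
  also have "\<dots> \<le> s ^ (\<Sum>i\<in>J. t i) * ((1/s) ^ (e * card J) / 4 + (1/s) ^ (e * card J) / 4)"
  proof (intro mult_left_mono add_mono \<tau>)
    \<comment> \<open>The three parts of \<open>b0\<close> cancel s^(2e+3), reproduce the main term
      and supply (1/s)^2 <= 1/4.\<close>
    have "b0 = (2 * e + 3) + (e * card J) + 2" using b0 by simp
    then have *: "(1/s) ^ b0 = (1/s) ^ (2*e+3) * (1/s) ^ (e * card J) * (1/s)^2"
      by (simp only: power_add)
    have "s ^ (2*e+3) * (1/s) ^ b0 = (1/s) ^ (e * card J) * (1/s)^2"
    proof -
      have "s ^ (2*e+3) * (1/s) ^ (2*e+3) = 1" using s2 by (simp add: power_mult_distrib[symmetric])
      then show ?thesis unfolding * by (simp only: mult.assoc[symmetric] mult_1)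
    qed
    also have "\<dots> \<le> (1/s) ^ (e * card J) * (1/4)"
    proof (rule mult_left_mono)
      have "(1/s)^2 \<le> (1/2)^2" using s2 by (intro power_mono) auto
      then show "(1/s)^2 \<le> 1/4" by (simp add: power2_eq_square)
    qed (use s2 in auto)
    finally show "s ^ (2*e+3) * (1/s) ^ b0 \<le> (1/s) ^ (e * card J) / 4" by simp
  qed (use s2 in auto)
  finally have 2: "real (card (nonprim J D b0 t)) \<le> s ^ (\<Sum>i\<in>J. t i) * (1/s) ^ (e * card J) / 2" by simp
  have fin: "finite (shell J D t)" by (rule finite_subset[OF shell_box card_box(1)[OF D J]])
  have sub: "nonprim J D b0 t \<subseteq> shell J D t" by (auto simp: nonprim_def)
  have "card (shell J D t - nonprim J D b0 t) = card (shell J D t) - card (nonprim J D b0 t)"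
    by (rule card_Diff_subset[OF finite_subset[OF sub fin] sub])
  moreover have "card (nonprim J D b0 t) \<le> card (shell J D t)" by (rule card_mono[OF fin sub])
  ultimately have "real (card (shell J D t - nonprim J D b0 t)) = real (card (shell J D t)) - real (card (nonprim J D b0 t))"
    by simp
  with 1 2 show ?thesis by linarith
qed

text \<open>
  The exponents of the shells range over \<open>[\<tau>/2, \<tau>]\<close> instead of \<open>[0, \<tau>]\<close>: there are still of the
  order of \<open>\<tau>^(d-1)\<close> of them with maximum \<open>\<tau>\<close>, and in these shells non-primitive vectors are negligible.
\<close>

lemma no_hit_small_several:
  fixes J :: "'i set" and a :: "nat \<Rightarrow> real"
  assumes J: "finite J" "card J \<ge> 2" and a: "\<And>\<tau>. 0 < a \<tau>" "\<And>\<tau>. a \<tau> \<le> 1"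
    and div: "\<not> summable (\<lambda>\<tau>. real (\<tau> + 1) ^ (card J - 1) * a \<tau>)" and \<epsilon>: "\<epsilon> > 0"
  shows "\<exists>N S. 2 * S + e \<le> N \<and> (\<forall>D D'. inv_pair e J D D' \<longrightarrow>
    real (card {z \<in> J \<rightarrow>\<^sub>E (seg 1 (int N) :: 'a::{field,finite} fls set). \<not> hit S e T a J D z}) \<le>
      \<epsilon> * real (card (J \<rightarrow>\<^sub>E (seg 1 (int N) :: 'a fls set))))"
proof -
  define s where "s = real CARD('a)"
  have s2: "s \<ge> 2" using card_field_ge_2[where 'a='a] by (simp add: s_def)
  obtain i0 i1 where i01: "i0 \<in> J" "i1 \<in> J" "i0 \<noteq> i1"
    using J by (metis card_2_iff' obtain_subset_with_card_n subset_iff)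
  define d where "d = card J"
  define b0 where "b0 = 2 * e + e * card J + 5"
  \<comment> \<open>The bound of \<open>card_proportional\<close> for one line, which will bound the
    ratio of variance to mean.\<close>
  define L where "L = s ^ (b0 + 1)"
  have Lpos: "L > 0" using s2 by (simp add: L_def)
  obtain \<tau>0' where \<tau>0': "\<And>\<tau>. \<tau> \<ge> \<tau>0' \<Longrightarrow> s ^ (e + 2) * real (\<tau> + e) * (1/s) ^ (\<tau> div 2) \<le> (1/s) ^ (e * card J) / 4"
    using linear_times_geometric_small[OF s2, of "(1/s) ^ (e * card J) / 4" "s ^ (e+2)"] s2 by auto
  define \<tau>0 where "\<tau>0 = \<tau>0' + 2 * e + T"
  \<comment> \<open>The size that \<open>hit\<close> allows for the linear form at a vector of shell
    \<open>t\<close>; \<open>M t\<close> rounds it to a power of 1/s.\<close>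
  define r where "r t = (1/s) ^ (e+1) * a (t i0) * (1/s) ^ (\<Sum>i\<in>J. t i)" for t :: "'i \<Rightarrow> nat"
  have rpos: "r t > 0" for t using s2 a by (simp add: r_def)
  have rlt: "r t < 1" for t
  proof -
    have "r t \<le> (1/s) ^ (e+1) * 1 * 1"
      unfolding r_def using s2 a less_imp_le[OF a(1)] by (intro mult_mono power_le_one) auto
    also have "\<dots> < 1" using s2 power_less_one_iff[of "1/s" "e+1"] by simp
    finally show ?thesis .
  qed
  obtain M where M: "\<And>t. (1/s) ^ Suc (M t) \<le> r t" "\<And>t. r t < (1/s) ^ M t"
    using least_power_below[OF s2 rpos rlt] by metis
  \<comment> \<open>Placing the maximum at the fixed index \<open>i0\<close> keeps the families for
    different \<open>\<tau>\<close> disjoint and still leaves a constant fraction of the exponent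
    vectors.\<close>
  define \<T> where "\<T> \<tau> = PiE J (\<lambda>i. if i = i0 then {\<tau>} else {(\<tau> + 1) div 2..\<tau>})" for \<tau> :: nat
  have card_\<T>: "card (\<T> \<tau>) = (\<tau> div 2 + 1) ^ (d - 1)" for \<tau>
  proof -
    have "card (\<T> \<tau>) = (\<Prod>i\<in>J. if i = i0 then 1 else \<tau> div 2 + 1)"
      unfolding \<T>_def card_PiE[OF J(1)] by (rule prod.cong) auto
    also have "\<dots> = (\<Prod>i\<in>J - {i0}. \<tau> div 2 + 1)"
      by (subst prod.remove[OF J(1) i01(1)]) (auto intro: prod.cong)
    also have "\<dots> = (\<tau> div 2 + 1) ^ (d - 1)" using i01 J by (simp add: d_def)
    finally show ?thesis .
  qed
  have fin_\<T>: "finite (\<T> \<tau>)" for \<tau> unfolding \<T>_def by (intro finite_PiE J) auto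
  have \<T>: "t i0 = \<tau>" "\<And>i. i \<in> J \<Longrightarrow> t i \<le> \<tau>" "\<And>i. i \<in> J \<Longrightarrow> (\<tau> + 1) div 2 \<le> t i" "t \<in> extensional J"
    if "t \<in> \<T> \<tau>" for t \<tau>
  proof -
    show 1: "t i0 = \<tau>" using that i01 by (force simp: \<T>_def dest: PiE_mem)
    show "t i \<le> \<tau>" "(\<tau> + 1) div 2 \<le> t i" if i: "i \<in> J" for i
      using PiE_mem[OF \<open>t \<in> \<T> \<tau>\<close>[unfolded \<T>_def] i] by (auto split: if_splits)
    show "t \<in> extensional J" using that by (auto simp: \<T>_def PiE_def)
  qed
  \<comment> \<open>The losses: half of the shell together with its factor s^(-e |J|), the factor in
    \<open>hit\<close>, and the halved range of the exponents.\<close>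
  define \<kappa> where "\<kappa> = (1/s) ^ (e * card J) / 2 * (1/s) ^ (e + 1) * (1/2) ^ (d - 1)"
  have \<kappa>: "\<kappa> > 0" using s2 by (simp add: \<kappa>_def)
  obtain \<tau>1 where \<tau>1: "\<tau>1 \<ge> \<tau>0" "L / (\<epsilon> * \<kappa>) \<le> (\<Sum>\<tau>\<in>{\<tau>0..\<tau>1}. real (\<tau> + 1) ^ (d - 1) * a \<tau>)"
    using divergent_tail[OF _ div, of \<tau>0 "L / (\<epsilon> * \<kappa>)"] less_imp_le[OF a(1)] unfolding d_def by auto
  define TT where "TT = (\<Union>\<tau>\<in>{\<tau>0..\<tau>1}. \<T> \<tau>)"
  have fin_TT: "finite TT" unfolding TT_def using fin_\<T> by blast
  \<comment> \<open>\<open>S\<close> and \<open>N\<close> depend on the finite set \<open>TT\<close>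
    but not on \<open>D\<close>, so one choice serves all matrices bounded by s^e.\<close>
  define S where "S = \<tau>1 + (\<Sum>t\<in>TT. Suc (M t))"
  have MS: "Suc (M t) \<le> S" if "t \<in> TT" for t
    using member_le_sum[of t TT "\<lambda>t. Suc (M t)"] fin_TT that by (simp add: S_def)
  have tS: "t i \<le> S" if "t \<in> TT" "i \<in> J" for t i
    using that \<T>(2) by (force simp: TT_def S_def)
  define N where "N = 2 * S + e"
  let ?\<Omega> = "J \<rightarrow>\<^sub>E (seg 1 (int N) :: 'a fls set)"
  have fin_\<Omega>: "finite ?\<Omega>" by (intro finite_PiE J finite_seg)
  have main: "real (card {z \<in> ?\<Omega>. \<not> hit S e T a J D z}) \<le> \<epsilon> * real (card ?\<Omega>)"
    if D: "inv_pair e J D D'" for D D' :: "'i \<Rightarrow> 'i \<Rightarrow> 'a fls"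
  proof -
    define Q where "Q t = shell J D t - nonprim J D b0 t" for t
    have finQ: "finite (Q t)" for t
      unfolding Q_def by (rule finite_Diff[OF finite_subset[OF shell_box card_box(1)[OF D J(1)]]])
    define I where "I = Sigma TT Q"
    have finI: "finite I" unfolding I_def using fin_TT finQ by blast
    define E where "E j = slab J N (snd j) (M (fst j))" for j :: "('i \<Rightarrow> nat) \<times> ('i \<Rightarrow> 'a fls)"
    define P where "P j = (1/s) ^ M (fst j)" for j :: "('i \<Rightarrow> nat) \<times> ('i \<Rightarrow> 'a fls)"
    have qprops: "snd j \<in> J \<rightarrow>\<^sub>E Zint" "\<And>l. l \<in> J \<Longrightarrow> snd j l \<in> Zint" "\<And>l. l \<in> J \<Longrightarrow> vge (- int (S + e)) (snd j l)"
      "M (fst j) + (S + e) \<le> N" "\<exists>l\<in>J. snd j l \<noteq> 0" "fst j \<in> TT" "snd j \<in> Q (fst j)" "fst j \<in> extensional J"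
      if "j \<in> I" for j
    proof -
      show tt: "fst j \<in> TT" "snd j \<in> Q (fst j)" using that by (auto simp: I_def)
      then have sh: "snd j \<in> shell J D (fst j)" by (simp add: Q_def)
      then show z: "snd j \<in> J \<rightarrow>\<^sub>E Zint" by (simp add: shell_def)
      then show "\<And>l. l \<in> J \<Longrightarrow> snd j l \<in> Zint" by blast
      show "vge (- int (S + e)) (snd j l)" if l: "l \<in> J" for l
      proof -
        have "vge (- int S - int e) (snd j l)"
        proof (rule inv_pair_vge_arg[OF D J(1) _ l])
          fix i assume i: "i \<in> J"
          show "vge (- int S) (dot J (D i) (snd j))"
            by (rule vge_mono[of "- int (fst j i)"]) (use sh i tS[OF tt(1) i] in \<open>auto simp: shell_def veq_def\<close>)
        qed
        then show ?thesis by simp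
      qed
      show "M (fst j) + (S + e) \<le> N" using MS[OF tt(1)] by (simp add: N_def)
      show "\<exists>l\<in>J. snd j l \<noteq> 0"
      proof (rule ccontr)
        assume "\<not> ?thesis"
        then have "dot J (D i0) (snd j) = 0" by (simp add: dot_def)
        then show False using sh i01 by (auto simp: shell_def veq_def)
      qed
      show "fst j \<in> extensional J" using tt \<T>(4) by (auto simp: TT_def)
    qed
    have cE: "real (card (E j)) = P j * real (card ?\<Omega>)" if j: "j \<in> I" for j
    proof -
      obtain l where l: "l \<in> J" "snd j l \<noteq> 0" using qprops(5)[OF j] by blast
      have "real (card (E j)) * s ^ M (fst j) = real (card ?\<Omega>)"
        using arg_cong[OF card_slab[where q = "snd j" and S = "S + e" and M = "M (fst j)" and N = N, OF J(1) qprops(2-4)[OF j] l], of real] by (simp add: E_def s_def)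
      then show ?thesis using s2 by (simp add: P_def power_divide field_simps)
    qed
    have cE2: "real (card (E i \<inter> E j)) = P i * P j * real (card ?\<Omega>)"
      if ij: "i \<in> I" "j \<in> I" and np: "\<not> proportional J (snd i) (snd j)" for i j
    proof -
      obtain l0 l1 where l: "l0 \<in> J" "l1 \<in> J" "snd i l0 * snd j l1 \<noteq> snd i l1 * snd j l0"
        using np by (auto simp: proportional_def)
      have "real (card (E i \<inter> E j)) * (s ^ M (fst i) * s ^ M (fst j)) = real (card ?\<Omega>)"
        using arg_cong[OF card_slab_pair[where q = "snd i" and q' = "snd j" and S = "S + e" and M = "M (fst i)" and M' = "M (fst j)" and N = N, OF J(1) qprops(2,3)[OF ij(1)] qprops(2,3)[OF ij(2)] qprops(4)[OF ij(1)] qprops(4)[OF ij(2)] l], of real]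
        by (simp add: E_def s_def)
      then show ?thesis using s2 by (simp add: P_def power_divide field_simps)
    qed
    have Pnn: "P j \<ge> 0" for j using s2 by (simp add: P_def)
    define A where "A = sum P I"
    have "A = (\<Sum>t\<in>TT. \<Sum>q\<in>Q t. (1/s) ^ M t)"
      unfolding A_def I_def P_def by (subst sum.Sigma) (use fin_TT finQ in \<open>auto intro!: sum.cong\<close>)
    also have "\<dots> = (\<Sum>t\<in>TT. real (card (Q t)) * (1/s) ^ M t)" by simp
    also have "\<dots> \<ge> (\<Sum>t\<in>TT. (1/s) ^ (e * card J) / 2 * (1/s) ^ (e + 1) * a (t i0))"
    proof (rule sum_mono)
      fix t assume "t \<in> TT"
      then obtain \<tau> where \<tau>: "\<tau> \<in> {\<tau>0..\<tau>1}" "t \<in> \<T> \<tau>" by (auto simp: TT_def)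
      have "s ^ (\<Sum>i\<in>J. t i) * (1/s) ^ (e * card J) / 2 \<le> real (card (Q t))"
        unfolding Q_def s_def
        by (rule card_shell_diff_nonprim[where t = t and \<tau> = \<tau>, OF D J(1) \<T>(2,3)[OF \<tau>(2)] i01 \<T>(1)[OF \<tau>(2)] b0_def])
           (use \<tau>(1) \<tau>0' in \<open>auto simp: \<tau>0_def s_def\<close>)
      then have "s ^ (\<Sum>i\<in>J. t i) * (1/s) ^ (e * card J) / 2 * r t \<le> real (card (Q t)) * (1/s) ^ M t"
        using M(2)[of t] rpos[of t] by (intro mult_mono) auto
      then show "(1/s) ^ (e * card J) / 2 * (1/s) ^ (e + 1) * a (t i0) \<le> real (card (Q t)) * (1/s) ^ M t"
        using s2 by (simp add: r_def power_divide)
    qed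
    also have "(\<Sum>t\<in>TT. (1/s) ^ (e * card J) / 2 * (1/s) ^ (e + 1) * a (t i0)) =
      (\<Sum>\<tau>\<in>{\<tau>0..\<tau>1}. \<Sum>t\<in>\<T> \<tau>. (1/s) ^ (e * card J) / 2 * (1/s) ^ (e + 1) * a (t i0))"
      unfolding TT_def
    proof (rule sum.UNION_disjoint)
      show "\<forall>i\<in>{\<tau>0..\<tau>1}. \<forall>j\<in>{\<tau>0..\<tau>1}. i \<noteq> j \<longrightarrow> \<T> i \<inter> \<T> j = {}"
        using \<T>(1) by blast
    qed (use fin_\<T> in auto)
    also have "\<dots> = (\<Sum>\<tau>\<in>{\<tau>0..\<tau>1}. real (card (\<T> \<tau>)) * ((1/s) ^ (e * card J) / 2 * (1/s) ^ (e + 1) * a \<tau>))"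
    proof (rule sum.cong[OF refl])
      fix \<tau>
      have "(\<Sum>t\<in>\<T> \<tau>. (1/s) ^ (e * card J) / 2 * (1/s) ^ (e + 1) * a (t i0)) = (\<Sum>t\<in>\<T> \<tau>. (1/s) ^ (e * card J) / 2 * (1/s) ^ (e + 1) * a \<tau>)"
        by (rule sum.cong) (simp_all add: \<T>(1))
      then show "(\<Sum>t\<in>\<T> \<tau>. (1/s) ^ (e * card J) / 2 * (1/s) ^ (e + 1) * a (t i0)) = real (card (\<T> \<tau>)) * ((1/s) ^ (e * card J) / 2 * (1/s) ^ (e + 1) * a \<tau>)"
        by simp
    qed
    also have "\<dots> \<ge> (\<Sum>\<tau>\<in>{\<tau>0..\<tau>1}. \<kappa> * (real (\<tau> + 1) ^ (d - 1) * a \<tau>))"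
    proof (rule sum_mono)
      fix \<tau>
      have "real (\<tau> + 1) \<le> real (2 * (\<tau> div 2 + 1))" by (rule of_nat_mono) simp
      then have "real (\<tau> + 1) / 2 \<le> real (\<tau> div 2 + 1)" by simp
      then have "(real (\<tau> + 1) / 2) ^ (d - 1) \<le> real (card (\<T> \<tau>))"
        unfolding card_\<T> of_nat_power by (rule power_mono) simp
      then have "(real (\<tau> + 1) / 2) ^ (d - 1) * ((1/s) ^ (e * card J) / 2 * (1/s) ^ (e + 1) * a \<tau>) \<le>
        real (card (\<T> \<tau>)) * ((1/s) ^ (e * card J) / 2 * (1/s) ^ (e + 1) * a \<tau>)"
        using s2 less_imp_le[OF a(1)] by (intro mult_right_mono) auto
      then show "\<kappa> * (real (\<tau> + 1) ^ (d - 1) * a \<tau>) \<le> real (card (\<T> \<tau>)) * ((1/s) ^ (e * card J) / 2 * (1/s) ^ (e + 1) * a \<tau>)"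
        unfolding \<kappa>_def by (simp add: power_divide mult_ac)
    qed
    also have "(\<Sum>\<tau>\<in>{\<tau>0..\<tau>1}. \<kappa> * (real (\<tau> + 1) ^ (d - 1) * a \<tau>)) = \<kappa> * (\<Sum>\<tau>\<in>{\<tau>0..\<tau>1}. real (\<tau> + 1) ^ (d - 1) * a \<tau>)"
      by (simp add: sum_distrib_left)
    also have "\<dots> \<ge> \<kappa> * (L / (\<epsilon> * \<kappa>))" using \<tau>1 \<kappa> by (intro mult_left_mono) auto
    finally have A: "A \<ge> L / \<epsilon>" using \<kappa> by simp
    then have Apos: "A > 0" using Lpos \<epsilon> by (meson divide_pos_pos less_le_trans)
    \<comment> \<open>Proportional vectors, at most \<open>L\<close> in number, are estimated
      trivially by \<open>E i\<close> itself; for all others the events are independent.\<close>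
    have "(\<Sum>j\<in>I. real (card (E i \<inter> E j))) \<le> P i * (A + L) * real (card ?\<Omega>)" if i: "i \<in> I" for i
    proof -
      let ?Pr = "{j \<in> I. proportional J (snd i) (snd j)}"
      obtain l0 where l0: "l0 \<in> J" "snd i l0 \<noteq> 0" using qprops(5)[OF i] by blast
      have cp: "card ?Pr \<le> CARD('a) ^ (b0 + 1)"
        by (rule card_proportional(2)[OF qprops(1)[OF i] l0, where D = D]) (use qprops(7,8) in \<open>auto simp: Q_def\<close>)
      have "(\<Sum>j\<in>I. real (card (E i \<inter> E j))) \<le> (\<Sum>j\<in>I. P i * P j * real (card ?\<Omega>) + (if proportional J (snd i) (snd j) then P i * real (card ?\<Omega>) else 0))"
      proof (rule sum_mono)
        fix j assume j: "j \<in> I"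
        show "real (card (E i \<inter> E j)) \<le> P i * P j * real (card ?\<Omega>) + (if proportional J (snd i) (snd j) then P i * real (card ?\<Omega>) else 0)"
        proof (cases "proportional J (snd i) (snd j)")
          case True
          have "finite (E i)" using fin_\<Omega> by (auto simp: E_def slab_def)
          then have "card (E i \<inter> E j) \<le> card (E i)" by (intro card_mono) auto
          then have "real (card (E i \<inter> E j)) \<le> P i * real (card ?\<Omega>)" using cE[OF i] by linarith
          then show ?thesis using True Pnn by (simp add: add_increasing)
        next
          case False
          then show ?thesis using cE2[OF i j] by simp
        qed
      qed
      also have "\<dots> = P i * A * real (card ?\<Omega>) + real (card ?Pr) * (P i * real (card ?\<Omega>))"
        using finI by (simp add: sum.distrib A_def sum_distrib_left sum_distrib_right sum.inter_filter[symmetric])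
      also have "\<dots> \<le> P i * A * real (card ?\<Omega>) + L * (P i * real (card ?\<Omega>))"
      proof (intro add_left_mono mult_right_mono)
        show "real (card ?Pr) \<le> L" using of_nat_mono[OF cp, where 'a = real] by (simp add: L_def s_def)
      qed (use Pnn in auto)
      finally show ?thesis by (simp add: algebra_simps)
    qed
    then have "(\<Sum>i\<in>I. \<Sum>j\<in>I. real (card (E i \<inter> E j))) \<le> (\<Sum>i\<in>I. P i * (A + L) * real (card ?\<Omega>))"
      by (rule sum_mono)
    also have "\<dots> = (A\<^sup>2 + L * A) * real (card ?\<Omega>)"
      by (simp add: sum_distrib_right[symmetric] A_def[symmetric]) (simp add: power2_eq_square algebra_simps)
    finally have pair: "(\<Sum>i\<in>I. \<Sum>j\<in>I. real (card (E i \<inter> E j))) \<le> (A\<^sup>2 + L * A) * real (card ?\<Omega>)" .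
    have "real (card {z\<in>?\<Omega>. \<forall>i\<in>I. z \<notin> E i}) * A \<le> L * real (card ?\<Omega>)"
      by (rule second_moment_bound[OF fin_\<Omega> finI A_def Apos _ cE pair]) (auto simp: E_def slab_def)
    also have "\<dots> \<le> (\<epsilon> * A) * real (card ?\<Omega>)"
      using A \<epsilon> by (intro mult_right_mono) (auto simp: field_simps)
    finally have fin_bound: "real (card {z\<in>?\<Omega>. \<forall>i\<in>I. z \<notin> E i}) \<le> \<epsilon> * real (card ?\<Omega>)"
      using Apos mult_right_le_imp_le[of _ A "\<epsilon> * real (card ?\<Omega>)"] by (simp add: mult_ac)
    have "{z \<in> ?\<Omega>. \<not> hit S e T a J D z} \<subseteq> {z\<in>?\<Omega>. \<forall>i\<in>I. z \<notin> E i}"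
    proof (safe)
      fix z t q assume z: "z \<in> ?\<Omega>" and nh: "\<not> hit S e T a J D z" and i: "(t, q) \<in> I" and zE: "z \<in> E (t, q)"
      have t: "t \<in> TT" and q: "q \<in> shell J D t" using i by (auto simp: I_def Q_def)
      then obtain \<tau> where \<tau>: "\<tau> \<in> {\<tau>0..\<tau>1}" "t \<in> \<T> \<tau>" by (auto simp: TT_def)
      have mx: "Max (t ` J) = t i0"
        by (rule Max_eqI) (use J i01 \<T>[OF \<tau>(2)] in auto)
      obtain p where p: "p \<in> Zint" "vge (int (Suc (M t))) (p + dot J z q)"
        using slab_imp_near[of z J N q "M t"] zE by (auto simp: E_def)
      have "(1/s) ^ Suc (M t) * s ^ (\<Sum>i\<in>J. t i) \<le> r t * s ^ (\<Sum>i\<in>J. t i)"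
        using M(1) s2 by (intro mult_right_mono) auto
      also have "\<dots> = (1/s) ^ (e+1) * a (t i0)" using s2 by (simp add: r_def power_divide)
      finally have "hit S e T a J D z"
        unfolding hit_def using q p MS[OF t] tS[OF t] mx \<T>(1)[OF \<tau>(2)] \<tau>(1)
        by (intro bexI[of _ q] bexI[of _ p] exI[of _ "Suc (M t)"] exI[of _ t]) (auto simp: shell_def s_def \<tau>0_def)
      with nh show False by simp
    qed
    then have "card {z \<in> ?\<Omega>. \<not> hit S e T a J D z} \<le> card {z\<in>?\<Omega>. \<forall>i\<in>I. z \<notin> E i}"
      by (rule card_mono[rotated]) (use fin_\<Omega> in auto)
    then show ?thesis using fin_bound by linarith
  qed
  show ?thesis using main by (intro exI[of _ N] exI[of _ S]) (auto simp: N_def)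
qed

section \<open>Reduced fractions\<close>

definition bezout :: "'a::comm_ring_1 fls \<Rightarrow> 'a fls \<Rightarrow> bool" where
  "bezout a b \<longleftrightarrow> (\<exists>x\<in>Zint. \<exists>y\<in>Zint. x * a + y * b = 1)"

definition monic :: "nat \<Rightarrow> 'a::zero_neq_one fls \<Rightarrow> bool" where
  "monic n b \<longleftrightarrow> b \<in> Zint \<and> vge (- int n) b \<and> b $$ (- int n) = 1"

text \<open>
  \<open>redfrac n\<close> consists of the reduced fractions \<open>a/b\<close> of absolute value less than 1 with monic denominator of
  degree \<open>n\<close>, and \<open>redfrac_at m n\<close> prescribes the degree \<open>m\<close> of the numerator as well. One step of the
  Euclidean algorithm relates the two, which yields their exact cardinalities.
\<close>

definition redfrac :: "nat \<Rightarrow> ('a::field fls \<times> 'a fls) set" where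
  "redfrac n = {(a, b). a \<in> Zint \<and> vge (1 - int n) a \<and> monic n b \<and> bezout a b}"

definition redfrac_at :: "nat \<Rightarrow> nat \<Rightarrow> ('a::field fls \<times> 'a fls) set" where
  "redfrac_at m n = {(a, b). a \<in> Zint \<and> veq (- int m) a \<and> monic n b \<and> bezout a b}"

lemma monic_veq: "monic n b \<Longrightarrow> veq (- int n) b"
  by (simp add: monic_def veq_def)

lemma monic_Zint: "monic n b \<Longrightarrow> b \<in> Zint"
  by (simp add: monic_def)

lemma monic_vge: "monic n b \<Longrightarrow> vge (- int n) b"
  by (simp add: monic_def)

lemma veq_mult_nth:
  fixes x y :: "'a::field fls"
  assumes "veq a x" "veq b y"
  shows "(x * y) $$ (a + b) = x $$ a * y $$ b"
  using assms fls_times_base[of x y] by (simp add: veq_iff)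

lemma monic_add_lower:
  fixes b :: "'a::field fls"
  assumes "monic n b" "r \<in> Zint" "vge (1 - int n) r"
  shows "monic n (b + r)"
  using assms by (auto simp: monic_def Zint_def vge_def)

lemma monic_mult:
  fixes b :: "'a::field fls"
  assumes "monic n b" "monic m c"
  shows "monic (n + m) (b * c)"
  using assms veq_mult_nth[OF monic_veq monic_veq, OF assms] vge_mult[OF monic_vge monic_vge, OF assms]
  by (auto simp: monic_def Zint_mult)

lemma monic_cancel:
  fixes b :: "'a::field fls"
  assumes "monic n b" "monic m (b * c)" "c \<in> Zint"
  shows "n \<le> m" "monic (m - n) c"
proof -
  have "c \<noteq> 0" using assms(2) by (auto simp: monic_def)
  then obtain k where k: "veq k c" using veq_exists by blast
  have "veq (- int n + k) (b * c)" by (rule veq_mult[OF monic_veq[OF assms(1)] k])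
  then have eq: "- int n + k = - int m" using monic_veq[OF assms(2)] veq_unique by blast
  moreover have "k \<le> 0" using k assms(3) Zint_veq_nonpos by blast
  ultimately show nm: "n \<le> m" by linarith
  have k': "k = - int (m - n)" using eq nm by simp
  have "(b * c) $$ (- int n + k) = b $$ (- int n) * c $$ k"
    by (rule veq_mult_nth[OF monic_veq[OF assms(1)] k])
  then have "c $$ k = 1" using assms(1,2) eq by (simp add: monic_def)
  then show "monic (m - n) c" using k assms(3) unfolding monic_def k' by (simp add: veq_vge)
qed

lemma monic_0: "monic 0 b \<Longrightarrow> b = (1 :: 'a::field fls)"
proof (rule fls_eqI)
  fix n assume "monic 0 b"
  then show "b $$ n = (1 :: 'a fls) $$ n"
    by (cases n "0::int" rule: linorder_cases) (auto simp: monic_def Zint_def vge_def)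
qed

lemma monic_unit:
  fixes b :: "'a::field fls"
  assumes "monic n b" "u \<in> Zint" "b * u = 1"
  shows "n = 0"
proof -
  have "monic 0 (1 :: 'a fls)" by (simp add: monic_def vge_def)
  then show ?thesis using monic_cancel(1)[OF assms(1), of 0 u] assms by simp
qed

lemma redfrac_0: "redfrac 0 = {(0, 1 :: 'a::field fls)}"
proof -
  have "bezout (0 :: 'a fls) 1" unfolding bezout_def by (rule bexI[of _ 0], rule bexI[of _ 1]) auto
  moreover have "monic 0 (1 :: 'a fls)" by (simp add: monic_def vge_def)
  ultimately show ?thesis unfolding redfrac_def using monic_0 Zint_vge_eq_0 by fastforce
qed

lemma finite_redfrac: "finite (redfrac n :: ('a::{field,finite} fls \<times> 'a fls) set)"
proof (rule finite_subset)
  show "redfrac n \<subseteq> (seg (- int n) 0 :: 'a fls set) \<times> seg (- int n) 0"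
    using Zint_vge_seg vge_mono[where a = "- int n" and b = "1 - int n"] by (fastforce simp: redfrac_def monic_def)
qed (intro finite_cartesian_product finite_seg)

text \<open>Write a = u a0 with \<open>a0\<close> monic and divide: b = c a0 + r with
  \<open>c\<close> monic of degree n - m, that is c = X^(n-m) + g. The pair (r, a0) is again
  reduced, with denominator degree \<open>m\<close>, and u, g and (r, a0) can be chosen
  freely.\<close>

lemma card_redfrac_at:
  assumes "m < n"
  shows "finite (redfrac_at m n :: ('a::{field,finite} fls \<times> 'a fls) set)"
    "card (redfrac_at m n :: ('a fls \<times> 'a fls) set) = (CARD('a) - 1) * card (redfrac m :: ('a fls \<times> 'a fls) set) * CARD('a) ^ (n - m)"
proof -
  let ?F = "\<lambda>(u, (r, a0), g). (fls_const u * a0, (Xpow (int (n - m)) + g) * a0 + r :: 'a fls)"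
  let ?X = "(UNIV - {0::'a}) \<times> (redfrac m :: ('a fls \<times> 'a fls) set) \<times> (seg (1 - int (n - m)) 0 :: 'a fls set)"
  have Xg: "monic (n - m) (Xpow (int (n - m)) + g)" if "g \<in> seg (1 - int (n - m)) 0" for g :: "'a fls"
  proof (rule monic_add_lower)
    show "monic (n - m) (Xpow (int (n - m)) :: 'a fls)" by (auto simp: monic_def Xpow_Zint vge_def Xpow_nth)
  qed (use that in \<open>auto simp: seg_Zint seg_vge\<close>)
  have cZ: "fls_const u \<in> Zint" for u :: 'a by (simp add: Zint_def)
  have bij: "bij_betw ?F ?X (redfrac_at m n)"
    unfolding bij_betw_def
  proof
    show "inj_on ?F ?X"
    proof (rule inj_onI)
      fix X Y assume X: "X \<in> ?X" and Y: "Y \<in> ?X" and F: "?F X = ?F Y"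
      obtain u r a g where XX: "X = (u, (r, a), g)" by (metis surj_pair)
      obtain u' r' a' g' where YY: "Y = (u', (r', a'), g')" by (metis surj_pair)
      have A: "(r, a) \<in> redfrac m" "(r', a') \<in> redfrac m" "g \<in> (seg (1 - int (n - m)) 0 :: 'a fls set)" "g' \<in> seg (1 - int (n - m)) 0"
        and u: "u \<noteq> 0" "u' \<noteq> 0"
        and e1: "fls_const u * a = fls_const u' * a'"
        and e2: "(Xpow (int (n - m)) + g) * a + r = (Xpow (int (n - m)) + g') * a' + r'"
        using X Y F unfolding XX YY by auto
      have "(fls_const u * a) $$ (- int m) = u" "(fls_const u' * a') $$ (- int m) = u'"
        using A by (auto simp: redfrac_def monic_def)
      then have uu: "u = u'" using e1 by simp
      then have aa: "a = a'" using e1 u by simp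
      have "veq (- int m) a" using A by (auto simp: redfrac_def monic_veq)
      moreover have "vge (1 - int m) (a * (g - g'))"
      proof -
        have "a * (g - g') = r' - r" using e2 unfolding aa by (simp add: algebra_simps)
        then show ?thesis using A by (auto simp: redfrac_def intro: vge_diff)
      qed
      ultimately have "vge (1 - int m - - int m) (g - g')" by (rule vge_mult_cancel)
      then have "vge 1 (g - g')" by simp
      moreover have "g - g' \<in> Zint" by (intro Zint_diff seg_Zint[OF A(3)] seg_Zint[OF A(4)])
      ultimately have "g = g'" using Zint_vge_eq_0 by force
      then show "X = Y" using e2 uu aa XX YY by simp
    qed
    show "?F ` ?X = redfrac_at m n"
    proof (intro set_eqI iffI)
      fix ab assume "ab \<in> ?F ` ?X"
      then obtain u r a0 g where A: "u \<noteq> 0" "(r, a0) \<in> redfrac m" "g \<in> (seg (1 - int (n - m)) 0 :: 'a fls set)"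
        and ab: "ab = (fls_const u * a0, (Xpow (int (n - m)) + g) * a0 + r)" by auto
      let ?c = "Xpow (int (n - m)) + g"
      have a0: "monic m a0" "r \<in> Zint" "vge (1 - int m) r" using A by (auto simp: redfrac_def)
      have mb: "monic n (?c * a0 + r)"
        by (rule monic_add_lower)
           (use monic_mult[OF Xg[OF A(3)] a0(1)] assms a0 in \<open>auto intro: vge_mono[of "1 - int m"]\<close>)
      have ma: "veq (- int m) (fls_const u * a0)"
        using veq_mult[of 0 "fls_const u" "- int m" a0] A(1) monic_veq[OF a0(1)] by (simp add: veq_iff)
      obtain x y where xy: "x \<in> Zint" "y \<in> Zint" "x * r + y * a0 = 1" using A by (auto simp: redfrac_def bezout_def)
      have "(fls_const (1/u) * (y - x * ?c)) * (fls_const u * a0) + x * (?c * a0 + r) =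
         (fls_const (1/u) * fls_const u) * ((y - x * ?c) * a0) + x * (?c * a0 + r)"
        by (simp only: mult_ac)
      also have "fls_const (1/u) * fls_const u = 1" using A(1) by (simp add: fls_const_mult_const)
      also have "1 * ((y - x * ?c) * a0) + x * (?c * a0 + r) = x * r + y * a0" by (simp add: algebra_simps)
      finally have "bezout (fls_const u * a0) (?c * a0 + r)"
        unfolding bezout_def using xy monic_Zint[OF Xg[OF A(3)]] cZ
        by (intro bexI[of _ x] bexI[of _ "fls_const (1/u) * (y - x * ?c)"]) (auto intro!: Zint_mult Zint_diff)
      then show "ab \<in> redfrac_at m n" unfolding ab redfrac_at_def using ma mb cZ monic_Zint[OF a0(1)] by (auto intro!: Zint_mult)
    next
      fix ab :: "'a fls \<times> 'a fls" assume "ab \<in> redfrac_at m n"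
      then obtain a b where ab: "ab = (a, b)" and A: "a \<in> Zint" "veq (- int m) a" "monic n b" "bezout a b"
        by (auto simp: redfrac_at_def)
      define u where "u = a $$ (- int m)"
      have u: "u \<noteq> 0" using A by (simp add: u_def veq_def)
      define a0 where "a0 = fls_const (1/u) * a"
      have uu: "fls_const u * fls_const (1/u) = 1" using u by (simp add: fls_const_mult_const)
      have au: "fls_const u * a0 = a" unfolding a0_def mult.assoc[symmetric] uu by simp
      have a0: "monic m a0"
        using A u by (auto simp: monic_def a0_def u_def veq_def vge_def intro!: Zint_mult cZ)
      then have a0nz: "a0 \<noteq> 0" by (auto simp: monic_def)
      define h where "h = b / a0"
      define c where "c = ipart h"
      define r where "r = b - c * a0"
      have ha: "h * a0 = b" using a0nz by (simp add: h_def)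
      have rZ: "r \<in> Zint" unfolding r_def c_def by (intro Zint_diff Zint_mult ipart_Zint monic_Zint[OF A(3)] monic_Zint[OF a0])
      have rv: "vge (1 - int m) r"
      proof -
        have "r = (h - c) * a0" unfolding r_def using ha by (simp add: algebra_simps)
        then show ?thesis unfolding c_def using vge_mult[OF vge_fpart monic_vge[OF a0], of h] by simp
      qed
      have hv: "veq (- int (n - m)) h"
        unfolding h_def using veq_divide[OF monic_veq[OF A(3)] monic_veq[OF a0]] assms by simp
      have "(h * a0) $$ (- int (n - m) + - int m) = h $$ (- int (n - m)) * a0 $$ (- int m)"
        by (rule veq_mult_nth[OF hv monic_veq[OF a0]])
      then have h1: "h $$ (- int (n - m)) = 1" using A(3) a0 assms unfolding ha by (simp add: monic_def)
      define g where "g = c - Xpow (int (n - m))"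
      have g: "g \<in> seg (1 - int (n - m)) 0"
        unfolding seg_def
      proof (intro CollectI allI impI)
        fix k assume k: "g $$ k \<noteq> 0"
        show "1 - int (n - m) \<le> k \<and> k \<le> 0"
        proof -
          have "k \<noteq> - int (n - m)" using k h1 by (auto simp: g_def c_def ipart_nth Xpow_nth)
          moreover have "k \<le> 0" using k by (auto simp: g_def c_def ipart_nth Xpow_nth split: if_splits)
          moreover have "\<not> k < - int (n - m)" using k hv by (auto simp: g_def c_def ipart_nth Xpow_nth veq_def vge_def split: if_splits)
          ultimately show ?thesis by linarith
        qed
      qed
      have bc: "b = (Xpow (int (n - m)) + g) * a0 + r" unfolding r_def g_def by simp
      obtain x y where xy: "x \<in> Zint" "y \<in> Zint" "x * a + y * b = 1" using A(4) by (auto simp: bezout_def)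
      have "y * r + (x * fls_const u + y * c) * a0 = x * (fls_const u * a0) + y * (c * a0 + r)"
        by (simp add: algebra_simps)
      also have "\<dots> = 1" unfolding au r_def using xy by simp
      finally have "bezout r a0" unfolding bezout_def using xy cZ
        by (intro bexI[of _ y] bexI[of _ "x * fls_const u + y * c"]) (auto simp: c_def ipart_Zint intro!: Zint_mult Zint_add)
      then have "(r, a0) \<in> redfrac m" using rZ rv a0 by (simp add: redfrac_def)
      then show "ab \<in> ?F ` ?X"
        using u g ab au bc by (intro image_eqI[where x = "(u, (r, a0), g)"]) auto
    qed
  qed
  have "finite ?X" by (intro finite_cartesian_product finite_redfrac finite_seg) auto
  then show "finite (redfrac_at m n :: ('a fls \<times> 'a fls) set)" using bij_betw_finite[OF bij] by simp
  have "card (UNIV - {0::'a}) = CARD('a) - 1" by (simp add: card_Diff_singleton)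
  then show "card (redfrac_at m n :: ('a fls \<times> 'a fls) set) = (CARD('a) - 1) * card (redfrac m :: ('a fls \<times> 'a fls) set) * CARD('a) ^ (n - m)"
    using bij_betw_same_card[OF bij, symmetric] assms
    by (simp add: card_cartesian_product card_seg nat_diff_distrib)
qed

lemma redfrac_at_disjoint: "m \<noteq> m' \<Longrightarrow> redfrac_at m n \<inter> redfrac_at m' n = {}"
  using veq_unique by (fastforce simp: redfrac_at_def)

text \<open>The numerator cannot be 0, since a monic denominator of positive degree is no unit; so
  it has a degree between 0 and \<open>n\<close>.\<close>

lemma redfrac_Suc: "redfrac (Suc n) = (\<Union>m\<in>{..n}. redfrac_at m (Suc n) :: ('a::field fls \<times> 'a fls) set)"
proof (intro set_eqI iffI)
  fix ab :: "'a fls \<times> 'a fls" assume "ab \<in> redfrac (Suc n)"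
  then obtain a b where ab: "ab = (a, b)" and A: "a \<in> Zint" "vge (- int n) a" "monic (Suc n) b" "bezout a b"
    by (auto simp: redfrac_def)
  have "a \<noteq> 0"
  proof
    assume "a = 0"
    then obtain y where "y \<in> Zint" "b * y = 1" using A(4) by (auto simp: bezout_def mult.commute)
    then show False using monic_unit[OF A(3)] by simp
  qed
  then obtain k where k: "veq k a" using veq_exists by blast
  have "k \<le> 0" "- int n \<le> k" using k A Zint_veq_nonpos veq_vge_le by blast+
  then have "veq (- int (nat (- k))) a" "nat (- k) \<le> n" using k by auto
  then show "ab \<in> (\<Union>m\<in>{..n}. redfrac_at m (Suc n))"
    using A unfolding ab redfrac_at_def by (intro UN_I[of "nat (- k)"]) auto
next
  fix ab :: "'a fls \<times> 'a fls" assume "ab \<in> (\<Union>m\<in>{..n}. redfrac_at m (Suc n))"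
  then show "ab \<in> redfrac (Suc n)"
    by (auto simp: redfrac_at_def redfrac_def intro: vge_mono[OF veq_vge])
qed

text \<open>\<open>G m\<close> is the number of reduced fractions with denominator degree m + 1.
  Summing \<open>card_redfrac_at\<close> gives G (m + 1) = s G m + (s - 1) s G m, so each further
  degree multiplies the number by s^2.\<close>

lemma card_Union_redfrac_at:
  assumes "m < n"
  shows "card (\<Union>k\<in>{..m}. redfrac_at k n :: ('a::{field,finite} fls \<times> 'a fls) set) = (CARD('a) - 1) * CARD('a) ^ (m + n)"
proof -
  let ?s = "CARD('a)" and ?c = "\<lambda>n. card (redfrac n :: ('a fls \<times> 'a fls) set)"
  define G where "G m = (\<Sum>k\<le>m. (?s - 1) * ?c k * ?s ^ (m + 1 - k))" for m
  have un: "card (\<Union>k\<in>{..m}. redfrac_at k n :: ('a fls \<times> 'a fls) set) = (\<Sum>k\<le>m. (?s - 1) * ?c k * ?s ^ (n - k))"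
    if "m < n" for m n
  proof -
    have "card (\<Union>k\<in>{..m}. redfrac_at k n :: ('a fls \<times> 'a fls) set) = (\<Sum>k\<le>m. card (redfrac_at k n :: ('a fls \<times> 'a fls) set))"
    proof (rule card_UN_disjoint)
      show "\<forall>k\<in>{..m}. finite (redfrac_at k n :: ('a fls \<times> 'a fls) set)"
        using that by (auto intro!: card_redfrac_at(1))
      show "\<forall>k\<in>{..m}. \<forall>j\<in>{..m}. k \<noteq> j \<longrightarrow> redfrac_at k n \<inter> (redfrac_at j n :: ('a fls \<times> 'a fls) set) = {}"
        by (intro ballI impI redfrac_at_disjoint)
    qed simp
    also have "\<dots> = (\<Sum>k\<le>m. (?s - 1) * ?c k * ?s ^ (n - k))"
    proof (rule sum.cong[OF refl])
      fix k assume "k \<in> {..m}"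
      then show "card (redfrac_at k n :: ('a fls \<times> 'a fls) set) = (?s - 1) * ?c k * ?s ^ (n - k)"
        using that by (intro card_redfrac_at(2)) auto
    qed
    finally show ?thesis .
  qed
  have cS: "?c (Suc m) = G m" for m
    unfolding redfrac_Suc by (subst un) (simp_all add: G_def)
  have G: "G m = (?s - 1) * ?s ^ (2 * m + 1)" for m
  proof (induction m)
    case 0
    show ?case by (simp add: G_def redfrac_0)
  next
    case (Suc m)
    have "G (Suc m) = (\<Sum>k\<le>m. (?s - 1) * ?c k * ?s ^ (Suc m + 1 - k)) + (?s - 1) * ?c (Suc m) * ?s"
      by (simp add: G_def)
    also have "(\<Sum>k\<le>m. (?s - 1) * ?c k * ?s ^ (Suc m + 1 - k)) = ?s * G m"
      unfolding G_def sum_distrib_left by (rule sum.cong) (auto simp: Suc_diff_le)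
    also have "?s * G m + (?s - 1) * ?c (Suc m) * ?s = ?s * ?s * G m"
      unfolding cS using card_field_ge_2[where 'a = 'a] by (cases ?s) (auto simp: algebra_simps)
    finally show ?case using Suc.IH by (simp add: algebra_simps)
  qed
  have "card (\<Union>k\<in>{..m}. redfrac_at k n :: ('a fls \<times> 'a fls) set) = ?s ^ (n - m - 1) * G m"
    unfolding un[OF assms] G_def sum_distrib_left
  proof (rule sum.cong[OF refl])
    fix k assume "k \<in> {..m}"
    then have "n - k = (n - m - 1) + (m + 1 - k)" using assms by auto
    then have "?s ^ (n - k) = ?s ^ (n - m - 1) * ?s ^ (m + 1 - k)" by (simp only: power_add)
    then show "(?s - 1) * ?c k * ?s ^ (n - k) = ?s ^ (n - m - 1) * ((?s - 1) * ?c k * ?s ^ (m + 1 - k))"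
      by simp
  qed
  also have "\<dots> = (?s - 1) * (?s ^ (n - m - 1) * ?s ^ (2 * m + 1))" unfolding G by (simp only: mult_ac)
  also have "?s ^ (n - m - 1) * ?s ^ (2 * m + 1) = ?s ^ (m + n)"
  proof -
    have "(n - m - 1) + (2 * m + 1) = m + n" using assms by simp
    then show ?thesis by (metis power_add)
  qed
  finally show ?thesis .
qed

lemma card_redfrac:
  "n > 0 \<Longrightarrow> card (redfrac n :: ('a::{field,finite} fls \<times> 'a fls) set) = (CARD('a) - 1) * CARD('a) ^ (2 * n - 1)"
  by (cases n) (simp_all add: redfrac_Suc card_Union_redfrac_at mult_2)

text \<open>
  Completing \<open>(p, q)\<close> to a unimodular matrix maps the fractions near \<open>p/q\<close> injectively to reduced fractions
  with small numerator. The bound is sharp enough to make the levels below pairwise negatively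
  correlated.
\<close>

lemma card_near_fractions:
  fixes p q :: "'a::{field,finite} fls"
  assumes pq: "(p, q) \<in> redfrac k" and kn: "k < n" and km: "k < m"
  shows "finite {(p', q') \<in> redfrac n. vge (int m - int n) (p' * q - q' * p)}" (is "finite ?S")
    and "card {(p', q') \<in> redfrac n. vge (int m - int n) (p' * q - q' * p)} \<le>
     (if m \<le> n then (CARD('a) - 1) * CARD('a) ^ (n - m + (n - k)) else 0)"
proof -
  have q: "p \<in> Zint" "monic k q" "bezout p q" using pq by (auto simp: redfrac_def)
  then obtain x0 y0 where xy0: "x0 \<in> Zint" "y0 \<in> Zint" "x0 * p + y0 * q = 1" by (auto simp: bezout_def)
  have qnz: "q \<noteq> 0" using q(2) by (auto simp: monic_def)
  have qZ: "q \<in> Zint" by (rule monic_Zint[OF q(2)])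
  \<comment> \<open>Reducing \<open>x\<close> modulo \<open>q\<close> brings its degree below
    \<open>k\<close>; \<open>y\<close> is adjusted to preserve the Bezout identity.\<close>
  define h where "h = ipart (x0 / q)"
  have hZ: "h \<in> Zint" by (simp add: h_def ipart_Zint)
  define x where "x = x0 - h * q"
  define y where "y = y0 + h * p"
  have xy: "x \<in> Zint" "y \<in> Zint" "x * p + y * q = 1"
    using xy0 hZ q(1) qZ by (auto simp: x_def y_def algebra_simps intro!: Zint_diff Zint_add Zint_mult)
  have "x = (x0 / q - h) * q" using qnz by (simp add: x_def algebra_simps)
  then have xv: "vge (1 - int k) x"
    unfolding h_def using vge_mult[OF vge_fpart monic_vge[OF q(2)], of "x0/q"] by simp
  \<comment> \<open>The matrix with rows (q, -p) and (x, y), of determinant 1, applied to (p', q');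
    \<open>p_eq\<close> and \<open>q_eq\<close> invert it.\<close>
  let ?f = "\<lambda>(p', q'). (p' * q - q' * p, x * p' + y * q')"
  have p_eq: "p' = p * (x * p' + y * q') + y * (p' * q - q' * p)" for p' q'
  proof -
    have "p * (x * p' + y * q') + y * (p' * q - q' * p) = (x * p + y * q) * p'" by (simp add: algebra_simps)
    then show ?thesis using xy by simp
  qed
  have q_eq: "q' = q * (x * p' + y * q') - x * (p' * q - q' * p)" for p' q'
  proof -
    have "q * (x * p' + y * q') - x * (p' * q - q' * p) = (x * p + y * q) * q'" by (simp add: algebra_simps)
    then show ?thesis using xy by simp
  qed
  show fin: "finite ?S" by (rule finite_subset[OF _ finite_redfrac[of n]]) auto
  have inj: "inj_on ?f ?S"
  proof (rule inj_onI, clarify)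
    fix a b c d
    assume e: "a * q - b * p = c * q - d * p" "x * a + y * b = x * c + y * d"
    have "a = p * (x * a + y * b) + y * (a * q - b * p)" by (rule p_eq)
    also have "\<dots> = p * (x * c + y * d) + y * (c * q - d * p)" by (simp only: e)
    also have "\<dots> = c" by (rule p_eq[symmetric])
    finally have ac: "a = c" .
    have "b = q * (x * a + y * b) - x * (a * q - b * p)" by (rule q_eq)
    also have "\<dots> = q * (x * c + y * d) - x * (c * q - d * p)" by (simp only: e)
    also have "\<dots> = d" by (rule q_eq[symmetric])
    finally show "a = c \<and> b = d" using ac by simp
  qed
  have props: "p' * q - q' * p \<in> Zint \<and> p' * q - q' * p \<noteq> 0 \<and> monic (n - k) (x * p' + y * q') \<and> bezout (p' * q - q' * p) (x * p' + y * q')"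
    if "(p', q') \<in> redfrac n" "vge (int m - int n) (p' * q - q' * p)" for p' q'
  proof -
    define a where "a = p' * q - q' * p"
    define b where "b = x * p' + y * q'"
    have p'q': "p' \<in> Zint" "monic n q'" "bezout p' q'" using that by (auto simp: redfrac_def)
    have q'Z: "q' \<in> Zint" by (rule monic_Zint[OF p'q'(2)])
    have aZ: "a \<in> Zint" unfolding a_def by (intro Zint_diff Zint_mult qZ q'Z p'q' q)
    have bZ: "b \<in> Zint" unfolding b_def by (intro Zint_add Zint_mult q'Z p'q' xy)
    have pe: "p' = p * b + y * a" and qe: "q' = q * b - x * a"
      unfolding a_def b_def by (rule p_eq, rule q_eq)
    \<comment> \<open>From deg x < k < m and deg a <= n - m, the product x a stays below degree
      \<open>n\<close>. So q b = q' + x a is monic of degree \<open>n\<close>, and \<open>b\<close>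
      is monic of degree n - k.\<close>
    have "monic n (q' + x * a)"
    proof (rule monic_add_lower[OF p'q'(2)])
      show "x * a \<in> Zint" by (intro Zint_mult xy aZ)
      show "vge (1 - int n) (x * a)"
        by (rule vge_mult'[OF xv]) (use that km in \<open>auto simp: a_def\<close>)
    qed
    moreover have "q' + x * a = q * b" using qe by simp
    ultimately have mb: "monic (n - k) b" using monic_cancel(2)[OF q(2) _ bZ] by simp
    obtain u v where uv: "u \<in> Zint" "v \<in> Zint" "u * p' + v * q' = 1" using p'q'(3) by (auto simp: bezout_def)
    have cab: "(u * y - v * x) * a + (u * p + v * q) * b = 1"
    proof -
      have "(u * y - v * x) * a + (u * p + v * q) * b = u * (p * b + y * a) + v * (q * b - x * a)"
        by (simp add: algebra_simps)
      then show ?thesis using pe qe uv by simp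
    qed
    have "a \<noteq> 0"
    proof
      assume "a = 0"
      then have "b * (u * p + v * q) = 1" using cab by (simp add: mult.commute)
      moreover have "u * p + v * q \<in> Zint" by (intro Zint_add Zint_mult uv q qZ)
      ultimately have "n - k = 0" using monic_unit[OF mb] by blast
      then show False using kn by simp
    qed
    moreover have "bezout a b" unfolding bezout_def using cab uv xy q(1) qZ
      by (intro bexI[of _ "u * y - v * x"] bexI[of _ "u * p + v * q"]) (auto intro!: Zint_add Zint_diff Zint_mult)
    ultimately show ?thesis using aZ mb by (simp add: a_def b_def)
  qed
  show "card ?S \<le> (if m \<le> n then (CARD('a) - 1) * CARD('a) ^ (n - m + (n - k)) else 0)"
  proof (cases "m \<le> n")
    case True
    have sub: "?f ` ?S \<subseteq> (\<Union>i\<in>{..n-m}. redfrac_at i (n - k))"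
    proof
      fix ab assume "ab \<in> ?f ` ?S"
      then obtain p' q' where p'q': "(p', q') \<in> redfrac n" "vge (int m - int n) (p' * q - q' * p)"
        and ab: "ab = (p' * q - q' * p, x * p' + y * q')" by auto
      note P = props[OF p'q']
      then obtain i where i: "veq i (p' * q - q' * p)" using veq_exists by blast
      have "i \<le> 0" "int m - int n \<le> i" using i P p'q'(2) Zint_veq_nonpos veq_vge_le by blast+
      then have "veq (- int (nat (- i))) (p' * q - q' * p)" "nat (- i) \<le> n - m" using i True by auto
      then show "ab \<in> (\<Union>i\<in>{..n-m}. redfrac_at i (n - k))"
        using P unfolding ab redfrac_at_def by (intro UN_I[of "nat (- i)"]) auto
    qed
    have "card ?S \<le> card (\<Union>i\<in>{..n-m}. redfrac_at i (n - k) :: ('a fls \<times> 'a fls) set)"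
      by (rule card_inj_on_le[OF inj sub]) (use km kn True in \<open>auto intro!: card_redfrac_at(1)\<close>)
    also have "\<dots> = (CARD('a) - 1) * CARD('a) ^ (n - m + (n - k))"
      by (rule card_Union_redfrac_at) (use km True kn in auto)
    finally show ?thesis using True by simp
  next
    case False
    \<comment> \<open>For m > n the new numerator would be a polynomial smaller than 1, hence 0,
      which is excluded.\<close>
    have "?S = {}"
    proof (safe)
      fix p' q' assume p'q': "(p', q') \<in> redfrac n" "vge (int m - int n) (p' * q - q' * p)"
      have "vge 1 (p' * q - q' * p)" by (rule vge_mono[OF p'q'(2)]) (use False in simp)
      then show "(p', q') \<in> {}" using props[OF p'q'] Zint_vge_eq_0 by blast
    qed
    then have "card ?S = 0" by (simp only: card.empty)
    then show ?thesis by (simp only:)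
  qed
qed

section \<open>Hits in dimension one\<close>

text \<open>For a denominator of degree \<open>n\<close> this is a ball of radius s^(-m-n) around
  the fraction.\<close>

definition frac_ball :: "nat \<Rightarrow> nat \<Rightarrow> 'a::comm_ring_1 fls \<times> 'a fls \<Rightarrow> 'a fls set" where
  "frac_ball N m pq = {z \<in> seg 1 (int N). vge (int m) (snd pq * z - fst pq)}"

definition level :: "nat \<Rightarrow> nat \<Rightarrow> nat \<Rightarrow> 'a::field fls set" where
  "level N m n = (\<Union>pq\<in>redfrac n. frac_ball N m pq)"

lemma finite_frac_ball: "finite (frac_ball N m pq :: 'a::{field,finite} fls set)"
  unfolding frac_ball_def by (simp add: finite_seg)

text \<open>Membership fixes the digits 1 to m + n - 1 of \<open>z\<close> as those of the fraction
  and leaves the digits from m + n to \<open>N\<close> free.\<close>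

lemma card_frac_ball:
  fixes pq :: "'a::{field,finite} fls \<times> 'a fls"
  assumes pq: "pq \<in> redfrac n" and n: "n > 0" and N: "m + n \<le> N + 1"
  shows "card (frac_ball N m pq) = CARD('a) ^ (N + 1 - (m + n))"
proof -
  obtain p q where [simp]: "pq = (p, q)" by (cases pq)
  have q: "p \<in> Zint" "vge (1 - int n) p" "monic n q" using pq by (auto simp: redfrac_def)
  have qnz: "q \<noteq> 0" using q(3) by (auto simp: monic_def)
  define c where "c = p / q"
  have c: "vge 1 c" using vge_divide[OF q(2) monic_veq[OF q(3)]] by (simp add: c_def)
  have qz: "q * z - p = q * (z - c)" for z using qnz by (simp add: c_def algebra_simps)
  have iff: "vge (int m) (q * z - p) \<longleftrightarrow> vge (int (m + n)) (z - c)" for z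
  proof
    assume "vge (int m) (q * z - p)"
    then have "vge (int m - - int n) (z - c)" unfolding qz by (rule vge_mult_cancel[OF monic_veq[OF q(3)]])
    then show "vge (int (m + n)) (z - c)" by simp
  next
    assume "vge (int (m + n)) (z - c)"
    then show "vge (int m) (q * z - p)" unfolding qz by (rule vge_mult'[OF monic_vge[OF q(3)]]) simp
  qed
  let ?c = "cut 1 (int (m + n) - 1) c"
  have "bij_betw (\<lambda>w. ?c + w) (seg (int (m + n)) (int N)) (frac_ball N m pq)"
    unfolding bij_betw_def
  proof
    show "(\<lambda>w. ?c + w) ` seg (int (m + n)) (int N) = frac_ball N m pq"
    proof (intro set_eqI iffI)
      fix z assume "z \<in> (\<lambda>w. ?c + w) ` seg (int (m + n)) (int N)"
      then obtain w where w: "w \<in> seg (int (m + n)) (int N)" "z = ?c + w" by blast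
      have 1: "z \<in> seg 1 (int N)"
        unfolding seg_def
      proof (intro CollectI allI impI)
        fix k assume "z $$ k \<noteq> 0"
        then have "1 \<le> k \<and> k \<le> int (m + n) - 1 \<or> int (m + n) \<le> k \<and> k \<le> int N"
          using w by (auto simp: seg_def split: if_splits)
        then show "1 \<le> k \<and> k \<le> int N" using n N by auto
      qed
      have 2: "vge (int (m + n)) (z - c)"
        unfolding vge_def
      proof (intro allI impI)
        fix k assume k: "k < int (m + n)"
        then have "w $$ k = 0" using w by (auto simp: seg_def)
        then show "(z - c) $$ k = 0" using k c w(2) by (auto simp: vge_def)
      qed
      show "z \<in> frac_ball N m pq" using 1 2 iff by (simp add: frac_ball_def)
    next
      fix z assume "z \<in> frac_ball N m pq"
      then have z: "z \<in> seg 1 (int N)" "vge (int (m + n)) (z - c)" using iff by (auto simp: frac_ball_def)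
      have "z - ?c \<in> seg (int (m + n)) (int N)"
        unfolding seg_def
      proof (intro CollectI allI impI)
        fix k assume k: "(z - ?c) $$ k \<noteq> 0"
        have k1: "int (m + n) \<le> k"
        proof (rule ccontr)
          assume h: "\<not> int (m + n) \<le> k"
          then have "(z - c) $$ k = 0" using z(2) by (simp add: vge_def)
          then show False using k h c by (auto simp: vge_def split: if_splits)
        qed
        then have "z $$ k \<noteq> 0" using k by auto
        then show "int (m + n) \<le> k \<and> k \<le> int N" using k1 z(1) by (auto simp: seg_def)
      qed
      then show "z \<in> (\<lambda>w. ?c + w) ` seg (int (m + n)) (int N)" by (rule image_eqI[rotated]) simp
    qed
  qed (auto simp: inj_on_def)
  then have "card (frac_ball N m pq) = card (seg (int (m + n)) (int N) :: 'a fls set)"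
    by (rule bij_betw_same_card[symmetric])
  also have "\<dots> = CARD('a) ^ (N + 1 - (m + n))"
    unfolding card_seg by (rule arg_cong[where f = "\<lambda>k. _ ^ k"]) (use N in linarith)
  finally show ?thesis .
qed

text \<open>p' q - q' p = q' (q z - p) - q (q' z - p'), and both terms on the right are at most
  s^(n-m).\<close>

lemma frac_balls_meet:
  fixes z :: "'a::field fls"
  assumes "z \<in> frac_ball N m (p, q)" "z \<in> frac_ball N m' (p', q')" "(p, q) \<in> redfrac k" "(p', q') \<in> redfrac n"
    and "m \<le> m'" "k \<le> n"
  shows "vge (int m - int n) (p' * q - q' * p)"
proof -
  have "p' * q - q' * p = q' * (q * z - p) - q * (q' * z - p')" by (simp add: algebra_simps)
  moreover have "vge (int m - int n) (q' * (q * z - p))"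
    by (rule vge_mult'[of "- int n" _ "int m"]) (use assms in \<open>auto simp: frac_ball_def redfrac_def monic_vge\<close>)
  moreover have "vge (int m - int n) (q * (q' * z - p'))"
    by (rule vge_mult'[of "- int k" _ "int m'"]) (use assms in \<open>auto simp: frac_ball_def redfrac_def monic_vge\<close>)
  ultimately show ?thesis by (simp add: vge_diff)
qed

text \<open>For n < m the determinant of two fractions whose balls meet is a polynomial smaller than
  1, hence 0. Reduced fractions with monic denominators and determinant 0 coincide.\<close>

lemma frac_balls_disjoint:
  assumes "pq \<in> redfrac n" "pq' \<in> redfrac n" "pq \<noteq> pq'" "n < m"
  shows "frac_ball N m pq \<inter> frac_ball N m pq' = ({} :: 'a::field fls set)"
proof (rule ccontr)
  assume "frac_ball N m pq \<inter> frac_ball N m pq' \<noteq> {}"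
  then obtain z where z: "z \<in> frac_ball N m pq" "z \<in> frac_ball N m pq'" by blast
  obtain p q p' q' where pq: "pq = (p, q)" "pq' = (p', q')" by (metis surj_pair)
  have P: "p \<in> Zint" "monic n q" "bezout p q" "p' \<in> Zint" "monic n q'" "bezout p' q'"
    using assms pq by (auto simp: redfrac_def)
  have "vge (int m - int n) (p' * q - q' * p)"
    using frac_balls_meet[of z N m p q m p' q' n n] z assms pq by simp
  then have "vge 1 (p' * q - q' * p)" by (rule vge_mono) (use assms in simp)
  moreover have "p' * q - q' * p \<in> Zint" by (intro Zint_diff Zint_mult P monic_Zint[OF P(2)] monic_Zint[OF P(5)])
  ultimately have e: "p' * q = q' * p" using Zint_vge_eq_0 by force
  obtain x y where xy: "x \<in> Zint" "y \<in> Zint" "x * p + y * q = 1" using P by (auto simp: bezout_def)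
  have "q * (x * p' + y * q') = x * (p' * q) + y * q * q'" by (simp add: algebra_simps)
  also have "\<dots> = q' * (x * p + y * q)" unfolding e by (simp add: algebra_simps)
  finally have qq: "q * (x * p' + y * q') = q'" using xy by simp
  moreover have "x * p' + y * q' \<in> Zint" by (intro Zint_add Zint_mult xy P monic_Zint[OF P(5)])
  ultimately have "monic (n - n) (x * p' + y * q')" using monic_cancel(2)[OF P(2), of n] P(5) by simp
  then have "x * p' + y * q' = 1" using monic_0 by simp
  then have "q = q'" using qq by simp
  moreover have "q \<noteq> 0" using P(2) by (auto simp: monic_def)
  ultimately have "p = p'" using e by (simp add: mult.commute)
  with \<open>q = q'\<close> pq assms show False by simp
qed

lemma card_level:
  assumes "0 < n" "n < m" "m + n \<le> N + 1"
  shows "card (level N m n :: 'a::{field,finite} fls set) =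
    (CARD('a) - 1) * CARD('a) ^ (2 * n - 1) * CARD('a) ^ (N + 1 - (m + n))"
proof -
  have "card (level N m n :: 'a fls set) = (\<Sum>pq\<in>(redfrac n :: ('a fls \<times> 'a fls) set). card (frac_ball N m pq))"
    unfolding level_def
  proof (rule card_UN_disjoint)
    show "\<forall>i\<in>(redfrac n :: ('a fls \<times> 'a fls) set). \<forall>j\<in>redfrac n. i \<noteq> j \<longrightarrow> frac_ball N m i \<inter> frac_ball N m j = {}"
      using frac_balls_disjoint assms by blast
  qed (use finite_redfrac finite_frac_ball in auto)
  also have "\<dots> = card (redfrac n :: ('a fls \<times> 'a fls) set) * CARD('a) ^ (N + 1 - (m + n))"
  proof -
    have "card (frac_ball N m pq) = CARD('a) ^ (N + 1 - (m + n))" if "pq \<in> redfrac n" for pq :: "'a fls \<times> 'a fls"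
      by (rule card_frac_ball[OF that]) (use assms in auto)
    then show ?thesis by simp
  qed
  finally show ?thesis using assms by (simp add: card_redfrac)
qed

text \<open>Meeting balls belong to close fractions, which \<open>card_near_fractions\<close>
  counts. For m <= n the resulting exponents agree exactly with those of the product of the two
  densities; for m > n the levels are disjoint. A constant lost here would leave a variance of the
  order of the squared mean.\<close>

lemma card_level_Int:
  assumes "0 < k" "k < n" "k < m" "m \<le> m'" "n < m'" "m + k \<le> N + 1" "m' + n \<le> N + 1"
  shows "card (level N m k \<inter> level N m' n :: 'a::{field,finite} fls set) * CARD('a) ^ N \<le>
     card (level N m k :: 'a fls set) * card (level N m' n :: 'a fls set)"
proof -
  let ?s = "CARD('a)" and ?C = "redfrac k :: ('a fls \<times> 'a fls) set"
  let ?S = "\<lambda>pq :: 'a fls \<times> 'a fls. {(p', q') \<in> redfrac n. vge (int m - int n) (p' * snd pq - q' * fst pq)}"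
  have finS: "finite (?S pq)" for pq by (rule finite_subset[OF _ finite_redfrac[of n]]) auto
  have "level N m k \<inter> level N m' n \<subseteq> (\<Union>pq\<in>?C. \<Union>pq'\<in>?S pq. frac_ball N m' pq')"
  proof
    fix z :: "'a fls" assume "z \<in> level N m k \<inter> level N m' n"
    then obtain p q p' q' where A: "(p, q) \<in> redfrac k" "(p', q') \<in> redfrac n" "z \<in> frac_ball N m (p, q)" "z \<in> frac_ball N m' (p', q')"
      by (auto simp: level_def)
    have "vge (int m - int n) (p' * q - q' * p)"
      by (rule frac_balls_meet[OF A(3,4,1,2)]) (use assms in auto)
    with A show "z \<in> (\<Union>pq\<in>?C. \<Union>pq'\<in>?S pq. frac_ball N m' pq')"
      by (intro UN_I[of "(p, q)"] UN_I[of "(p', q')"]) auto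
  qed
  then have "card (level N m k \<inter> level N m' n :: 'a fls set) \<le> card (\<Union>pq\<in>?C. \<Union>pq'\<in>?S pq. frac_ball N m' pq')"
    by (rule card_mono[rotated]) (intro finite_UN_I finite_redfrac finS finite_frac_ball)
  also have "\<dots> \<le> (\<Sum>pq\<in>?C. card (\<Union>pq'\<in>?S pq. frac_ball N m' pq'))"
    by (rule card_UN_le[OF finite_redfrac])
  also have "\<dots> \<le> (\<Sum>pq\<in>?C. \<Sum>pq'\<in>?S pq. card (frac_ball N m' pq'))"
    by (intro sum_mono card_UN_le finS)
  also have "\<dots> = (\<Sum>pq\<in>?C. card (?S pq) * ?s ^ (N + 1 - (m' + n)))"
  proof (rule sum.cong[OF refl])
    fix pq
    have "(\<Sum>pq'\<in>?S pq. card (frac_ball N m' pq')) = (\<Sum>pq'\<in>?S pq. ?s ^ (N + 1 - (m' + n)))"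
      by (rule sum.cong[OF refl], rule card_frac_ball[where n = n]) (use assms in auto)
    then show "(\<Sum>pq'\<in>?S pq. card (frac_ball N m' pq')) = card (?S pq) * ?s ^ (N + 1 - (m' + n))" by simp
  qed
  also have "\<dots> \<le> (\<Sum>pq\<in>?C. (if m \<le> n then (?s - 1) * ?s ^ (n - m + (n - k)) else 0) * ?s ^ (N + 1 - (m' + n)))"
  proof (intro sum_mono mult_right_mono)
    fix pq assume "pq \<in> ?C"
    then show "card (?S pq) \<le> (if m \<le> n then (?s - 1) * ?s ^ (n - m + (n - k)) else 0)"
      using card_near_fractions(2)[of "fst pq" "snd pq" k n m] assms by simp
  qed simp
  also have "\<dots> = card ?C * ((if m \<le> n then (?s - 1) * ?s ^ (n - m + (n - k)) else 0) * ?s ^ (N + 1 - (m' + n)))"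
    by simp
  finally have le: "card (level N m k \<inter> level N m' n :: 'a fls set) \<le>
    card ?C * ((if m \<le> n then (?s - 1) * ?s ^ (n - m + (n - k)) else 0) * ?s ^ (N + 1 - (m' + n)))" .
  show ?thesis
  proof (cases "m \<le> n")
    case True
    have "card (level N m k \<inter> level N m' n :: 'a fls set) * ?s ^ N \<le>
       (card ?C * ((?s - 1) * ?s ^ (n - m + (n - k)) * ?s ^ (N + 1 - (m' + n)))) * ?s ^ N"
      using le True by (intro mult_right_mono) auto
    also have "\<dots> = (?s - 1) * (?s - 1) * (?s ^ (2 * k - 1) * ?s ^ (n - m + (n - k)) * ?s ^ (N + 1 - (m' + n)) * ?s ^ N)"
      unfolding card_redfrac[OF assms(1)] by (simp only: mult_ac)
    also have "?s ^ (2 * k - 1) * ?s ^ (n - m + (n - k)) * ?s ^ (N + 1 - (m' + n)) * ?s ^ N =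
       ?s ^ (2 * k - 1) * ?s ^ (N + 1 - (m + k)) * (?s ^ (2 * n - 1) * ?s ^ (N + 1 - (m' + n)))"
      unfolding power_add[symmetric] by (rule arg_cong[where f = "\<lambda>k. _ ^ k"]) (use assms True in linarith)
    also have "(?s - 1) * (?s - 1) * \<dots> = card (level N m k :: 'a fls set) * card (level N m' n :: 'a fls set)"
    proof -
      have "0 < n" using assms by simp
      show ?thesis
        unfolding card_level[OF assms(1,3,6)] card_level[OF \<open>0 < n\<close> assms(5,7)] by (simp only: mult_ac)
    qed
    finally show ?thesis .
  next
    case False
    then show ?thesis using le by simp
  qed
qed

text \<open>By \<open>card_level_Int\<close> only the diagonal of the pair sum exceeds the product
  of densities, so the variance is at most the mean and Chebyshev's inequality applies with
  \<open>L = 1\<close>. Monotonicity of \<open>m\<close> orders every pair of levels as that lemma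
  requires.\<close>

lemma level_second_moment:
  fixes m :: "nat \<Rightarrow> nat"
  defines "s \<equiv> real CARD('a::{field,finite})"
  assumes fin: "finite \<Theta>" "\<Theta> \<noteq> {}" and \<Theta>: "\<And>n. n \<in> \<Theta> \<Longrightarrow> 0 < n \<and> n < m n \<and> m n + n \<le> N + 1"
    and mono: "\<And>k n. k \<in> \<Theta> \<Longrightarrow> n \<in> \<Theta> \<Longrightarrow> k \<le> n \<Longrightarrow> m k \<le> m n"
  shows "real (card {z \<in> (seg 1 (int N) :: 'a fls set). \<forall>n\<in>\<Theta>. z \<notin> level N (m n) n}) * (\<Sum>n\<in>\<Theta>. (s - 1) * s ^ n * (1/s) ^ m n)
     \<le> s ^ N"
proof -
  have s2: "s \<ge> 2" using card_field_ge_2[where 'a='a] by (simp add: s_def)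
  let ?\<Omega> = "seg 1 (int N) :: 'a fls set"
  define E where "E n = (level N (m n) n :: 'a fls set)" for n
  define P where "P n = (s - 1) * s ^ n * (1/s) ^ m n" for n
  have c\<Omega>: "real (card ?\<Omega>) = s ^ N" by (simp add: card_seg s_def)
  have Ppos: "P n > 0" for n using s2 by (simp add: P_def)
  have cE: "real (card (E n)) = P n * real (card ?\<Omega>)" if "n \<in> \<Theta>" for n
  proof -
    have "2 * n - 1 + (N + 1 - (m n + n)) + m n = n + N" using \<Theta>[OF that] by linarith
    then have "s ^ (2 * n - 1) * s ^ (N + 1 - (m n + n)) * s ^ m n = s ^ n * s ^ N"
      by (metis power_add)
    then have e: "s ^ (2 * n - 1) * s ^ (N + 1 - (m n + n)) = s ^ n * s ^ N * (1/s) ^ m n"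
      using s2 by (simp add: power_divide field_simps)
    have "real (card (E n)) = (s - 1) * (s ^ (2 * n - 1) * s ^ (N + 1 - (m n + n)))"
      unfolding E_def using \<Theta>[OF that] card_field_ge_2[where 'a='a]
      by (subst card_level) (auto simp: s_def of_nat_diff)
    then show ?thesis unfolding e c\<Omega> P_def by (simp only: mult_ac)
  qed
  have sub: "E n \<subseteq> ?\<Omega>" for n by (auto simp: E_def level_def frac_ball_def)
  have pair: "real (card (E k \<inter> E n)) \<le> P k * P n * real (card ?\<Omega>)" if "k \<in> \<Theta>" "n \<in> \<Theta>" "k < n" for k n
  proof -
    have "card (E k \<inter> E n) * CARD('a) ^ N \<le> card (E k) * card (E n)"
      unfolding E_def by (rule card_level_Int) (use \<Theta>[OF that(1)] \<Theta>[OF that(2)] mono[OF that(1,2)] that(3) in auto)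
    then have "real (card (E k \<inter> E n) * CARD('a) ^ N) \<le> real (card (E k) * card (E n))" by (rule of_nat_mono)
    then have "real (card (E k \<inter> E n)) * s ^ N \<le> (P k * P n * s ^ N) * s ^ N"
      using cE that by (simp add: s_def[symmetric] c\<Omega> mult_ac)
    then have "real (card (E k \<inter> E n)) \<le> P k * P n * s ^ N"
      by (rule mult_right_le_imp_le) (use s2 in simp)
    then show ?thesis by (simp add: c\<Omega>)
  qed
  define A where "A = sum P \<Theta>"
  have A: "A > 0" unfolding A_def using fin Ppos by (intro sum_pos) auto
  have "(\<Sum>k\<in>\<Theta>. \<Sum>n\<in>\<Theta>. real (card (E k \<inter> E n))) \<le>
     (\<Sum>k\<in>\<Theta>. \<Sum>n\<in>\<Theta>. P k * P n * real (card ?\<Omega>) + (if k = n then P k * real (card ?\<Omega>) else 0))"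
  proof (intro sum_mono)
    fix k n assume kn: "k \<in> \<Theta>" "n \<in> \<Theta>"
    show "real (card (E k \<inter> E n)) \<le> P k * P n * real (card ?\<Omega>) + (if k = n then P k * real (card ?\<Omega>) else 0)"
    proof (cases k n rule: linorder_cases)
      case less
      then show ?thesis using pair[OF kn] by simp
    next
      case equal
      then show ?thesis using cE kn Ppos less_imp_le[OF Ppos] by simp
    next
      case greater
      then show ?thesis using pair[OF kn(2,1)] by (simp add: Int_commute mult_ac)
    qed
  qed
  also have "\<dots> = (A\<^sup>2 + 1 * A) * real (card ?\<Omega>)"
    using fin by (simp add: sum.distrib A_def power2_eq_square sum_product sum_distrib_right[symmetric] distrib_right)
  finally have pr: "(\<Sum>k\<in>\<Theta>. \<Sum>n\<in>\<Theta>. real (card (E k \<inter> E n))) \<le> (A\<^sup>2 + 1 * A) * real (card ?\<Omega>)" .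
  have "real (card {z \<in> ?\<Omega>. \<forall>n\<in>\<Theta>. z \<notin> E n}) * A \<le> 1 * real (card ?\<Omega>)"
    by (rule second_moment_bound[OF finite_seg fin(1) A_def A sub cE pr])
  then show ?thesis unfolding E_def A_def P_def c\<Omega> by simp
qed

text \<open>\<open>D\<close> is a single scalar of absolute value s^(-k) with |k| <= e, so the
  vectors of shell \<open>\<tau>\<close> are the polynomials of degree \<tau> + k, and a level of
  reduced fractions consists of hits. By \<open>dec\<close> the exponents of the balls do not
  decrease with \<open>\<tau>\<close>, as the second moment bound demands.\<close>

lemma no_hit_small_one:
  fixes c :: 'i and a :: "nat \<Rightarrow> real"
  assumes a: "\<And>\<tau>. 0 < a \<tau>" "\<And>\<tau>. a \<tau> \<le> 1"
    and dec: "\<And>\<tau> \<tau>'. \<tau> \<le> \<tau>' \<Longrightarrow> (1 / real CARD('a)) ^ \<tau>' * a \<tau>' \<le> (1 / real CARD('a)) ^ \<tau> * a \<tau>"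
    and div: "\<not> summable a" and \<epsilon>: "\<epsilon> > 0"
  shows "\<exists>N S. 2 * S + e \<le> N \<and> (\<forall>D D'. inv_pair e {c} D D' \<longrightarrow>
    real (card {z \<in> {c} \<rightarrow>\<^sub>E (seg 1 (int N) :: 'a::{field,finite} fls set). \<not> hit S e T a {c} D z}) \<le>
      \<epsilon> * real (card ({c} \<rightarrow>\<^sub>E (seg 1 (int N) :: 'a fls set))))"
proof -
  define s where "s = real CARD('a)"
  have s2: "s \<ge> 2" using card_field_ge_2[where 'a='a] by (simp add: s_def)
  define r where "r \<tau> = (1/s) ^ (e+1) * a \<tau> * (1/s) ^ \<tau>" for \<tau>
  have rpos: "r \<tau> > 0" for \<tau> using s2 a by (simp add: r_def)
  have rle: "r \<tau> \<le> (1/s) ^ (e + 1 + \<tau>)" for \<tau>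
  proof -
    have "r \<tau> \<le> (1/s) ^ (e+1) * 1 * (1/s) ^ \<tau>"
      unfolding r_def using s2 a less_imp_le[OF a(1)] by (intro mult_mono) auto
    then show ?thesis by (simp add: power_add)
  qed
  have rlt: "r \<tau> < 1" for \<tau>
  proof -
    have "(1/s) ^ (e + 1 + \<tau>) < 1" using s2 power_less_one_iff[of "1/s" "e + 1 + \<tau>"] by simp
    then show ?thesis using rle[of \<tau>] by linarith
  qed
  obtain M where M: "\<And>\<tau>. (1/s) ^ Suc (M \<tau>) \<le> r \<tau>" "\<And>\<tau>. r \<tau> < (1/s) ^ M \<tau>"
    using least_power_below[OF s2 rpos rlt] by metis
  have inv1: "0 < 1/s" "1/s < 1" using s2 by auto
  have Mmono: "M \<tau> \<le> M \<tau>'" if "\<tau> \<le> \<tau>'" for \<tau> \<tau>'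
  proof -
    have "r \<tau>' \<le> r \<tau>"
    proof -
      have "(1/s) ^ (e+1) * ((1/s) ^ \<tau>' * a \<tau>') \<le> (1/s) ^ (e+1) * ((1/s) ^ \<tau> * a \<tau>)"
        using dec[OF that] s2 unfolding s_def[symmetric] by (intro mult_left_mono) auto
      then show ?thesis by (simp only: r_def mult_ac)
    qed
    then have "(1/s) ^ Suc (M \<tau>') < (1/s) ^ M \<tau>" using M(1)[of \<tau>'] M(2)[of \<tau>] by linarith
    then have "M \<tau> < Suc (M \<tau>')" using inv1 by (simp only: power_strict_decreasing_iff)
    then show ?thesis by simp
  qed
  \<comment> \<open>Due to the factor (1/s)^(e+1) in \<open>hit\<close>: the degrees \<tau> + k <=
    \<tau> + e stay below the exponent of the balls, which makes the balls of one level
    disjoint.\<close>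
  have Mlarge: "\<tau> + e < Suc (M \<tau>)" for \<tau>
  proof -
    have "(1/s) ^ Suc (M \<tau>) \<le> (1/s) ^ (e + 1 + \<tau>)" using M(1)[of \<tau>] rle[of \<tau>] by linarith
    then have "e + 1 + \<tau> \<le> Suc (M \<tau>)" using inv1 by (simp only: power_decreasing_iff)
    then show ?thesis by simp
  qed
  \<comment> \<open>The exponent is \<open>e\<close> for the shift of degrees by \<open>k\<close>, e
    + 1 for the factor in \<open>hit\<close>, and 1 for rounding to a power of 1/s.\<close>
  define \<kappa> where "\<kappa> = (1/s) ^ (2 * e + 2)"
  have \<kappa>: "\<kappa> > 0" using s2 by (simp add: \<kappa>_def)
  \<comment> \<open>Makes the degrees \<tau> + k positive for every k >= -e and puts all hits beyond
    \<open>T\<close>.\<close>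
  define \<tau>0 where "\<tau>0 = e + 1 + T"
  obtain \<tau>1 where \<tau>1: "\<tau>1 \<ge> \<tau>0" "1 / (\<epsilon> * \<kappa>) \<le> (\<Sum>\<tau>\<in>{\<tau>0..\<tau>1}. a \<tau>)"
    using divergent_tail[OF _ div, of \<tau>0 "1 / (\<epsilon> * \<kappa>)"] less_imp_le[OF a(1)] by auto
  define S where "S = \<tau>1 + Suc (M \<tau>1)"
  define N where "N = 2 * S + e"
  let ?\<Omega> = "seg 1 (int N) :: 'a fls set"
  have fun_card: "card {z \<in> {c} \<rightarrow>\<^sub>E ?\<Omega>. R (z c)} = card {z \<in> ?\<Omega>. R z}" for R
  proof (rule bij_betw_same_card[of "\<lambda>z. z c"], rule bij_betwI[where g = "\<lambda>y. \<lambda>x\<in>{c}. y"])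
    fix x assume "x \<in> {z \<in> {c} \<rightarrow>\<^sub>E ?\<Omega>. R (z c)}"
    then show "(\<lambda>xa\<in>{c}. x c) = x" by (auto simp: PiE_def extensional_def fun_eq_iff)
  qed auto
  have main: "real (card {z \<in> {c} \<rightarrow>\<^sub>E ?\<Omega>. \<not> hit S e T a {c} D z}) \<le> \<epsilon> * real (card ({c} \<rightarrow>\<^sub>E ?\<Omega>))"
    if D: "inv_pair e {c} D D'" for D D' :: "'i \<Rightarrow> 'i \<Rightarrow> 'a fls"
  proof -
    define \<delta> where "\<delta> = D c c"
    have \<delta>: "vge (- int e) \<delta>" "vge (- int e) (D' c c)" "\<delta> * D' c c = 1" using D by (auto simp: inv_pair_def \<delta>_def)
    have "\<delta> \<noteq> 0" using \<delta>(3) by auto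
    then obtain k where k: "veq k \<delta>" using veq_exists by blast
    have "D' c c \<noteq> 0" using \<delta>(3) by auto
    then obtain k' where k': "veq k' (D' c c)" using veq_exists by blast
    have "veq (k + k') (1 :: 'a fls)" using veq_mult[OF k k'] \<delta>(3) by simp
    then have "k' = - k" by (auto simp: veq_iff)
    then have ke: "- int e \<le> k" "k \<le> int e" using veq_vge_le[OF k \<delta>(1)] veq_vge_le[OF k' \<delta>(2)] by auto
    define \<theta> where "\<theta> \<tau> = nat (int \<tau> + k)" for \<tau>
    have \<theta>: "int (\<theta> \<tau>) = int \<tau> + k" if "\<tau> \<in> {\<tau>0..\<tau>1}" for \<tau>
      using that ke by (auto simp: \<theta>_def \<tau>0_def)
    define \<Theta> where "\<Theta> = \<theta> ` {\<tau>0..\<tau>1}"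
    have inj: "inj_on \<theta> {\<tau>0..\<tau>1}"
    proof (rule inj_onI)
      fix x y assume "x \<in> {\<tau>0..\<tau>1}" "y \<in> {\<tau>0..\<tau>1}" "\<theta> x = \<theta> y"
      then have "int x + k = int y + k" using \<theta>[of x] \<theta>[of y] by (simp only:)
      then show "x = y" by linarith
    qed
    define m where "m n = Suc (M (nat (int n - k)))" for n
    have m\<theta>: "m (\<theta> \<tau>) = Suc (M \<tau>)" if "\<tau> \<in> {\<tau>0..\<tau>1}" for \<tau>
      using \<theta>[OF that] by (simp add: m_def)
    have bound: "0 < n \<and> n < m n \<and> m n + n \<le> N + 1" if n: "n \<in> \<Theta>" for n
    proof -
      obtain \<tau> where \<tau>: "\<tau> \<in> {\<tau>0..\<tau>1}" "n = \<theta> \<tau>" using n by (auto simp: \<Theta>_def)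
      have "M \<tau> \<le> M \<tau>1" using \<tau> Mmono by auto
      then show ?thesis using \<theta>[OF \<tau>(1)] m\<theta>[OF \<tau>(1)] \<tau> ke Mlarge[of \<tau>] by (auto simp: \<tau>0_def N_def S_def)
    qed
    have mono: "m i \<le> m n" if "i \<in> \<Theta>" "n \<in> \<Theta>" "i \<le> n" for i n
      using that by (auto simp: m_def intro!: Mmono)
    have "\<Theta> \<noteq> {}" "finite \<Theta>" using \<tau>1 by (auto simp: \<Theta>_def)
    then have key: "real (card {z \<in> ?\<Omega>. \<forall>n\<in>\<Theta>. z \<notin> level N (m n) n}) * (\<Sum>n\<in>\<Theta>. (s - 1) * s ^ n * (1/s) ^ m n) \<le> s ^ N"
      unfolding s_def by (intro level_second_moment bound mono)
    have "1 / \<epsilon> = \<kappa> * (1 / (\<epsilon> * \<kappa>))" using \<kappa> by simp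
    also have "\<dots> \<le> \<kappa> * (\<Sum>\<tau>\<in>{\<tau>0..\<tau>1}. a \<tau>)" using \<tau>1(2) \<kappa> by (intro mult_left_mono) auto
    also have "\<dots> = (\<Sum>\<tau>\<in>{\<tau>0..\<tau>1}. \<kappa> * a \<tau>)" by (simp add: sum_distrib_left)
    also have "\<dots> \<le> (\<Sum>\<tau>\<in>{\<tau>0..\<tau>1}. (s - 1) * s ^ \<theta> \<tau> * (1/s) ^ m (\<theta> \<tau>))"
    proof (rule sum_mono)
      fix \<tau> assume \<tau>: "\<tau> \<in> {\<tau>0..\<tau>1}"
      have "\<tau> \<le> \<theta> \<tau> + e" using \<theta>[OF \<tau>] ke by linarith
      then have "s ^ \<tau> \<le> s ^ \<theta> \<tau> * s ^ e" unfolding power_add[symmetric] using s2 by (intro power_increasing) auto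
      then have 1: "s ^ \<tau> * (1/s) ^ e \<le> s ^ \<theta> \<tau>" using s2 by (simp add: power_divide field_simps)
      have 2: "r \<tau> * (1/s) \<le> (1/s) ^ m (\<theta> \<tau>)"
        unfolding m\<theta>[OF \<tau>] using M(2)[of \<tau>] s2 by (simp add: divide_right_mono)
      have "\<kappa> * a \<tau> = 1 * (s ^ \<tau> * (1/s) ^ e) * (r \<tau> * (1/s))"
      proof -
        have "2 * e + 2 = e + (e + 1) + 1" by simp
        then have "\<kappa> = (1/s) ^ e * (1/s) ^ (e+1) * (1/s)" unfolding \<kappa>_def by (simp only: power_add power_one_right)
        moreover have "s ^ \<tau> * (1/s) ^ \<tau> = 1" using s2 by (simp add: power_mult_distrib[symmetric])
        ultimately show ?thesis unfolding r_def by (simp add: mult_ac)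
      qed
      also have "\<dots> \<le> (s - 1) * s ^ \<theta> \<tau> * (1/s) ^ m (\<theta> \<tau>)"
        using 1 2 s2 rpos[of \<tau>] by (intro mult_mono) auto
      finally show "\<kappa> * a \<tau> \<le> (s - 1) * s ^ \<theta> \<tau> * (1/s) ^ m (\<theta> \<tau>)" .
    qed
    also have "\<dots> = (\<Sum>n\<in>\<Theta>. (s - 1) * s ^ n * (1/s) ^ m n)"
      unfolding \<Theta>_def by (simp add: sum.reindex[OF inj])
    finally have "real (card {z \<in> ?\<Omega>. \<forall>n\<in>\<Theta>. z \<notin> level N (m n) n}) * (1 / \<epsilon>) \<le> s ^ N"
      using key by (meson mult_left_mono of_nat_0_le_iff order_trans)
    then have b: "real (card {z \<in> ?\<Omega>. \<forall>n\<in>\<Theta>. z \<notin> level N (m n) n}) \<le> \<epsilon> * s ^ N"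
      using \<epsilon> by (simp add: field_simps)
    have "{z \<in> {c} \<rightarrow>\<^sub>E ?\<Omega>. \<not> hit S e T a {c} D z} \<subseteq> {z \<in> {c} \<rightarrow>\<^sub>E ?\<Omega>. \<forall>n\<in>\<Theta>. z c \<notin> level N (m n) n}"
    proof (safe)
      fix z n assume nh: "\<not> hit S e T a {c} D z" and n: "n \<in> \<Theta>" and z: "z c \<in> level N (m n) n"
      obtain \<tau> where \<tau>: "\<tau> \<in> {\<tau>0..\<tau>1}" "n = \<theta> \<tau>" using n by (auto simp: \<Theta>_def)
      obtain p q where pq: "(p, q) \<in> redfrac n" "vge (int (m n)) (q * z c - p)" using z by (auto simp: level_def frac_ball_def)
      have q: "p \<in> Zint" "monic n q" using pq by (auto simp: redfrac_def)
      have "veq (k + - int n) (\<delta> * q)" by (rule veq_mult[OF k monic_veq[OF q(2)]])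
      then have v: "veq (- int \<tau>) (\<delta> * q)" using \<theta>[OF \<tau>(1)] \<tau>(2) by simp
      have mS: "m n \<le> S" using m\<theta>[OF \<tau>(1)] \<tau> Mmono[of \<tau> \<tau>1] by (simp add: S_def)
      have "(1/s) ^ m n * s ^ \<tau> \<le> r \<tau> * s ^ \<tau>"
        using M(1)[of \<tau>] m\<theta>[OF \<tau>(1)] \<tau>(2) s2 by (intro mult_right_mono) auto
      also have "\<dots> = (1/s) ^ (e+1) * a \<tau>" using s2 by (simp add: r_def power_divide)
      finally have "hit S e T a {c} D z"
        unfolding hit_def using v mS pq q \<tau> monic_Zint[OF q(2)]
        by (intro bexI[of _ "\<lambda>l\<in>{c}. q"] bexI[of _ "- p"] exI[of _ "m n"] exI[of _ "\<lambda>_. \<tau>"])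
           (auto simp: dot_def \<delta>_def s_def S_def \<tau>0_def mult.commute Zint_uminus)
      with nh show False by simp
    qed
    then have "card {z \<in> {c} \<rightarrow>\<^sub>E ?\<Omega>. \<not> hit S e T a {c} D z} \<le> card {z \<in> {c} \<rightarrow>\<^sub>E ?\<Omega>. \<forall>n\<in>\<Theta>. z c \<notin> level N (m n) n}"
      by (rule card_mono[rotated]) (simp add: finite_PiE finite_seg)
    also have "\<dots> = card {z \<in> ?\<Omega>. \<forall>n\<in>\<Theta>. z \<notin> level N (m n) n}" by (rule fun_card)
    finally have "real (card {z \<in> {c} \<rightarrow>\<^sub>E ?\<Omega>. \<not> hit S e T a {c} D z}) \<le> \<epsilon> * s ^ N" using b by linarith
    then show ?thesis by (simp add: card_PiE card_seg s_def)
  qed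
  show ?thesis using main by (intro exI[of _ N] exI[of _ S]) (auto simp: N_def)
qed

lemma no_hit_small:
  fixes J :: "'i set" and a :: "nat \<Rightarrow> real"
  assumes J: "finite J" "J \<noteq> {}" and a: "\<And>\<tau>. 0 < a \<tau>" "\<And>\<tau>. a \<tau> \<le> 1"
    and dec: "\<And>\<tau> \<tau>'. \<tau> \<le> \<tau>' \<Longrightarrow> (1 / real CARD('a)) ^ \<tau>' * a \<tau>' \<le> (1 / real CARD('a)) ^ \<tau> * a \<tau>"
    and div: "\<not> summable (\<lambda>\<tau>. real (\<tau> + 1) ^ (card J - 1) * a \<tau>)" and \<epsilon>: "\<epsilon> > 0"
  shows "\<exists>N S. 2 * S + e \<le> N \<and> (\<forall>D D'. inv_pair e J D D' \<longrightarrow>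
    real (card {z \<in> J \<rightarrow>\<^sub>E (seg 1 (int N) :: 'a::{field,finite} fls set). \<not> hit S e T a J D z}) \<le>
      \<epsilon> * real (card (J \<rightarrow>\<^sub>E (seg 1 (int N) :: 'a fls set))))"
proof (cases "card J \<ge> 2")
  case True
  then show ?thesis using no_hit_small_several[OF J(1) True a div \<epsilon>] by blast
next
  case False
  moreover have "card J > 0" using J by (simp add: card_gt_0_iff)
  ultimately have "card J = 1" by linarith
  then obtain c where c: "J = {c}" by (rule card_1_singletonE)
  have "\<not> summable a" using div unfolding c by simp
  then show ?thesis using no_hit_small_one[where c = c, OF a dec _ \<epsilon>] unfolding c by blast
qed

section \<open>Condensation of the series\<close>

text \<open>On the block s^n <= x < s^(n+1) one has ln x <= (n + 1) ln s and \<psi> x <= \<psi>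
  (s^n), and there are fewer than s^(n+1) terms.\<close>

lemma condensation_block:
  fixes \<psi> :: "real \<Rightarrow> real" and s :: nat
  assumes s: "s \<ge> 2" and nonneg: "\<And>x. x > 0 \<Longrightarrow> \<psi> x \<ge> 0" and dec: "antimono_on {0<..} \<psi>"
  shows "(\<Sum>x\<in>{1..<s ^ n}. ln (real x) ^ k * \<psi> (real x)) \<le>
    (ln (real s) ^ k * real s) * (\<Sum>\<tau><n. real (\<tau> + 1) ^ k * (real s ^ \<tau> * \<psi> (real s ^ \<tau>)))"
proof (induction n)
  case (Suc n)
  let ?F = "\<lambda>x. ln (real x) ^ k * \<psi> (real x)"
  have le: "s ^ n \<le> s ^ Suc n" "1 \<le> s ^ n" using s by auto
  have "(\<Sum>x\<in>{s ^ n..<s ^ Suc n}. ?F x) \<le> (\<Sum>x\<in>{s ^ n..<s ^ Suc n}. (real (n + 1) * ln (real s)) ^ k * \<psi> (real s ^ n))"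
  proof (rule sum_mono)
    fix x assume x: "x \<in> {s ^ n..<s ^ Suc n}"
    then have x1: "1 \<le> x" using le by auto
    have "real x \<le> real s ^ (n + 1)" using x by (metis Suc_eq_plus1 atLeastLessThan_iff less_imp_le of_nat_le_iff of_nat_power)
    then have "ln (real x) \<le> ln (real s ^ (n + 1))" using x1 s by (subst ln_le_cancel_iff) auto
    also have "\<dots> = real (n + 1) * ln (real s)" using s by (subst ln_realpow) auto
    finally have 1: "ln (real x) \<le> real (n + 1) * ln (real s)" .
    have "real s ^ n \<le> real x" using x by (metis atLeastLessThan_iff of_nat_le_iff of_nat_power)
    then have 2: "\<psi> (real x) \<le> \<psi> (real s ^ n)" using dec s x1 by (auto simp: monotone_on_def)
    show "?F x \<le> (real (n + 1) * ln (real s)) ^ k * \<psi> (real s ^ n)"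
      using 1 2 x1 s nonneg[of "real x"] by (intro mult_mono power_mono) auto
  qed
  also have "\<dots> = real (s ^ Suc n - s ^ n) * ((real (n + 1) * ln (real s)) ^ k * \<psi> (real s ^ n))" by simp
  also have "\<dots> \<le> real (s ^ Suc n) * ((real (n + 1) * ln (real s)) ^ k * \<psi> (real s ^ n))"
    using s nonneg[of "real s ^ n"] by (intro mult_right_mono of_nat_mono mult_nonneg_nonneg zero_le_power) auto
  also have "\<dots> = (ln (real s) ^ k * real s) * (real (n + 1) ^ k * (real s ^ n * \<psi> (real s ^ n)))"
    by (simp add: power_mult_distrib)
  finally have b: "(\<Sum>x\<in>{s ^ n..<s ^ Suc n}. ?F x) \<le> (ln (real s) ^ k * real s) * (real (n + 1) ^ k * (real s ^ n * \<psi> (real s ^ n)))" .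
  have "(\<Sum>x\<in>{1..<s ^ Suc n}. ?F x) = (\<Sum>x\<in>{1..<s ^ n}. ?F x) + (\<Sum>x\<in>{s ^ n..<s ^ Suc n}. ?F x)"
    by (rule sum.atLeastLessThan_concat[symmetric]) (use le in auto)
  also have "\<dots> \<le> (ln (real s) ^ k * real s) * (\<Sum>\<tau><n. real (\<tau> + 1) ^ k * (real s ^ \<tau> * \<psi> (real s ^ \<tau>))) +
     (ln (real s) ^ k * real s) * (real (n + 1) ^ k * (real s ^ n * \<psi> (real s ^ n)))"
    by (rule add_mono[OF Suc.IH b])
  finally show ?case by (simp only: sum.lessThan_Suc distrib_left)
qed simp

text \<open>Cutting off at 1 is harmless: convergence of the truncated series brings its terms below
  1 eventually, and as the weights are at least 1, the minimum is then its second argument. Cauchy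
  condensation with base s does the rest.\<close>

lemma condensation:
  fixes \<psi> :: "real \<Rightarrow> real" and s :: nat
  assumes s: "s \<ge> 2" and nonneg: "\<And>x. x > 0 \<Longrightarrow> \<psi> x \<ge> 0" and dec: "antimono_on {0<..} \<psi>"
    and div: "\<not> summable (\<lambda>m::nat. ln (real (Suc m)) ^ k * \<psi> (real (Suc m)))"
  shows "\<not> summable (\<lambda>\<tau>. real (\<tau> + 1) ^ k * min 1 (real s ^ \<tau> * \<psi> (real s ^ \<tau>)))"
proof
  assume sm: "summable (\<lambda>\<tau>. real (\<tau> + 1) ^ k * min 1 (real s ^ \<tau> * \<psi> (real s ^ \<tau>)))"
  let ?c = "\<lambda>\<tau>. real s ^ \<tau> * \<psi> (real s ^ \<tau>)"
  let ?h = "\<lambda>\<tau>. real (\<tau> + 1) ^ k * ?c \<tau>"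
  have "(\<lambda>\<tau>. real (\<tau> + 1) ^ k * min 1 (?c \<tau>)) \<longlonglongrightarrow> 0" by (rule summable_LIMSEQ_zero[OF sm])
  then have "eventually (\<lambda>\<tau>. real (\<tau> + 1) ^ k * min 1 (?c \<tau>) < 1) sequentially"
    by (rule order_tendstoD(2)) simp
  then have "eventually (\<lambda>\<tau>. real (\<tau> + 1) ^ k * min 1 (?c \<tau>) = ?h \<tau>) sequentially"
  proof (rule eventually_mono)
    fix \<tau> assume lt: "real (\<tau> + 1) ^ k * min 1 (?c \<tau>) < 1"
    have "1 \<le> real (\<tau> + 1) ^ k" by (rule one_le_power) simp
    have "?c \<tau> < 1"
    proof (rule ccontr)
      assume "\<not> ?c \<tau> < 1"
      then have "min 1 (?c \<tau>) = 1" by simp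
      with lt \<open>1 \<le> real (\<tau> + 1) ^ k\<close> show False by (simp only: mult_1_right)
    qed
    then show "real (\<tau> + 1) ^ k * min 1 (?c \<tau>) = ?h \<tau>" by simp
  qed
  then have sh: "summable ?h" using sm by (subst (asm) summable_cong)
  have hn: "?h \<tau> \<ge> 0" for \<tau> using s nonneg[of "real s ^ \<tau>"] by simp
  have "summable (\<lambda>m::nat. ln (real (Suc m)) ^ k * \<psi> (real (Suc m)))"
  proof (rule summableI_nonneg_bounded)
    show "0 \<le> ln (real (Suc m)) ^ k * \<psi> (real (Suc m))" for m
      using nonneg[of "real (Suc m)"] by (intro mult_nonneg_nonneg zero_le_power) auto
    fix N
    have "(\<Sum>m<N. ln (real (Suc m)) ^ k * \<psi> (real (Suc m))) = (\<Sum>x\<in>{1..<Suc N}. ln (real x) ^ k * \<psi> (real x))"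
      by (rule sum.reindex_bij_witness[of _ "\<lambda>x. x - 1" Suc]) auto
    also have "\<dots> \<le> (\<Sum>x\<in>{1..<s ^ Suc N}. ln (real x) ^ k * \<psi> (real x))"
    proof (rule sum_mono2)
      have "Suc N < 2 ^ Suc N" by (rule less_exp)
      also have "(2::nat) ^ Suc N \<le> s ^ Suc N" using s by (rule power_mono) simp
      finally show "{1..<Suc N} \<subseteq> {1..<s ^ Suc N}" by auto
      show "0 \<le> ln (real x) ^ k * \<psi> (real x)" if "x \<in> {1..<s ^ Suc N} - {1..<Suc N}" for x
        using that nonneg[of "real x"] by (intro mult_nonneg_nonneg zero_le_power) auto
    qed simp
    also have "\<dots> \<le> (ln (real s) ^ k * real s) * (\<Sum>\<tau><Suc N. ?h \<tau>)"
      by (rule condensation_block[OF s nonneg dec])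
    also have "\<dots> \<le> (ln (real s) ^ k * real s) * suminf ?h"
      using s sum_le_suminf[OF sh, of "{..<Suc N}"] hn by (intro mult_left_mono) auto
    finally show "(\<Sum>m<N. ln (real (Suc m)) ^ k * \<psi> (real (Suc m))) \<le> (ln (real s) ^ k * real s) * suminf ?h" .
  qed
  with div show False by blast
qed

text \<open>A zero of \<open>\<psi>\<close> would persist by monotonicity and leave finitely many
  nonzero terms. Positivity later supplies the slack that makes \<open>good\<close> an open
  condition.\<close>

lemma psi_pos:
  fixes \<psi> :: "real \<Rightarrow> real"
  assumes nonneg: "\<And>x. x > 0 \<Longrightarrow> \<psi> x \<ge> 0" and dec: "antimono_on {0<..} \<psi>"
    and div: "\<not> summable (\<lambda>m::nat. ln (real (Suc m)) ^ k * \<psi> (real (Suc m)))" and x: "x > 0"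
  shows "\<psi> x > 0"
proof (rule ccontr)
  assume "\<not> \<psi> x > 0"
  then have x0: "\<psi> x \<le> 0" by simp
  have "eventually (\<lambda>m::nat. ln (real (Suc m)) ^ k * \<psi> (real (Suc m)) = 0) sequentially"
    unfolding eventually_sequentially
  proof (intro exI allI impI)
    fix m assume "nat \<lceil>x\<rceil> \<le> m"
    then have "x \<le> real (Suc m)" by linarith
    then have "\<psi> (real (Suc m)) \<le> \<psi> x" using dec x by (auto simp: monotone_on_def)
    then have "\<psi> (real (Suc m)) = 0" using x0 nonneg[of "real (Suc m)"] by simp
    then show "ln (real (Suc m)) ^ k * \<psi> (real (Suc m)) = 0" by simp
  qed
  then have "summable (\<lambda>m::nat. ln (real (Suc m)) ^ k * \<psi> (real (Suc m))) \<longleftrightarrow> summable (\<lambda>_::nat. 0 :: real)"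
    by (rule summable_cong)
  with div show False by simp
qed

section \<open>Approximable vectors and unipotent orbits\<close>

definition good :: "(real \<Rightarrow> real) \<Rightarrow> real \<Rightarrow> 'a::{field,finite} fls ^ 'n \<Rightarrow> bool" where
  "good \<psi> T v \<longleftrightarrow> prod_k v \<le> norm_k v * \<psi> (norm_k v) \<and> T \<le> norm_k v"

text \<open>Coordinate \<open>r\<close> is at most 1 and all others are at least 1, so the norm is
  the largest of the others and only the product feels the small coordinate.\<close>

lemma good_witness:
  fixes v :: "'a::{field,finite} fls ^ 'n"
  defines "s \<equiv> real CARD('a)"
  assumes n: "CARD('n) \<ge> 2" and r: "vge (int m) (v $ r)" and t: "\<And>i. i \<noteq> r \<Longrightarrow> veq (- int (t i)) (v $ i)"
    and small: "(1/s) ^ m * s ^ (\<Sum>i\<in>UNIV - {r}. t i) \<le> s ^ Max (t ` (UNIV - {r})) * \<psi> (s ^ Max (t ` (UNIV - {r})))"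
    and T: "T \<le> s ^ Max (t ` (UNIV - {r}))"
  shows "good \<psi> T v"
proof -
  have s2: "s \<ge> 2" using card_field_ge_2[where 'a='a] by (simp add: s_def)
  let ?J = "UNIV - {r}" and ?\<tau> = "Max (t ` (UNIV - {r}))"
  have "card ?J = CARD('n) - 1" by (simp add: card_Diff_singleton)
  then have Jne: "?J \<noteq> {}" using n by (metis card.empty diff_is_0_eq not_less_eq_eq numeral_2_eq_2 One_nat_def)
  have abs_i: "abs_k (v $ i) = s ^ t i" if "i \<noteq> r" for i
    using abs_k_veq[OF t[OF that]] by (simp add: s_def power_int_def)
  have abs_r: "abs_k (v $ r) \<le> (1/s) ^ m"
    using abs_k_vge[OF r] by (simp add: s_def power_int_minus power_divide inverse_eq_divide)
  have m1: "(1/s) ^ m \<le> 1" using s2 by (intro power_le_one) auto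
  have norm: "norm_k v = s ^ ?\<tau>"
    unfolding norm_k_def
  proof (rule Max_eqI)
    show "y \<le> s ^ ?\<tau>" if "y \<in> range (\<lambda>i. abs_k (v $ i))" for y
    proof -
      obtain i where i: "y = abs_k (v $ i)" using \<open>y \<in> _\<close> by blast
      show ?thesis
      proof (cases "i = r")
        case True
        have "1 \<le> s ^ ?\<tau>" using s2 by simp
        then show ?thesis using True i abs_r m1 by simp
      next
        case False
        then have "t i \<le> ?\<tau>" by (intro Max_ge) auto
        then show ?thesis using abs_i[OF False] i s2 by (simp add: power_increasing)
      qed
    qed
    have "?\<tau> \<in> t ` ?J" by (rule Max_in) (use Jne in auto)
    then obtain i where "i \<noteq> r" "?\<tau> = t i" by auto
    then show "s ^ ?\<tau> \<in> range (\<lambda>i. abs_k (v $ i))" using abs_i by (metis rangeI)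
  qed simp
  have "prod_k v = abs_k (v $ r) * (\<Prod>i\<in>?J. abs_k (v $ i))"
    unfolding prod_k_def by (subst prod.remove[of UNIV r]) auto
  also have "(\<Prod>i\<in>?J. abs_k (v $ i)) = (\<Prod>i\<in>?J. s ^ t i)"
    by (rule prod.cong) (use abs_i in auto)
  also have "\<dots> = s ^ (\<Sum>i\<in>?J. t i)" by (rule power_sum[symmetric])
  also have "abs_k (v $ r) * s ^ (\<Sum>i\<in>?J. t i) \<le> (1/s) ^ m * s ^ (\<Sum>i\<in>?J. t i)"
    using abs_r s2 by (intro mult_right_mono) auto
  finally show ?thesis unfolding good_def norm using small T by simp
qed

section \<open>Unipotent translates of a bounded matrix\<close>

definition mvge :: "int \<Rightarrow> 'a::zero fls ^ 'm ^ 'n \<Rightarrow> bool" where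
  "mvge b A \<longleftrightarrow> (\<forall>i j. vge b (A $ i $ j))"

definition unip :: "'n::finite \<Rightarrow> ('n \<Rightarrow> 'a::comm_ring_1 fls) \<Rightarrow> 'a fls ^ 'n ^ 'n" where
  "unip c y = (\<chi> i k. if i = k then 1 else if i = c then y k else 0)"

lemma unip_mult_vec:
  "(unip c y *v q) $ i = q $ i + (if i = c then (\<Sum>l\<in>UNIV - {c}. y l * q $ l) else 0)"
proof (cases "i = c")
  case True
  have "(\<Sum>l\<in>UNIV. unip c y $ i $ l * q $ l) = unip c y $ i $ c * q $ c + (\<Sum>l\<in>UNIV - {c}. unip c y $ i $ l * q $ l)"
    by (rule sum.remove) auto
  also have "(\<Sum>l\<in>UNIV - {c}. unip c y $ i $ l * q $ l) = (\<Sum>l\<in>UNIV - {c}. y l * q $ l)"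
    by (rule sum.cong) (use True in \<open>auto simp: unip_def\<close>)
  finally show ?thesis using True by (simp add: matrix_vector_mult_def unip_def)
next
  case False
  have "(\<Sum>l\<in>UNIV. unip c y $ i $ l * q $ l) = (\<Sum>l\<in>UNIV. if l = i then q $ l else 0)"
    by (rule sum.cong) (use False in \<open>auto simp: unip_def\<close>)
  then show ?thesis using False by (simp add: matrix_vector_mult_def)
qed

text \<open>Take the largest entry of column \<open>c\<close>; invertibility excludes a zero column.
  Since all ratios to this pivot are at most 1, eliminating the column does not enlarge the
  matrix.\<close>

lemma exists_pivot:
  fixes G :: "'a::{field,finite} fls ^ 'n ^ 'n"
  assumes "Ginv ** G = mat 1"
  shows "\<exists>r. G $ r $ c \<noteq> 0 \<and> (\<forall>i. vge 0 (G $ i $ c / G $ r $ c))"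
proof -
  let ?I = "{i. G $ i $ c \<noteq> 0}"
  have "?I \<noteq> {}"
  proof
    assume "?I = {}"
    then have "(Ginv ** G) $ c $ c = 0" by (simp add: matrix_matrix_mult_def)
    then show False using assms by (simp add: mat_def)
  qed
  then have "Min ((\<lambda>i. fls_subdegree (G $ i $ c)) ` ?I) \<in> (\<lambda>i. fls_subdegree (G $ i $ c)) ` ?I"
    by (intro Min_in) auto
  then obtain r where r0: "r \<in> ?I" "fls_subdegree (G $ r $ c) = Min ((\<lambda>i. fls_subdegree (G $ i $ c)) ` ?I)"
    by auto
  have r: "G $ r $ c \<noteq> 0" "\<And>i. G $ i $ c \<noteq> 0 \<Longrightarrow> fls_subdegree (G $ r $ c) \<le> fls_subdegree (G $ i $ c)"
    using r0(1) unfolding r0(2) by (auto intro!: Min_le)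
  have "vge 0 (G $ i $ c / G $ r $ c)" for i
  proof (cases "G $ i $ c = 0")
    case False
    then show ?thesis
      using vge_divide[of "fls_subdegree (G $ r $ c)" "G $ i $ c" "fls_subdegree (G $ r $ c)" "G $ r $ c"] r
      by (simp add: vge_iff veq_iff)
  qed simp
  with r show ?thesis by blast
qed

text \<open>
  The lattice of \<open>A\<close> contains a vector all of whose small perturbations are good; unlike \<open>good\<close> itself,
  this survives replacing \<open>A\<close> by a nearby matrix.
\<close>

definition robust :: "nat \<Rightarrow> (real \<Rightarrow> real) \<Rightarrow> real \<Rightarrow> 'a::{field,finite} fls ^ 'n ^ 'n \<Rightarrow> bool" where
  "robust S \<psi> T A \<longleftrightarrow> (\<exists>q. (\<forall>i. q $ i \<in> Zint) \<and> (\<forall>i. vge (- int S) ((A *v q) $ i)) \<and>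
     (\<forall>v. (\<forall>i. vge (int S + 1) (v $ i - (A *v q) $ i)) \<longrightarrow> good \<psi> T v))"

text \<open>Block inversion: eliminating column \<open>c\<close> with row \<open>r\<close> leaves
  the Schur complement of the pivot, and its inverse is the matching block of \<open>Ginv\<close>.
  \<open>\<sigma>\<close> labels the rows other than \<open>r\<close> by the columns other than
  \<open>c\<close>; the powers of X cancel.\<close>

lemma pivot_inv_pair:
  fixes G Ginv :: "'a::{field,finite} fls ^ 'n ^ 'n" and c r :: 'n
  defines "J \<equiv> UNIV - {c}" and "\<sigma> \<equiv> \<lambda>i. if i = r then c else i" and "\<gamma> \<equiv> \<lambda>i. G $ i $ c / G $ r $ c"
  assumes G: "mvge (- int C) G" "mvge (- int C) Ginv" and inv: "G ** Ginv = mat 1" "Ginv ** G = mat 1"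
    and r: "G $ r $ c \<noteq> 0" "\<And>i. vge 0 (\<gamma> i)"
  shows "inv_pair (C + j) J (\<lambda>i l. Xpow (int j) * (G $ \<sigma> i $ l - \<gamma> (\<sigma> i) * G $ r $ l)) (\<lambda>l i. Xpow (- int j) * Ginv $ l $ \<sigma> i)"
proof -
  have GG: "(\<Sum>l\<in>UNIV. G $ i $ l * Ginv $ l $ k) = of_bool (i = k)" for i k
    using arg_cong[OF inv(1), of "\<lambda>A. A $ i $ k"] by (simp add: matrix_matrix_mult_def mat_def)
  have GG': "(\<Sum>l\<in>UNIV. Ginv $ i $ l * G $ l $ k) = of_bool (i = k)" for i k
    using arg_cong[OF inv(2), of "\<lambda>A. A $ i $ k"] by (simp add: matrix_matrix_mult_def mat_def)
  have XX: "Xpow (int j) * Xpow (- int j) = (1 :: 'a fls)" by (simp add: Xpow_mult)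
  have \<gamma>r: "\<gamma> r = 1" using r by (simp add: \<gamma>_def)
  have \<gamma>c: "G $ i $ c - \<gamma> i * G $ r $ c = 0" for i using r by (simp add: \<gamma>_def)
  have \<sigma>: "\<sigma> i \<noteq> r" if "i \<in> J" for i using that by (auto simp: \<sigma>_def J_def)
  have \<sigma>inj: "\<sigma> i = \<sigma> k \<longleftrightarrow> i = k" if "i \<in> J" "k \<in> J" for i k using that by (auto simp: \<sigma>_def J_def)
  have bij: "bij_betw \<sigma> J (UNIV - {r})"
    by (rule bij_betwI[where g = "\<lambda>k. if k = c then r else k"]) (auto simp: \<sigma>_def J_def)
  show ?thesis
    unfolding inv_pair_def
  proof (intro conjI ballI)
    fix i l assume il: "i \<in> J" "l \<in> J"
    have "vge (- int C) (G $ \<sigma> i $ l - \<gamma> (\<sigma> i) * G $ r $ l)"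
      by (intro vge_diff vge_mult'[OF r(2)]) (use G in \<open>auto simp: mvge_def\<close>)
    then show "vge (- int (C + j)) (Xpow (int j) * (G $ \<sigma> i $ l - \<gamma> (\<sigma> i) * G $ r $ l))"
      by (rule vge_mult'[OF veq_vge[OF veq_Xpow]]) simp
    show "vge (- int (C + j)) (Xpow (- int j) * Ginv $ i $ \<sigma> l)"
      by (rule vge_mult'[OF veq_vge[OF veq_Xpow], of "- int C"]) (use G in \<open>auto simp: mvge_def\<close>)
  next
    fix i k assume ik: "i \<in> J" "k \<in> J"
    have "(\<Sum>l\<in>J. Xpow (int j) * (G $ \<sigma> i $ l - \<gamma> (\<sigma> i) * G $ r $ l) * (Xpow (- int j) * Ginv $ l $ \<sigma> k)) =
       (\<Sum>l\<in>J. (G $ \<sigma> i $ l - \<gamma> (\<sigma> i) * G $ r $ l) * Ginv $ l $ \<sigma> k)"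
    proof (rule sum.cong[OF refl])
      fix l
      have "Xpow (int j) * (G $ \<sigma> i $ l - \<gamma> (\<sigma> i) * G $ r $ l) * (Xpow (- int j) * Ginv $ l $ \<sigma> k) =
        (Xpow (int j) * Xpow (- int j)) * ((G $ \<sigma> i $ l - \<gamma> (\<sigma> i) * G $ r $ l) * Ginv $ l $ \<sigma> k)" by (simp only: mult_ac)
      then show "Xpow (int j) * (G $ \<sigma> i $ l - \<gamma> (\<sigma> i) * G $ r $ l) * (Xpow (- int j) * Ginv $ l $ \<sigma> k) =
        (G $ \<sigma> i $ l - \<gamma> (\<sigma> i) * G $ r $ l) * Ginv $ l $ \<sigma> k" unfolding XX by simp
    qed
    also have "\<dots> = (\<Sum>l\<in>UNIV. (G $ \<sigma> i $ l - \<gamma> (\<sigma> i) * G $ r $ l) * Ginv $ l $ \<sigma> k)"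
      unfolding J_def by (subst (2) sum.remove[of _ c]) (auto simp: \<gamma>c)
    also have "\<dots> = (\<Sum>l\<in>UNIV. G $ \<sigma> i $ l * Ginv $ l $ \<sigma> k) - \<gamma> (\<sigma> i) * (\<Sum>l\<in>UNIV. G $ r $ l * Ginv $ l $ \<sigma> k)"
      by (simp add: left_diff_distrib sum_subtractf sum_distrib_left mult.assoc)
    also have "\<dots> = of_bool (i = k)" unfolding GG using \<sigma>[OF ik(2)] \<sigma>inj[OF ik] by simp
    finally show "(\<Sum>l\<in>J. Xpow (int j) * (G $ \<sigma> i $ l - \<gamma> (\<sigma> i) * G $ r $ l) * (Xpow (- int j) * Ginv $ l $ \<sigma> k)) = of_bool (i = k)" .
    have "(\<Sum>l\<in>J. Xpow (- int j) * Ginv $ i $ \<sigma> l * (Xpow (int j) * (G $ \<sigma> l $ k - \<gamma> (\<sigma> l) * G $ r $ k))) =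
       (\<Sum>l\<in>J. Ginv $ i $ \<sigma> l * (G $ \<sigma> l $ k - \<gamma> (\<sigma> l) * G $ r $ k))"
    proof (rule sum.cong[OF refl])
      fix l
      have "Xpow (- int j) * Ginv $ i $ \<sigma> l * (Xpow (int j) * (G $ \<sigma> l $ k - \<gamma> (\<sigma> l) * G $ r $ k)) =
        (Xpow (int j) * Xpow (- int j)) * (Ginv $ i $ \<sigma> l * (G $ \<sigma> l $ k - \<gamma> (\<sigma> l) * G $ r $ k))" by (simp only: mult_ac)
      then show "Xpow (- int j) * Ginv $ i $ \<sigma> l * (Xpow (int j) * (G $ \<sigma> l $ k - \<gamma> (\<sigma> l) * G $ r $ k)) =
        Ginv $ i $ \<sigma> l * (G $ \<sigma> l $ k - \<gamma> (\<sigma> l) * G $ r $ k)" unfolding XX by simp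
    qed
    also have "\<dots> = (\<Sum>m\<in>UNIV - {r}. Ginv $ i $ m * (G $ m $ k - \<gamma> m * G $ r $ k))"
      by (rule sum.reindex_bij_betw[OF bij, where g = "\<lambda>m. Ginv $ i $ m * (G $ m $ k - \<gamma> m * G $ r $ k)"])
    also have "\<dots> = (\<Sum>m\<in>UNIV. Ginv $ i $ m * (G $ m $ k - \<gamma> m * G $ r $ k))"
      by (subst (2) sum.remove[of _ r]) (auto simp: \<gamma>r)
    also have "\<dots> = (\<Sum>m\<in>UNIV. Ginv $ i $ m * G $ m $ k) - (\<Sum>m\<in>UNIV. Ginv $ i $ m * G $ m $ c) * (G $ r $ k / G $ r $ c)"
      unfolding \<gamma>_def by (simp add: right_diff_distrib sum_subtractf sum_distrib_right sum_divide_distrib mult.assoc)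
    also have "\<dots> = of_bool (i = k)" unfolding GG' using ik by (simp add: J_def)
    finally show "(\<Sum>l\<in>J. Xpow (- int j) * Ginv $ i $ \<sigma> l * (Xpow (int j) * (G $ \<sigma> l $ k - \<gamma> (\<sigma> l) * G $ r $ k))) = of_bool (i = k)" .
  qed
qed

text \<open>Apply the matrix to Q with entry p' at \<open>c\<close> and entries X^j q elsewhere.
  Coordinate \<open>r\<close> becomes the pivot times p' + (z + \<beta>) . q, and each other
  coordinate is an integral multiple of it plus a coordinate of \<open>D q\<close>. X^j undoes the
  factor X^(-j) that keeps the unipotent matrix near the identity, and \<open>\<beta>\<close> is the
  contribution of row \<open>r\<close> of \<open>G\<close>.\<close>

lemma hit_robust:
  fixes G Ginv :: "'a::{field,finite} fls ^ 'n ^ 'n" and c r :: 'n and j :: nat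
  defines "s \<equiv> real CARD('a)"
  defines "J \<equiv> UNIV - {c}" and "\<sigma> \<equiv> \<lambda>i. if i = r then c else i" and "\<gamma> \<equiv> \<lambda>i. G $ i $ c / G $ r $ c"
  defines "D \<equiv> \<lambda>i l. Xpow (int j) * (G $ \<sigma> i $ l - \<gamma> (\<sigma> i) * G $ r $ l)"
  defines "\<beta> \<equiv> \<lambda>l. Xpow (int j) * G $ r $ l / G $ r $ c"
  assumes n: "CARD('n) \<ge> 2" and G: "mvge (- int C) G" "mvge (- int C) Ginv" and inv: "G ** Ginv = mat 1" "Ginv ** G = mat 1"
    and r: "G $ r $ c \<noteq> 0" "\<And>i. vge 0 (\<gamma> i)"
    and N: "2 * S + (C + j) \<le> N"
    and a: "\<And>\<tau>. a \<tau> \<le> 1" "\<And>\<tau>. a \<tau> \<le> s ^ \<tau> * \<psi> (s ^ \<tau>)"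
    and T: "T \<le> s ^ T0"
    and hit: "hit S (C + j) T0 a J D (\<lambda>l\<in>J. z l + cut 1 (int N) (\<beta> l))"
  shows "robust S \<psi> T (G ** unip c (\<lambda>l. Xpow (- int j) * z l))"
proof -
  have s2: "s \<ge> 2" using card_field_ge_2[where 'a='a] by (simp add: s_def)
  let ?e = "C + j"
  have J: "finite J" by simp
  have ip: "inv_pair ?e J D (\<lambda>l i. Xpow (- int j) * Ginv $ l $ \<sigma> i)"
    unfolding D_def J_def \<sigma>_def \<gamma>_def by (rule pivot_inv_pair[OF G inv]) (use r in \<open>auto simp: \<gamma>_def\<close>)
  obtain q p m t where q: "q \<in> J \<rightarrow>\<^sub>E Zint" and p: "p \<in> Zint" and m: "m \<le> S"
    and t: "\<And>i. i \<in> J \<Longrightarrow> t i \<le> S" "\<And>i. i \<in> J \<Longrightarrow> veq (- int (t i)) (dot J (D i) q)"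
    and v: "vge (int m) (p + dot J (\<lambda>l\<in>J. z l + cut 1 (int N) (\<beta> l)) q)" and T0: "T0 \<le> Max (t ` J)"
    and le: "(1/s) ^ m * s ^ (\<Sum>i\<in>J. t i) \<le> (1/s) ^ (?e + 1) * a (Max (t ` J))"
    using hit unfolding hit_def s_def by blast
  have qv: "vge (- int S - int ?e) (q l)" if "l \<in> J" for l
  proof (rule inv_pair_vge_arg[OF ip J _ that])
    fix i assume i: "i \<in> J"
    show "vge (- int S) (dot J (D i) q)"
      by (rule vge_mono[OF veq_vge[OF t(2)[OF i]]]) (use t(1)[OF i] in simp)
  qed
  \<comment> \<open>The hit involves only the first \<open>N\<close> digits of
    \<open>\<beta>\<close>: the polynomial part goes into \<open>p'\<close>, and the tail is too
    small to matter.\<close>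
  define p' where "p' = p - (\<Sum>l\<in>J. ipart (\<beta> l) * q l)"
  have p'Z: "p' \<in> Zint" unfolding p'_def using q by (intro Zint_diff p Zint_sum Zint_mult ipart_Zint) auto
  define x where "x = p' + (\<Sum>l\<in>J. (z l + \<beta> l) * q l)"
  have xv: "vge (int m) x"
  proof -
    define \<rho> where "\<rho> l = \<beta> l - ipart (\<beta> l) - cut 1 (int N) (\<beta> l)" for l
    have "vge (int m) (\<Sum>l\<in>J. \<rho> l * q l)"
    proof (rule vge_sum)
      fix l assume l: "l \<in> J"
      have "vge (int N + 1) (\<rho> l)" unfolding \<rho>_def by (auto simp: vge_def ipart_nth)
      then show "vge (int m) (\<rho> l * q l)" by (rule vge_mult'[OF _ qv[OF l]]) (use m N in simp)
    qed
    moreover have "x = (p + dot J (\<lambda>l\<in>J. z l + cut 1 (int N) (\<beta> l)) q) + (\<Sum>l\<in>J. \<rho> l * q l)"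
    proof -
      have "(\<Sum>l\<in>J. (z l + \<beta> l) * q l) = (\<Sum>l\<in>J. (z l + cut 1 (int N) (\<beta> l)) * q l + \<rho> l * q l + ipart (\<beta> l) * q l)"
        by (rule sum.cong) (auto simp: \<rho>_def algebra_simps)
      also have "\<dots> = dot J (\<lambda>l\<in>J. z l + cut 1 (int N) (\<beta> l)) q + (\<Sum>l\<in>J. \<rho> l * q l) + (\<Sum>l\<in>J. ipart (\<beta> l) * q l)"
        by (simp add: sum.distrib dot_def)
      finally show ?thesis unfolding x_def p'_def by simp
    qed
    ultimately show ?thesis using vge_add[OF v] by simp
  qed
  define Q where "Q = (\<chi> i. if i = c then p' else Xpow (int j) * q i)"
  have QZ: "Q $ i \<in> Zint" for i
    using p'Z q Xpow_Zint[of "int j"] by (auto simp: Q_def J_def intro!: Zint_mult)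
  define A where "A = G ** unip c (\<lambda>l. Xpow (- int j) * z l)"
  have XX: "Xpow (- int j) * Xpow (int j) = (1 :: 'a fls)" by (simp add: Xpow_mult)
  have AQ: "(A *v Q) $ i = G $ i $ c * (p' + (\<Sum>l\<in>J. z l * q l)) + (\<Sum>l\<in>J. G $ i $ l * (Xpow (int j) * q l))" for i
  proof -
    have u: "(unip c (\<lambda>l. Xpow (- int j) * z l) *v Q) $ k = (if k = c then p' + (\<Sum>l\<in>J. z l * q l) else Xpow (int j) * q k)" for k
    proof -
      have "(\<Sum>l\<in>UNIV - {c}. Xpow (- int j) * z l * Q $ l) = (\<Sum>l\<in>J. z l * q l)"
        unfolding J_def
      proof (rule sum.cong[OF refl])
        fix l assume "l \<in> UNIV - {c}"
        then have "Xpow (- int j) * z l * Q $ l = (Xpow (- int j) * Xpow (int j)) * (z l * q l)" by (simp add: Q_def mult_ac)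
        then show "Xpow (- int j) * z l * Q $ l = z l * q l" unfolding XX by simp
      qed
      then show ?thesis unfolding unip_mult_vec by (simp add: Q_def)
    qed
    have "(A *v Q) $ i = (\<Sum>k\<in>UNIV. G $ i $ k * (unip c (\<lambda>l. Xpow (- int j) * z l) *v Q) $ k)"
      unfolding A_def matrix_vector_mul_assoc[symmetric] by (simp add: matrix_vector_mult_def)
    also have "\<dots> = G $ i $ c * (p' + (\<Sum>l\<in>J. z l * q l)) + (\<Sum>l\<in>J. G $ i $ l * (Xpow (int j) * q l))"
      unfolding u J_def by (subst sum.remove[of _ c]) (auto intro!: sum.cong)
    finally show ?thesis .
  qed
  have vr: "(A *v Q) $ r = G $ r $ c * x"
  proof -
    have "G $ r $ c * (\<Sum>l\<in>J. \<beta> l * q l) = (\<Sum>l\<in>J. G $ r $ l * (Xpow (int j) * q l))"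
      unfolding sum_distrib_left by (rule sum.cong) (use r in \<open>auto simp: \<beta>_def\<close>)
    then show ?thesis unfolding AQ x_def by (simp add: sum.distrib distrib_right distrib_left)
  qed
  have vi: "(A *v Q) $ \<sigma> i = \<gamma> (\<sigma> i) * (A *v Q) $ r + dot J (D i) q" for i
  proof -
    have g: "\<gamma> (\<sigma> i) * G $ r $ c = G $ \<sigma> i $ c" using r by (simp add: \<gamma>_def)
    have "dot J (D i) q = (\<Sum>l\<in>J. G $ \<sigma> i $ l * (Xpow (int j) * q l)) - \<gamma> (\<sigma> i) * (\<Sum>l\<in>J. G $ r $ l * (Xpow (int j) * q l))"
      unfolding dot_def D_def sum_distrib_left sum_subtractf[symmetric] by (rule sum.cong) (auto simp: algebra_simps)
    then show ?thesis unfolding AQ by (simp add: distrib_left mult.assoc[symmetric] g)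
  qed
  \<comment> \<open>As \<open>a\<close> is at most 1, the factor in \<open>hit\<close> forces m >= C
    + j + 1. So coordinate \<open>r\<close> stays below 1 even after multiplication by the pivot and
    cannot disturb the shell exponents.\<close>
  have m_e: "?e + 1 \<le> m"
  proof -
    have "(1/s) ^ m * 1 \<le> (1/s) ^ m * s ^ (\<Sum>i\<in>J. t i)" using s2 by (intro mult_left_mono one_le_power) auto
    also have "\<dots> \<le> (1/s) ^ (?e + 1) * 1" using le a(1)[of "Max (t ` J)"] s2
      by (meson mult_left_mono order_trans zero_le_power divide_nonneg_nonneg zero_le_one zero_le_numeral)
    finally have "(1/s) ^ m \<le> (1/s) ^ (?e + 1)" by simp
    moreover have "0 < 1/s" "1/s < 1" using s2 by auto
    ultimately show ?thesis by (simp only: power_decreasing_iff)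
  qed
  have vrv: "vge (int (m - C)) ((A *v Q) $ r)"
    unfolding vr by (rule vge_mult'[OF _ xv, of "- int C"]) (use G m_e in \<open>auto simp: mvge_def of_nat_diff\<close>)
  have viv: "veq (- int (t i)) ((A *v Q) $ \<sigma> i)" if i: "i \<in> J" for i
  proof -
    have "vge 1 (\<gamma> (\<sigma> i) * (A *v Q) $ r)"
      by (rule vge_mult'[OF r(2) vrv]) (use m_e in simp)
    then have "veq (- int (t i)) (dot J (D i) q + \<gamma> (\<sigma> i) * (A *v Q) $ r)" by (rule veq_add[OF t(2)[OF i]]) simp
    then show ?thesis unfolding vi[of i] by (simp only: add.commute)
  qed
  have bij: "bij_betw \<sigma> J (UNIV - {r})"
    by (rule bij_betwI[where g = "\<lambda>k. if k = c then r else k"]) (auto simp: \<sigma>_def J_def)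
  define t' where "t' k = t (if k = c then r else k)" for k
  have t'\<sigma>: "t' (\<sigma> i) = t i" if "i \<in> J" for i using that by (auto simp: t'_def \<sigma>_def J_def)
  have mem: "\<exists>i. i \<in> J \<and> k = \<sigma> i" if "k \<noteq> r" for k
    by (rule exI[of _ "if k = c then r else k"]) (use that in \<open>auto simp: \<sigma>_def J_def\<close>)
  have sum_t': "(\<Sum>k\<in>UNIV - {r}. t' k) = (\<Sum>i\<in>J. t i)"
    using sum.reindex_bij_betw[OF bij, of t'] t'\<sigma> by simp
  have img_t': "t' ` (UNIV - {r}) = t ` J"
    using bij t'\<sigma> unfolding bij_betw_def by (metis (no_types, lifting) image_cong image_image)
  let ?\<tau> = "Max (t ` J)"
  have fin: "good \<psi> T v" if v: "\<And>i. vge (int S + 1) (v $ i - (A *v Q) $ i)" for v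
  proof (rule good_witness[where m = "m - C" and r = r and t = t'])
    have e: "v $ i = (A *v Q) $ i + (v $ i - (A *v Q) $ i)" for i by simp
    show "vge (int (m - C)) (v $ r)"
      by (subst e, rule vge_add[OF vrv vge_mono[OF v]]) (use m in simp)
    show "veq (- int (t' k)) (v $ k)" if kr: "k \<noteq> r" for k
    proof -
      obtain i where i: "i \<in> J" "k = \<sigma> i" using mem[OF kr] by blast
      show ?thesis unfolding i(2) t'\<sigma>[OF i(1)]
        by (subst e, rule veq_add[OF viv[OF i(1)] v]) simp
    qed
    \<comment> \<open>The pivot costs s^C, which the factor (1/s)^(C+j+1) repays.\<close>
    have "(1/s) ^ (m - C) * s ^ (\<Sum>i\<in>J. t i) = s ^ C * ((1/s) ^ m * s ^ (\<Sum>i\<in>J. t i))"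
    proof -
      have "m = C + (m - C)" using m_e by simp
      then have "(1/s) ^ m = (1/s) ^ C * (1/s) ^ (m - C)" by (metis power_add)
      moreover have "s ^ C * (1/s) ^ C = 1" using s2 by (simp add: power_mult_distrib[symmetric])
      ultimately show ?thesis by (simp add: mult.assoc[symmetric])
    qed
    also have "\<dots> \<le> s ^ C * ((1/s) ^ (?e + 1) * a ?\<tau>)" using le s2 by (intro mult_left_mono) auto
    also have "\<dots> = (1/s) ^ (j + 1) * a ?\<tau>"
    proof -
      have e1: "(1/s) ^ (?e + 1) = (1/s) ^ C * (1/s) ^ (j + 1)" by (simp only: power_add mult.assoc)
      have e2: "s ^ C * (1/s) ^ C = 1" using s2 by (simp add: power_mult_distrib[symmetric])
      have "s ^ C * ((1/s) ^ (?e + 1) * a ?\<tau>) = (s ^ C * (1/s) ^ C) * ((1/s) ^ (j + 1) * a ?\<tau>)"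
        unfolding e1 by (simp only: mult.assoc)
      then show ?thesis unfolding e2 by (simp only: mult_1)
    qed
    also have "\<dots> \<le> s ^ ?\<tau> * \<psi> (s ^ ?\<tau>)"
    proof (cases "a ?\<tau> \<ge> 0")
      case True
      have "(1/s) ^ (j + 1) \<le> 1" using s2 by (intro power_le_one) auto
      then have "(1/s) ^ (j + 1) * a ?\<tau> \<le> 1 * a ?\<tau>" using True by (intro mult_right_mono) auto
      then show ?thesis using a(2)[of ?\<tau>] by simp
    next
      case False
      have "0 \<le> (1/s) ^ m * s ^ (\<Sum>i\<in>J. t i)" using s2 by simp
      moreover have "(1/s) ^ (?e + 1) * a ?\<tau> < 0" using False s2 by (intro mult_pos_neg) auto
      ultimately show ?thesis using le by linarith
    qed
    finally show "(1 / real CARD('a)) ^ (m - C) * real CARD('a) ^ (\<Sum>i\<in>UNIV - {r}. t' i)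
       \<le> real CARD('a) ^ Max (t' ` (UNIV - {r})) * \<psi> (real CARD('a) ^ Max (t' ` (UNIV - {r})))"
      unfolding sum_t' img_t' s_def .
    have "s ^ T0 \<le> s ^ ?\<tau>" using T0 s2 by (intro power_increasing) auto
    then show "T \<le> real CARD('a) ^ Max (t' ` (UNIV - {r}))" unfolding img_t' using T by (simp add: s_def)
  qed (rule n)
  have bound: "vge (- int S) ((A *v Q) $ k)" for k
  proof (cases "k = r")
    case True
    then show ?thesis using vge_mono[OF vrv] by simp
  next
    case False
    then obtain i where i: "i \<in> J" "k = \<sigma> i" using mem by blast
    show ?thesis unfolding i(2) by (rule vge_mono[OF veq_vge[OF viv[OF i(1)]]]) (use t(1)[OF i(1)] in simp)
  qed
  show ?thesis
    unfolding robust_def A_def[symmetric] using QZ bound fin by blast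
qed

text \<open>\<open>G\<close> enters only through the bound \<open>C\<close>, hence the uniformity.
  The shift by the digits of \<open>\<beta>\<close> permutes the sample space, so counting the
  \<open>z\<close> without a robust vector reduces to counting those without a hit.\<close>

lemma unipotent_average:
  fixes \<psi> :: "real \<Rightarrow> real" and c :: "'n::finite"
  assumes n: "CARD('n) \<ge> 2"
    and nonneg: "\<And>x. x > 0 \<Longrightarrow> \<psi> x \<ge> 0" and noninc: "antimono_on {0<..} \<psi>"
    and div: "\<not> summable (\<lambda>m::nat. ln (real (Suc m)) ^ (CARD('n) - 2) * \<psi> (real (Suc m)))"
    and \<epsilon>: "\<epsilon> > 0"
  shows "\<exists>N S. \<forall>G Ginv :: 'a::{field,finite} fls ^ 'n ^ 'n. mvge (- int C) G \<longrightarrow> mvge (- int C) Ginv \<longrightarrow>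
    G ** Ginv = mat 1 \<longrightarrow> Ginv ** G = mat 1 \<longrightarrow>
    real (card {z \<in> (UNIV - {c}) \<rightarrow>\<^sub>E (seg 1 (int N) :: 'a fls set). \<not> robust S \<psi> T (G ** unip c (\<lambda>l. Xpow (- int j) * z l))}) \<le>
      \<epsilon> * real (card ((UNIV - {c}) \<rightarrow>\<^sub>E (seg 1 (int N) :: 'a fls set)))"
proof -
  define s where "s = real CARD('a)"
  have s2: "s \<ge> 2" using card_field_ge_2[where 'a='a] by (simp add: s_def)
  define a where "a \<tau> = min 1 (s ^ \<tau> * \<psi> (s ^ \<tau>))" for \<tau> :: nat
  define J where "J = UNIV - {c}"
  have "card J = CARD('n) - 1" by (simp add: J_def card_Diff_singleton)
  then have cJ: "card J - 1 = CARD('n) - 2" and "card J > 0" using n by auto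
  then have J: "finite J" "J \<noteq> {}" by (auto simp: card_gt_0_iff)
  have \<psi>pos: "\<psi> x > 0" if "x > 0" for x using psi_pos[OF nonneg noninc div that] .
  have a: "0 < a \<tau>" "a \<tau> \<le> 1" "a \<tau> \<le> s ^ \<tau> * \<psi> (s ^ \<tau>)" for \<tau>
    using s2 \<psi>pos[of "s ^ \<tau>"] by (auto simp: a_def)
  have dec: "(1/s) ^ \<tau>' * a \<tau>' \<le> (1/s) ^ \<tau> * a \<tau>" if "\<tau> \<le> \<tau>'" for \<tau> \<tau>'
  proof -
    \<comment> \<open>In this form neither argument of the minimum increases, although
      \<open>a\<close> itself may.\<close>
    have e: "(1/s) ^ \<tau> * a \<tau> = min ((1/s) ^ \<tau>) (\<psi> (s ^ \<tau>))" for \<tau>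
    proof -
      have "(1/s) ^ \<tau> * a \<tau> = min ((1/s) ^ \<tau> * 1) ((1/s) ^ \<tau> * (s ^ \<tau> * \<psi> (s ^ \<tau>)))"
        unfolding a_def using s2 by (simp add: min_mult_distrib_left)
      moreover have "(1/s) ^ \<tau> * s ^ \<tau> = 1" using s2 by (simp add: power_mult_distrib[symmetric])
      ultimately show ?thesis by (simp add: mult.assoc[symmetric])
    qed
    have "s ^ \<tau> \<le> s ^ \<tau>'" using that s2 by (intro power_increasing) auto
    then have "\<psi> (s ^ \<tau>') \<le> \<psi> (s ^ \<tau>)" using noninc s2 by (auto simp: monotone_on_def)
    moreover have "(1/s) ^ \<tau>' \<le> (1/s) ^ \<tau>" using that s2 by (intro power_decreasing) auto
    ultimately show ?thesis unfolding e by linarith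
  qed
  have diva: "\<not> summable (\<lambda>\<tau>. real (\<tau> + 1) ^ (card J - 1) * a \<tau>)"
    unfolding cJ a_def s_def by (rule condensation[OF card_field_ge_2 nonneg noninc div])
  obtain T0 where T0: "T \<le> s ^ T0" using real_arch_pow[of s T] s2 by (auto intro: less_imp_le)
  obtain N S where NS: "2 * S + (C + j) \<le> N"
    "\<And>D D'. inv_pair (C + j) J D D' \<Longrightarrow>
      real (card {z \<in> J \<rightarrow>\<^sub>E (seg 1 (int N) :: 'a fls set). \<not> hit S (C + j) T0 a J D z}) \<le> \<epsilon> * real (card (J \<rightarrow>\<^sub>E (seg 1 (int N) :: 'a fls set)))"
    using no_hit_small[where a = a and e = "C + j" and T = T0, OF J a(1,2) dec[unfolded s_def] diva \<epsilon>] by blast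
  let ?\<Omega> = "J \<rightarrow>\<^sub>E (seg 1 (int N) :: 'a fls set)"
  have fin: "finite ?\<Omega>" by (intro finite_PiE J finite_seg)
  show ?thesis
  proof (intro exI allI impI)
    fix G Ginv :: "'a fls ^ 'n ^ 'n"
    assume G: "mvge (- int C) G" "mvge (- int C) Ginv" and inv: "G ** Ginv = mat 1" "Ginv ** G = mat 1"
    obtain r where r: "G $ r $ c \<noteq> 0" "\<And>i. vge 0 (G $ i $ c / G $ r $ c)" using exists_pivot[OF inv(2)] by blast
    define D where "D = (\<lambda>i l. Xpow (int j) * (G $ (if i = r then c else i) $ l - G $ (if i = r then c else i) $ c / G $ r $ c * G $ r $ l))"
    define w where "w = (\<lambda>l\<in>J. cut 1 (int N) (Xpow (int j) * G $ r $ l / G $ r $ c))"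
    have w: "w \<in> ?\<Omega>" by (auto simp: w_def)
    let ?\<tau> = "\<lambda>z. \<lambda>l\<in>J. z l + w l"
    have bij: "bij_betw ?\<tau> ?\<Omega> ?\<Omega>" by (rule PiE_seg_transl[OF J(1) w])
    have "{z \<in> ?\<Omega>. \<not> robust S \<psi> T (G ** unip c (\<lambda>l. Xpow (- int j) * z l))} \<subseteq> {z \<in> ?\<Omega>. \<not> hit S (C + j) T0 a J D (?\<tau> z)}"
    proof safe
      fix z assume nr: "\<not> robust S \<psi> T (G ** unip c (\<lambda>l. Xpow (- int j) * z l))" and h: "hit S (C + j) T0 a J D (?\<tau> z)"
      have "?\<tau> z = (\<lambda>l\<in>J. z l + cut 1 (int N) (Xpow (int j) * G $ r $ l / G $ r $ c))"
        by (auto simp: w_def fun_eq_iff)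
      then have h': "hit S (C + j) T0 a J D (\<lambda>l\<in>J. z l + cut 1 (int N) (Xpow (int j) * G $ r $ l / G $ r $ c))" using h by simp
      have "robust S \<psi> T (G ** unip c (\<lambda>l. Xpow (- int j) * z l))"
        by (rule hit_robust[OF n G inv r NS(1) a(2) a(3)[unfolded s_def] T0[unfolded s_def] h'[unfolded J_def D_def]])
      with nr show False by blast
    qed
    then have "card {z \<in> ?\<Omega>. \<not> robust S \<psi> T (G ** unip c (\<lambda>l. Xpow (- int j) * z l))} \<le> card {z \<in> ?\<Omega>. \<not> hit S (C + j) T0 a J D (?\<tau> z)}"
      by (rule card_mono[rotated]) (use fin in auto)
    also have "\<dots> = card {z \<in> ?\<Omega>. \<not> hit S (C + j) T0 a J D z}"
    proof (rule bij_betw_same_card[of ?\<tau>], unfold bij_betw_def, intro conjI)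
      show "inj_on ?\<tau> {z \<in> ?\<Omega>. \<not> hit S (C + j) T0 a J D (?\<tau> z)}"
        by (rule inj_on_subset[OF bij_betw_imp_inj_on[OF bij]]) auto
      show "?\<tau> ` {z \<in> ?\<Omega>. \<not> hit S (C + j) T0 a J D (?\<tau> z)} = {z \<in> ?\<Omega>. \<not> hit S (C + j) T0 a J D z}"
      proof (intro set_eqI iffI)
        fix y assume y: "y \<in> {z \<in> ?\<Omega>. \<not> hit S (C + j) T0 a J D z}"
        then have "y \<in> ?\<tau> ` ?\<Omega>" using bij_betw_imp_surj_on[OF bij] by simp
        then obtain z where "z \<in> ?\<Omega>" "y = ?\<tau> z" by blast
        with y show "y \<in> ?\<tau> ` {z \<in> ?\<Omega>. \<not> hit S (C + j) T0 a J D (?\<tau> z)}" by blast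
      next
        fix y assume "y \<in> ?\<tau> ` {z \<in> ?\<Omega>. \<not> hit S (C + j) T0 a J D (?\<tau> z)}"
        then obtain z where "z \<in> ?\<Omega>" "y = ?\<tau> z" "\<not> hit S (C + j) T0 a J D (?\<tau> z)" by blast
        then show "y \<in> {z \<in> ?\<Omega>. \<not> hit S (C + j) T0 a J D z}" using bij_betw_apply[OF bij] by blast
      qed
    qed
    finally have le: "card {z \<in> ?\<Omega>. \<not> robust S \<psi> T (G ** unip c (\<lambda>l. Xpow (- int j) * z l))} \<le> card {z \<in> ?\<Omega>. \<not> hit S (C + j) T0 a J D z}" .
    have "inv_pair (C + j) J D (\<lambda>l i. Xpow (- int j) * Ginv $ l $ (if i = r then c else i))"
      unfolding D_def J_def by (rule pivot_inv_pair[OF G inv r])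
    from NS(2)[OF this] of_nat_mono[OF le, where 'a = real]
    show "real (card {z \<in> (UNIV - {c}) \<rightarrow>\<^sub>E (seg 1 (int N) :: 'a fls set). \<not> robust S \<psi> T (G ** unip c (\<lambda>l. Xpow (- int j) * z l))}) \<le>
      \<epsilon> * real (card ((UNIV - {c}) \<rightarrow>\<^sub>E (seg 1 (int N) :: 'a fls set)))"
      unfolding J_def[symmetric] by linarith
  qed
qed

section \<open>Averages over the maximal compact subgroup\<close>

text \<open>SL_n(O), with O the elements of absolute value at most 1. The integral inverse is what
  cancels a factor modulo X^(-i).\<close>

definition SL_O :: "('a::{field,finite} fls ^ 'n ^ 'n) set" where
  "SL_O = {h. det h = 1 \<and> mvge 0 h \<and> (\<exists>h'. mvge 0 h' \<and> h ** h' = mat 1 \<and> h' ** h = mat 1)}"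

definition bad :: "(real \<Rightarrow> real) \<Rightarrow> real \<Rightarrow> 'a::{field,finite} fls ^ 'n ^ 'n \<Rightarrow> bool" where
  "bad \<psi> T A \<longleftrightarrow> (\<forall>q. (\<forall>i. q $ i \<in> Zint) \<longrightarrow> \<not> good \<psi> T (A *v q))"

text \<open>For integral \<open>h\<close> this encodes the class modulo X^(-i); its finitely many
  values replace integration over the compact group.\<close>

definition trunc_mat :: "nat \<Rightarrow> 'a::zero fls ^ 'n ^ 'n \<Rightarrow> 'n \<times> 'n \<Rightarrow> 'a fls" where
  "trunc_mat i h = (\<lambda>(a, b). cut 0 (int i - 1) (h $ a $ b))"

lemma mvge_mult:
  fixes A :: "'a::idom fls ^ 'n ^ 'm" and B :: "'a fls ^ 'k ^ 'n"
  assumes "mvge a A" "mvge b B" "d \<le> a + b" shows "mvge d (A ** B)"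
  using assms unfolding mvge_def matrix_matrix_mult_def by (auto intro!: vge_sum vge_mult'[of a _ b])

lemma mvge_vec:
  fixes A :: "'a::idom fls ^ 'n ^ 'm"
  assumes "mvge a A" "\<And>i. vge b (x $ i)" "d \<le> a + b" shows "vge d ((A *v x) $ i)"
  using assms unfolding mvge_def matrix_vector_mult_def by (auto intro!: vge_sum vge_mult'[of a _ b])

lemma mvge_add:
  fixes A :: "'a::comm_ring_1 fls ^ 'n ^ 'm"
  shows "mvge a A \<Longrightarrow> mvge a B \<Longrightarrow> mvge a (A + B)"
  unfolding mvge_def by (auto intro: vge_add)

lemma mvge_mat_1: "mvge 0 (mat 1 :: 'a::{zero,one} fls ^ 'n ^ 'n)"
  by (auto simp: mvge_def mat_def vge_one)

lemma matrix_mult_add_left: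
  fixes A B :: "'a::semiring_1 ^ 'n ^ 'm"
  shows "(A + B) ** C = A ** C + B ** C"
  by (vector matrix_matrix_mult_def sum.distrib distrib_right)

lemma matrix_mult_diff_left:
  fixes A B :: "'a::ring_1 ^ 'n ^ 'm"
  shows "(A - B) ** C = A ** C - B ** C"
  by (vector matrix_matrix_mult_def sum_subtractf left_diff_distrib)

lemma det_unip: "det (unip c y :: 'a::field fls ^ 'n ^ 'n) = 1"
proof -
  let ?x = "\<Sum>i\<in>UNIV - {c}. y i *s row i (mat 1 :: 'a fls ^ 'n ^ 'n)"
  have e: "unip c y = (\<chi> k. if k = c then row c (mat 1) + ?x else row k (mat 1))"
  proof (unfold vec_eq_iff, intro allI)
    fix k l
    have "(\<Sum>i\<in>UNIV - {c}. y i * (if i = l then 1 else 0)) = (if l = c then 0 else y l)"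
      by (simp add: if_distrib cong: if_cong)
    then show "unip c y $ k $ l = (\<chi> k. if k = c then row c (mat 1) + ?x else row k (mat 1)) $ k $ l"
      by (auto simp: unip_def row_def mat_def sum_component)
  qed
  have "?x \<in> vec.span {row j (mat 1 :: 'a fls ^ 'n ^ 'n) | j. j \<noteq> c}"
    by (force intro: vec.span_sum vec.span_scale vec.span_base)
  from det_row_span[OF this] show ?thesis unfolding e by (simp add: det_I)
qed

lemma unip_inverse: "unip c y ** unip c (\<lambda>l. - y l) = (mat 1 :: 'a::comm_ring_1 fls ^ 'n ^ 'n)"
  unfolding matrix_eq
proof
  fix x :: "'a fls ^ 'n"
  have "(unip c y *v (unip c (\<lambda>l. - y l) *v x)) $ i = x $ i" for i
  proof -
    have "(\<Sum>l\<in>UNIV - {c}. y l * (unip c (\<lambda>l. - y l) *v x) $ l) = (\<Sum>l\<in>UNIV - {c}. y l * x $ l)"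
      by (rule sum.cong) (auto simp: unip_mult_vec)
    then show ?thesis by (simp add: unip_mult_vec[of c y] unip_mult_vec[of c "\<lambda>l. - y l"] sum_negf)
  qed
  then show "unip c y ** unip c (\<lambda>l. - y l) *v x = mat 1 *v x"
    unfolding matrix_vector_mul_assoc[symmetric] by (simp add: vec_eq_iff)
qed

lemma SL_O_mult:
  assumes "h \<in> SL_O" "w \<in> SL_O" shows "h ** w \<in> SL_O"
proof -
  obtain h' w' where A: "mvge 0 h'" "h ** h' = mat 1" "h' ** h = mat 1" "mvge 0 w'" "w ** w' = mat 1" "w' ** w = mat 1"
    and B: "det h = 1" "mvge 0 h" "det w = 1" "mvge 0 w" using assms by (auto simp: SL_O_def)
  have 1: "(h ** w) ** (w' ** h') = mat 1"
  proof -
    have "(h ** w) ** (w' ** h') = h ** (w ** w') ** h'" by (simp only: matrix_mul_assoc)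
    then show ?thesis using A by simp
  qed
  have 2: "(w' ** h') ** (h ** w) = mat 1"
  proof -
    have "(w' ** h') ** (h ** w) = w' ** (h' ** h) ** w" by (simp only: matrix_mul_assoc)
    then show ?thesis using A by simp
  qed
  show ?thesis unfolding SL_O_def using A B 1 2 by (auto simp: det_mul intro!: mvge_mult exI[of _ "w' ** h'"])
qed

text \<open>g (1 + E) g^(-1) = 1 + g E g^(-1), and |E| <= s^(-2C) absorbs the bounds s^C for
  \<open>g\<close> and its inverse. Changing the sign of \<open>y\<close> gives the inverse
  matrix.\<close>

lemma conj_unip_SL_O:
  fixes g ginv :: "'a::{field,finite} fls ^ 'n ^ 'n"
  assumes g: "mvge (- int C) g" "mvge (- int C) ginv" "g ** ginv = mat 1" "ginv ** g = mat 1"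
    and y: "\<And>l. l \<noteq> c \<Longrightarrow> vge (2 * int C) (y l)"
  shows "g ** unip c y ** ginv \<in> SL_O"
proof -
  have mv: "mvge 0 (g ** unip c y ** ginv)" if y: "\<And>l. l \<noteq> c \<Longrightarrow> vge (2 * int C) (y l)" for y
  proof -
    define E :: "'a fls ^ 'n ^ 'n" where "E = (\<chi> i k. if i = c \<and> k \<noteq> c then y k else 0)"
    have u: "unip c y = mat 1 + E" by (auto simp: vec_eq_iff unip_def E_def mat_def)
    have "mvge (2 * int C) E" using y by (auto simp: mvge_def E_def)
    then have "mvge 0 (g ** E ** ginv)" using g by (intro mvge_mult[of "int C" _ "- int C"] mvge_mult[of "- int C" _ "2 * int C"]) auto
    moreover have "g ** unip c y ** ginv = mat 1 + g ** E ** ginv"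
      unfolding u by (simp add: matrix_add_ldistrib matrix_mult_add_left g)
    ultimately show ?thesis by (simp add: mvge_add mvge_mat_1)
  qed
  have inv: "(g ** unip c y ** ginv) ** (g ** unip c (\<lambda>l. - y l) ** ginv) = mat 1" for y
  proof -
    have "(g ** unip c y ** ginv) ** (g ** unip c (\<lambda>l. - y l) ** ginv) =
       g ** (unip c y ** (ginv ** g) ** unip c (\<lambda>l. - y l)) ** ginv" by (simp only: matrix_mul_assoc)
    then show ?thesis using g by (simp add: unip_inverse)
  qed
  have "det (g ** unip c y ** ginv) = det (g ** ginv)" by (simp add: det_mul det_unip)
  then have "det (g ** unip c y ** ginv) = 1" using g by (simp add: det_I)
  moreover have "mvge 0 (g ** unip c (\<lambda>l. - y l) ** ginv)" by (rule mv) (use y in \<open>auto intro: vge_uminus\<close>)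
  moreover have "(g ** unip c (\<lambda>l. - y l) ** ginv) ** (g ** unip c y ** ginv) = mat 1"
    using inv[of "\<lambda>l. - y l"] by simp
  moreover have "mvge 0 (g ** unip c y ** ginv)" by (rule mv[OF y])
  ultimately show ?thesis unfolding SL_O_def using inv[of y] by blast
qed

lemma trunc_mat_eq_iff:
  fixes h h' :: "'a::comm_ring_1 fls ^ 'n ^ 'n"
  assumes "mvge 0 h" "mvge 0 h'"
  shows "trunc_mat i h = trunc_mat i h' \<longleftrightarrow> mvge (int i) (h - h')"
proof
  assume eq: "trunc_mat i h = trunc_mat i h'"
  show "mvge (int i) (h - h')"
    unfolding mvge_def vge_def
  proof (intro allI impI)
    fix a b n assume n: "n < int i"
    have "cut 0 (int i - 1) (h $ a $ b) = cut 0 (int i - 1) (h' $ a $ b)"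
      using fun_cong[OF eq, of "(a, b)"] by (simp add: trunc_mat_def)
    then have "cut 0 (int i - 1) (h $ a $ b) $$ n = cut 0 (int i - 1) (h' $ a $ b) $$ n" by simp
    then show "(h - h') $ a $ b $$ n = 0"
      using n assms by (cases "n < 0") (auto simp: mvge_def vge_def)
  qed
next
  assume m: "mvge (int i) (h - h')"
  have "cut 0 (int i - 1) (h $ a $ b) = cut 0 (int i - 1) (h' $ a $ b)" for a b
    by (rule fls_eqI) (use m in \<open>auto simp: mvge_def vge_def\<close>)
  then show "trunc_mat i h = trunc_mat i h'" by (auto simp: trunc_mat_def fun_eq_iff)
qed

lemma trunc_mat_mult_right:
  assumes "h \<in> SL_O" "h' \<in> SL_O" "w \<in> SL_O"
  shows "trunc_mat i (h ** w) = trunc_mat i (h' ** w) \<longleftrightarrow> trunc_mat i h = trunc_mat i h'"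
proof -
  have K: "mvge 0 h" "mvge 0 h'" "mvge 0 (h ** w)" "mvge 0 (h' ** w)" "mvge 0 w"
    using assms SL_O_mult by (auto simp: SL_O_def)
  obtain w' where w': "mvge 0 w'" "w ** w' = mat 1" using assms by (auto simp: SL_O_def)
  have "mvge (int i) (h ** w - h' ** w) \<longleftrightarrow> mvge (int i) (h - h')"
  proof
    assume "mvge (int i) (h ** w - h' ** w)"
    then have "mvge (int i) ((h ** w - h' ** w) ** w')" by (rule mvge_mult[OF _ w'(1)]) simp
    moreover have "(h ** w - h' ** w) ** w' = h - h'"
      unfolding matrix_mult_diff_left by (simp add: matrix_mul_assoc[symmetric] w')
    ultimately show "mvge (int i) (h - h')" by simp
  next
    assume "mvge (int i) (h - h')"
    then show "mvge (int i) (h ** w - h' ** w)"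
      unfolding matrix_mult_diff_left[symmetric] by (rule mvge_mult[OF _ K(5)]) simp
  qed
  then show ?thesis using K by (simp add: trunc_mat_eq_iff)
qed

lemma finite_trunc_mat: "finite (trunc_mat i ` (SL_O :: ('a::{field,finite} fls ^ 'n ^ 'n) set))"
proof (rule finite_subset)
  show "trunc_mat i ` (SL_O :: ('a fls ^ 'n ^ 'n) set) \<subseteq> PiE UNIV (\<lambda>_. seg 0 (int i - 1))"
    by (auto simp: trunc_mat_def)
qed (intro finite_PiE finite_seg finite)

text \<open>\<open>R\<close> induces an injective, hence bijective, map of the finitely many
  classes, and \<open>P\<close> depends on the class only; \<open>\<pi>\<close> is this permutation
  expressed on the representatives \<open>H\<close>.\<close>

lemma card_translate_representatives:
  assumes H: "finite H" "H \<subseteq> K" "inj_on F H" "F ` H = F ` K"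
    and R: "\<And>h. h \<in> K \<Longrightarrow> R h \<in> K" "\<And>h h'. h \<in> K \<Longrightarrow> h' \<in> K \<Longrightarrow> F (R h) = F (R h') \<longleftrightarrow> F h = F h'"
    and P: "\<And>h h'. h \<in> K \<Longrightarrow> h' \<in> K \<Longrightarrow> F h = F h' \<Longrightarrow> P h = P h'"
  shows "card {h \<in> H. P (R h)} = card {h \<in> H. P h}"
proof -
  define \<pi> where "\<pi> h = the_inv_into H F (F (R h))" for h
  have mem: "F (R h) \<in> F ` H" if "h \<in> H" for h using that H R(1) by auto
  have \<pi>H: "\<pi> h \<in> H" "F (\<pi> h) = F (R h)" if "h \<in> H" for h
    using the_inv_into_into[OF H(3) mem[OF that]] f_the_inv_into_f[OF H(3) mem[OF that]] by (auto simp: \<pi>_def)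
  have inj: "inj_on \<pi> H"
  proof (rule inj_onI)
    fix h h' assume hh: "h \<in> H" "h' \<in> H" "\<pi> h = \<pi> h'"
    then have "F (R h) = F (R h')" using \<pi>H(2) by metis
    then have "F h = F h'" using R(2) H(2) hh by blast
    then show "h = h'" using H(3) hh by (auto dest: inj_onD)
  qed
  then have surj: "\<pi> ` H = H" using endo_inj_surj[OF H(1)] \<pi>H(1) by blast
  have PP: "P (R h) = P (\<pi> h)" if "h \<in> H" for h
    using P[of "R h" "\<pi> h"] \<pi>H[OF that] R(1) H(2) that by auto
  have "bij_betw \<pi> {h \<in> H. P (R h)} {h \<in> H. P h}"
    unfolding bij_betw_def
  proof
    show "inj_on \<pi> {h \<in> H. P (R h)}" by (rule inj_on_subset[OF inj]) auto
    show "\<pi> ` {h \<in> H. P (R h)} = {h \<in> H. P h}"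
    proof (intro set_eqI iffI)
      fix y assume "y \<in> {h \<in> H. P h}"
      then obtain h where "h \<in> H" "y = \<pi> h" "P y" using surj by blast
      then show "y \<in> \<pi> ` {h \<in> H. P (R h)}" using PP by auto
    qed (use \<pi>H PP in auto)
  qed
  then show ?thesis by (rule bij_betw_same_card)
qed

lemma matrix_bounded: "\<exists>C::nat. \<forall>C'\<ge>C. mvge (- int C') (A :: 'a::zero fls ^ 'n ^ 'm)"
proof -
  have *: "\<forall>i j. \<exists>n. vge (- int n) (A $ i $ j)"
  proof (intro allI)
    fix i j
    have "vge (- int (nat (- fls_subdegree (A $ i $ j)))) (A $ i $ j)" by (auto simp: vge_iff)
    then show "\<exists>n. vge (- int n) (A $ i $ j)" by blast
  qed
  then obtain f where f: "\<And>i j. vge (- int (f i j)) (A $ i $ j)" by metis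
  have le: "f i j \<le> Max (range (\<lambda>(i, j). f i j))" for i j by (rule Max_ge) auto
  have "mvge (- int C') A" if C': "C' \<ge> Max (range (\<lambda>(i, j). f i j))" for C'
    unfolding mvge_def
  proof (intro allI)
    fix i j
    show "vge (- int C') (A $ i $ j)" by (rule vge_mono[OF f]) (use le[of i j] C' in simp)
  qed
  then show ?thesis by blast
qed

lemma SL_exists_inverse:
  fixes g :: "'a::{field,finite} fls ^ 'n ^ 'n"
  assumes "det g = 1"
  shows "\<exists>g'. g ** g' = mat 1 \<and> g' ** g = mat 1 \<and> det g' = 1"
proof -
  have "invertible g" using assms by (simp add: invertible_det_nz)
  then obtain g' where g': "g ** g' = mat 1" "g' ** g = mat 1" by (auto simp: invertible_def)
  have "det (g ** g') = 1" using g' by (simp add: det_I)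
  then have "det g' = 1" using assms by (simp add: det_mul)
  with g' show ?thesis by blast
qed

text \<open>
  Right multiplication by \<open>g u(y) g\<^sup>-\<^sup>1\<close>, which lies in \<open>SL\<^sub>n(O)\<close> for small \<open>y\<close>, permutes the classes
  modulo \<open>X^(-i)\<close>. Hence the average over the classes can be replaced by averages over the unipotent
  orbits \<open>h g u(y)\<close>, which are controlled uniformly in \<open>h\<close>.
\<close>

lemma bad_fraction_small:
  fixes \<psi> :: "real \<Rightarrow> real" and g :: "'a::{field,finite} fls ^ 'n ^ 'n"
  assumes n: "CARD('n) \<ge> 2"
    and nonneg: "\<And>x. x > 0 \<Longrightarrow> \<psi> x \<ge> 0" and noninc: "antimono_on {0<..} \<psi>"
    and div: "\<not> summable (\<lambda>m::nat. ln (real (Suc m)) ^ (CARD('n) - 2) * \<psi> (real (Suc m)))"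
    and \<epsilon>: "\<epsilon> > 0" and g: "det g = 1"
  shows "\<exists>i0. \<forall>i\<ge>i0. \<forall>H. finite H \<and> H \<subseteq> SL_O \<and> inj_on (trunc_mat i) H \<and> trunc_mat i ` H = trunc_mat i ` (SL_O :: ('a fls ^ 'n ^ 'n) set) \<longrightarrow>
     real (card {h \<in> H. bad \<psi> T (h ** g)}) \<le> \<epsilon> * real (card H)"
proof -
  obtain ginv where ginv: "g ** ginv = mat 1" "ginv ** g = mat 1" using SL_exists_inverse[OF g] by blast
  obtain C1 C2 where C12: "\<And>C. C \<ge> C1 \<Longrightarrow> mvge (- int C) g" "\<And>C. C \<ge> C2 \<Longrightarrow> mvge (- int C) ginv"
    using matrix_bounded by metis
  define C where "C = max C1 C2"
  have C: "mvge (- int C) g" "mvge (- int C) ginv" using C12 by (auto simp: C_def)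
  fix c :: 'n
  \<comment> \<open>j = 2 C because conjugation by \<open>g\<close> can enlarge the unipotent part
    by s^(2C).\<close>
  obtain N S where NS: "\<And>G Ginv :: 'a fls ^ 'n ^ 'n. mvge (- int C) G \<Longrightarrow> mvge (- int C) Ginv \<Longrightarrow>
    G ** Ginv = mat 1 \<Longrightarrow> Ginv ** G = mat 1 \<Longrightarrow>
    real (card {z \<in> (UNIV - {c}) \<rightarrow>\<^sub>E (seg 1 (int N) :: 'a fls set). \<not> robust S \<psi> T (G ** unip c (\<lambda>l. Xpow (- int (2 * C)) * z l))}) \<le>
      \<epsilon> * real (card ((UNIV - {c}) \<rightarrow>\<^sub>E (seg 1 (int N) :: 'a fls set)))"
    using unipotent_average[OF n nonneg noninc div \<epsilon>, where C = C and c = c and j = "2 * C" and T = T, where 'a = 'a] by blast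
  let ?\<Omega> = "(UNIV - {c}) \<rightarrow>\<^sub>E (seg 1 (int N) :: 'a fls set)"
  have fin: "finite ?\<Omega>" by (intro finite_PiE finite_seg finite)
  have "(\<lambda>l\<in>UNIV - {c}. 0) \<in> ?\<Omega>" by auto
  then have \<Omega>pos: "card ?\<Omega> > 0" using fin card_gt_0_iff by blast
  define u where "u z = unip c (\<lambda>l. Xpow (- int (2 * C)) * z l)" for z :: "'n \<Rightarrow> 'a fls"
  define w where "w z = g ** u z ** ginv" for z
  have wK: "w z \<in> SL_O" if z: "z \<in> ?\<Omega>" for z
    unfolding w_def u_def
  proof (rule conj_unip_SL_O[OF C ginv])
    fix l assume "l \<noteq> c"
    then have "vge 1 (z l)" using z by (auto intro: seg_vge)
    then show "vge (2 * int C) (Xpow (- int (2 * C)) * z l)"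
      by (rule vge_mult'[OF veq_vge[OF veq_Xpow]]) simp
  qed
  show ?thesis
  proof (intro exI allI impI)
    fix i and H :: "('a fls ^ 'n ^ 'n) set"
    \<comment> \<open>\<open>robust\<close> tolerates errors up to s^(-S-1), and changing
      \<open>h\<close> within its class modulo X^(-i) moves a vector \<open>h *v x\<close> with |x|
      <= s^S by at most s^(S-i).\<close>
    assume i: "2 * S + 1 \<le> i" and HH: "finite H \<and> H \<subseteq> SL_O \<and> inj_on (trunc_mat i) H \<and> trunc_mat i ` H = trunc_mat i ` (SL_O :: ('a fls ^ 'n ^ 'n) set)"
    then have H: "finite H" "H \<subseteq> SL_O" "inj_on (trunc_mat i) H" "trunc_mat i ` H = trunc_mat i ` (SL_O :: ('a fls ^ 'n ^ 'n) set)" by auto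
    \<comment> \<open>\<open>bad\<close> need not be constant on classes modulo X^(-i), so it is
      replaced by its saturation. Robustness still excludes it, since a robust vector stays good for
      every member of the class.\<close>
    define P where "P h \<longleftrightarrow> (\<exists>h1\<in>SL_O. trunc_mat i h1 = trunc_mat i h \<and> bad \<psi> T (h1 ** g))" for h
    have key: "\<not> robust S \<psi> T ((h ** g) ** u z)" if h: "h \<in> SL_O" and z: "z \<in> ?\<Omega>" and p: "P (h ** w z)" for h z
    proof
      assume "robust S \<psi> T ((h ** g) ** u z)"
      then obtain q where q: "\<And>i. q $ i \<in> Zint" "\<And>i. vge (- int S) (((h ** g) ** u z *v q) $ i)"
        "\<And>v. (\<And>i. vge (int S + 1) (v $ i - ((h ** g) ** u z *v q) $ i)) \<Longrightarrow> good \<psi> T v"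
        unfolding robust_def by blast
      obtain h1 where h1: "h1 \<in> SL_O" "trunc_mat i h1 = trunc_mat i (h ** w z)" "bad \<psi> T (h1 ** g)"
        using p unfolding P_def by blast
      have hw: "h ** w z \<in> SL_O" by (rule SL_O_mult[OF h wK[OF z]])
      obtain k where k: "mvge 0 k" "k ** (h ** w z) = mat 1" using hw by (auto simp: SL_O_def)
      have d: "mvge (int i) (h1 - h ** w z)"
        using trunc_mat_eq_iff[of h1 "h ** w z" i] h1 hw by (auto simp: SL_O_def)
      have e1: "(h ** g) ** u z *v q = (h ** w z) *v (g *v q)"
      proof -
        have "(h ** w z) ** g = h ** (g ** u z ** (ginv ** g))" unfolding w_def by (simp only: matrix_mul_assoc)
        then have "(h ** w z) ** g = (h ** g) ** u z" using ginv by (simp add: matrix_mul_assoc)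
        then show ?thesis by (simp add: matrix_vector_mul_assoc)
      qed
      \<comment> \<open>\<open>k\<close> is integral, so the bound on the vector of the translated
        lattice passes back to g q.\<close>
      have "k *v ((h ** w z) *v (g *v q)) = (k ** (h ** w z)) *v (g *v q)" by (rule matrix_vector_mul_assoc)
      then have "g *v q = k *v ((h ** w z) *v (g *v q))" unfolding k by simp
      then have gq: "vge (- int S) ((g *v q) $ i)" for i
        using mvge_vec[OF k(1), of "- int S" "(h ** w z) *v (g *v q)" "- int S"] q(2) unfolding e1 by simp
      have "good \<psi> T (h1 ** g *v q)"
      proof (rule q(3))
        fix j
        have "(h1 ** g *v q) $ j - ((h ** g) ** u z *v q) $ j = ((h1 - h ** w z) *v (g *v q)) $ j"
          unfolding e1 by (simp add: matrix_vector_mul_assoc[symmetric] matrix_vector_mult_diff_rdistrib)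
        then show "vge (int S + 1) ((h1 ** g *v q) $ j - ((h ** g) ** u z *v q) $ j)"
          using mvge_vec[OF d gq, of "int S + 1" j] i by simp
      qed
      then show False using h1(3) q(1) unfolding bad_def by blast
    qed
    have row: "real (card {z \<in> ?\<Omega>. P (h ** w z)}) \<le> \<epsilon> * real (card ?\<Omega>)" if h: "h \<in> H" for h
    proof -
      have hK: "h \<in> SL_O" using h H by blast
      obtain h' where h': "mvge 0 h'" "h ** h' = mat 1" "h' ** h = mat 1" and hm: "mvge 0 h" using hK by (auto simp: SL_O_def)
      have "card {z \<in> ?\<Omega>. P (h ** w z)} \<le> card {z \<in> ?\<Omega>. \<not> robust S \<psi> T ((h ** g) ** u z)}"
        by (rule card_mono) (use fin key[OF hK] in auto)
      moreover have "real (card {z \<in> ?\<Omega>. \<not> robust S \<psi> T ((h ** g) ** u z)}) \<le> \<epsilon> * real (card ?\<Omega>)"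
        unfolding u_def
      proof (rule NS)
        show "mvge (- int C) (h ** g)" by (rule mvge_mult[OF hm C(1)]) simp
        show "mvge (- int C) (ginv ** h')" by (rule mvge_mult[OF C(2) h'(1)]) simp
        have "(h ** g) ** (ginv ** h') = h ** (g ** ginv) ** h'" by (simp only: matrix_mul_assoc)
        then show "(h ** g) ** (ginv ** h') = mat 1" using ginv h' by simp
        have "(ginv ** h') ** (h ** g) = ginv ** (h' ** h) ** g" by (simp only: matrix_mul_assoc)
        then show "(ginv ** h') ** (h ** g) = mat 1" using ginv h' by simp
      qed
      ultimately show ?thesis by linarith
    qed
    have col: "card {h \<in> H. P (h ** w z)} = card {h \<in> H. P h}" if z: "z \<in> ?\<Omega>" for z
    proof (rule card_translate_representatives[OF H])
      show "h ** w z \<in> SL_O" if "h \<in> SL_O" for h using SL_O_mult[OF that wK[OF z]] .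
      show "trunc_mat i (h ** w z) = trunc_mat i (h' ** w z) \<longleftrightarrow> trunc_mat i h = trunc_mat i h'"
        if "h \<in> SL_O" "h' \<in> SL_O" for h h' by (rule trunc_mat_mult_right[OF that wK[OF z]])
    qed (simp add: P_def)
    \<comment> \<open>Double counting: the sum over \<open>h\<close> does not depend on
      \<open>z\<close> by \<open>col\<close>, and the sum over \<open>z\<close> is small by
      \<open>row\<close>.\<close>
    have sums: "(\<Sum>z\<in>?\<Omega>. card {h \<in> H. P (h ** w z)}) = (\<Sum>h\<in>H. card {z \<in> ?\<Omega>. P (h ** w z)})"
    proof -
      have "(\<Sum>z\<in>?\<Omega>. card {h \<in> H. P (h ** w z)}) = (\<Sum>z\<in>?\<Omega>. \<Sum>h\<in>H. if P (h ** w z) then 1 else 0)"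
        using H(1) by (simp add: sum.inter_filter[symmetric])
      also have "\<dots> = (\<Sum>h\<in>H. \<Sum>z\<in>?\<Omega>. if P (h ** w z) then 1 else 0)" by (rule sum.swap)
      also have "\<dots> = (\<Sum>h\<in>H. card {z \<in> ?\<Omega>. P (h ** w z)})"
        using fin by (simp add: sum.inter_filter[symmetric])
      finally show ?thesis .
    qed
    have "real (card ?\<Omega>) * real (card {h \<in> H. P h}) = real (\<Sum>z\<in>?\<Omega>. card {h \<in> H. P (h ** w z)})"
      using col by simp
    also have "\<dots> = (\<Sum>h\<in>H. real (card {z \<in> ?\<Omega>. P (h ** w z)}))" unfolding sums by simp
    also have "\<dots> \<le> (\<Sum>h\<in>H. \<epsilon> * real (card ?\<Omega>))" by (rule sum_mono[OF row])
    also have "\<dots> = real (card ?\<Omega>) * (\<epsilon> * real (card H))" by simp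
    finally have "real (card {h \<in> H. P h}) \<le> \<epsilon> * real (card H)"
      using \<Omega>pos by (simp only: mult_le_cancel_left_pos of_nat_0_less_iff)
    moreover have "card {h \<in> H. bad \<psi> T (h ** g)} \<le> card {h \<in> H. P h}"
      by (rule card_mono) (use H in \<open>auto simp: P_def\<close>)
    ultimately show "real (card {h \<in> H. bad \<psi> T (h ** g)}) \<le> \<epsilon> * real (card H)" by linarith
  qed
qed

section \<open>Null sets of lattices\<close>

text \<open>Nonzero coordinates keep their absolute value under small changes. Zero coordinates
  become at most \<open>\<delta>\<close>, chosen so that the norm is unchanged and the product obeys
  the bound even if all other coordinates are as large as the norm.\<close>

lemma good_open:
  fixes v :: "'a::{field,finite} fls ^ 'n"
  assumes good: "good \<psi> T v" and T: "T > 0" and \<psi>: "\<And>x. x > 0 \<Longrightarrow> \<psi> x > 0"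
  shows "\<exists>M. \<forall>v'. (\<forall>i. vge M (v' $ i - v $ i)) \<longrightarrow> good \<psi> T v'"
proof -
  define s where "s = real CARD('a)"
  have s2: "s \<ge> 2" using card_field_ge_2[where 'a='a] by (simp add: s_def)
  let ?r = "norm_k v"
  have rpos: "?r > 0" using good T by (auto simp: good_def)
  define \<delta> where "\<delta> = min ?r (?r * \<psi> ?r / ?r ^ (CARD('n) - 1))"
  have \<delta>: "\<delta> > 0" "\<delta> \<le> ?r" "\<delta> * ?r ^ (CARD('n) - 1) \<le> ?r * \<psi> ?r"
  proof -
    show "\<delta> > 0" using rpos \<psi>[OF rpos] by (simp add: \<delta>_def)
    show "\<delta> \<le> ?r" by (simp add: \<delta>_def)
    have "\<delta> \<le> ?r * \<psi> ?r / ?r ^ (CARD('n) - 1)" by (simp add: \<delta>_def)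
    then show "\<delta> * ?r ^ (CARD('n) - 1) \<le> ?r * \<psi> ?r" using rpos by (simp add: pos_le_divide_eq)
  qed
  obtain m where m: "(1/s) ^ m < \<delta>" using real_arch_pow_inv[of \<delta> "1/s"] \<delta> s2 by auto
  define M where "M = max (int m) (Max (range (\<lambda>i. fls_subdegree (v $ i))) + 1)"
  have "good \<psi> T v'" if v': "\<And>i. vge M (v' $ i - v $ i)" for v'
  proof -
    have nz: "abs_k (v' $ i) = abs_k (v $ i)" if "v $ i \<noteq> 0" for i
    proof -
      have q: "veq (fls_subdegree (v $ i)) (v $ i)" using that by (simp add: veq_iff)
      have "fls_subdegree (v $ i) \<le> Max (range (\<lambda>i. fls_subdegree (v $ i)))" by (rule Max_ge) auto
      then have "fls_subdegree (v $ i) < M" by (simp add: M_def less_max_iff_disj)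
      then have "veq (fls_subdegree (v $ i)) (v $ i + (v' $ i - v $ i))" by (rule veq_add[OF q v'])
      then have "veq (fls_subdegree (v $ i)) (v' $ i)" by simp
      then show ?thesis using abs_k_veq[OF q] abs_k_veq by metis
    qed
    have z: "abs_k (v' $ i) \<le> \<delta>" if "v $ i = 0" for i
    proof -
      have "vge (int m) (v' $ i)" using vge_mono[OF v', of "int m" i] that by (simp add: M_def)
      then have "abs_k (v' $ i) \<le> real CARD('a) powi (- int m)" by (rule abs_k_vge)
      also have "\<dots> = (1/s) ^ m" by (simp add: s_def power_int_minus power_divide inverse_eq_divide)
      finally show ?thesis using m by simp
    qed
    have le: "abs_k (v $ i) \<le> ?r" for i unfolding norm_k_def by (rule Max_ge) auto
    have le': "abs_k (v' $ i) \<le> ?r" for i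
      using nz[of i] z[of i] le[of i] \<delta>(2) by (cases "v $ i = 0") auto
    have nn: "abs_k x \<ge> 0" for x :: "'a fls" by (auto simp: abs_k_def)
    have norm: "norm_k v' = ?r"
      unfolding norm_k_def[of v']
    proof (rule Max_eqI)
      have "?r \<in> range (\<lambda>i. abs_k (v $ i))" unfolding norm_k_def by (rule Max_in) auto
      then obtain i where i: "?r = abs_k (v $ i)" by blast
      then have "v $ i \<noteq> 0" using rpos by (auto simp: abs_k_def)
      then show "?r \<in> range (\<lambda>i. abs_k (v' $ i))" using nz i by (metis rangeI)
    qed (use le' in auto)
    have "prod_k v' \<le> ?r * \<psi> ?r"
    proof (cases "\<forall>i. v $ i \<noteq> 0")
      case True
      then have "prod_k v' = prod_k v" unfolding prod_k_def using nz by (intro prod.cong) auto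
      then show ?thesis using good by (simp add: good_def)
    next
      case False
      then obtain i where i: "v $ i = 0" by blast
      have "prod_k v' = abs_k (v' $ i) * (\<Prod>k\<in>UNIV - {i}. abs_k (v' $ k))"
        unfolding prod_k_def by (subst prod.remove[of UNIV i]) auto
      also have "\<dots> \<le> \<delta> * (\<Prod>k\<in>UNIV - {i}. ?r)"
        using z[OF i] le' nn \<delta> by (intro mult_mono prod_mono prod_nonneg) auto
      also have "\<dots> = \<delta> * ?r ^ (CARD('n) - 1)" by (simp add: card_Diff_singleton)
      also have "\<dots> \<le> ?r * \<psi> ?r" by (rule \<delta>)
      finally show ?thesis .
    qed
    then show ?thesis using good unfolding good_def norm by simp
  qed
  then show ?thesis by blast
qed

lemma dist_fls_vge:
  fixes x y :: "'a::comm_ring_1 fls"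
  assumes "dist x y < inverse (2 ^ m)"
  shows "vge (int m) (x - y)"
proof (cases "x = y")
  case False
  have "fls_subdegree (x - y) \<ge> int m"
  proof (rule ccontr)
    assume a: "\<not> fls_subdegree (x - y) \<ge> int m"
    have "inverse (2 ^ m) \<le> dist x y"
    proof (cases "fls_subdegree (x - y) \<ge> 0")
      case True
      then have "nat (fls_subdegree (x - y)) \<le> m" using a by linarith
      then have "(2::real) ^ nat (fls_subdegree (x - y)) \<le> 2 ^ m" by (intro power_increasing) auto
      then show ?thesis using True False by (simp add: dist_fls_def le_imp_inverse_le)
    next
      case neg: False
      have "inverse ((2::real) ^ m) \<le> 1" by (simp add: inverse_le_1_iff)
      also have "1 \<le> (2::real) ^ nat (- fls_subdegree (x - y))" by simp
      finally show ?thesis using neg False by (simp add: dist_fls_def)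
    qed
    with assms show False by simp
  qed
  then show ?thesis by (simp add: vge_iff)
qed simp

lemma open_good:
  fixes h :: "'a::{field,finite} fls ^ 'n ^ 'n" and q :: "'a fls ^ 'n"
  assumes T: "T > 0" and \<psi>: "\<And>x. x > 0 \<Longrightarrow> \<psi> x > 0"
  shows "open {g. good \<psi> T (h *v (g *v q))}"
  unfolding open_dist
proof (intro ballI)
  fix g assume "g \<in> {g. good \<psi> T (h *v (g *v q))}"
  then have "good \<psi> T (h *v (g *v q))" by simp
  then obtain M where M: "\<And>v'. (\<And>i. vge M (v' $ i - (h *v (g *v q)) $ i)) \<Longrightarrow> good \<psi> T v'"
    using good_open[where \<psi> = \<psi>, OF _ T \<psi>] by blast
  obtain a where a: "mvge (- int a) h" using matrix_bounded[of h] by blast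
  obtain b where "mvge (- int b) (\<chi> (i::'n) j. q $ j)" using matrix_bounded by blast
  then have b: "vge (- int b) (q $ j)" for j by (auto simp: mvge_def)
  define m where "m = nat (M + int a + int b)"
  show "\<exists>e>0. \<forall>y. dist y g < e \<longrightarrow> y \<in> {g. good \<psi> T (h *v (g *v q))}"
  proof (intro exI conjI allI impI CollectI)
    fix y assume y: "dist y g < inverse (2 ^ m)"
    have "dist (y $ i $ j) (g $ i $ j) < inverse (2 ^ m)" for i j
      using dist_vec_nth_le[of "y $ i" j "g $ i"] dist_vec_nth_le[of y i g] y by linarith
    then have d: "mvge (int m) (y - g)" by (auto simp: mvge_def intro: dist_fls_vge)
    show "good \<psi> T (h *v (y *v q))"
    proof (rule M)
      fix i
      have "vge (int m - int b) (((y - g) *v q) $ i)" for i by (rule mvge_vec[OF d b]) simp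
      then have "vge M ((h *v ((y - g) *v q)) $ i)" by (rule mvge_vec[OF a]) (simp add: m_def)
      moreover have "h *v ((y - g) *v q) = h *v (y *v q) - h *v (g *v q)"
        by (simp only: matrix_vector_mult_diff_rdistrib matrix_vector_mult_diff_distrib)
      ultimately show "vge M ((h *v (y *v q)) $ i - (h *v (g *v q)) $ i)" by simp
    qed
  qed simp
qed

section \<open>Measurability and invariance of the bad sets\<close>

definition badset :: "(real \<Rightarrow> real) \<Rightarrow> real \<Rightarrow> ('a::{field,finite} fls ^ 'n) set set" where
  "badset \<psi> T = {\<Lambda> \<in> unimodular_lattices. \<forall>v\<in>\<Lambda>. \<not> good \<psi> T v}"

lemma lattice_of_mult: "(*v) h ` lattice_of g = lattice_of (h ** g)"
  by (auto simp: lattice_of_def image_image matrix_vector_mul_assoc)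

lemma SL_k_mult: "g \<in> SL_k \<Longrightarrow> h \<in> SL_k \<Longrightarrow> g ** h \<in> SL_k"
  by (simp add: SL_k_def det_mul)

lemma lattice_of_badset:
  assumes "g \<in> SL_k"
  shows "lattice_of g \<in> badset \<psi> T \<longleftrightarrow> bad \<psi> T g"
  using assms by (auto simp: badset_def bad_def unimodular_lattices_def lattice_of_def ring_Z_eq)

text \<open>The complement is open in the quotient: its preimage in \<open>SL_k\<close> is the
  union, over polynomial vectors \<open>q\<close>, of the relatively open sets where h g q is
  good.\<close>

lemma translate_badset_measurable:
  fixes h :: "'a::{field,finite} fls ^ 'n ^ 'n"
  assumes T: "T > 0" and \<psi>: "\<And>x. x > 0 \<Longrightarrow> \<psi> x > 0" and h: "h \<in> SL_k"
  shows "{\<Lambda> \<in> unimodular_lattices. (*v) h ` \<Lambda> \<in> badset \<psi> T} \<in> sets borel_lattices"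
proof -
  let ?X = "unimodular_lattices :: ('a fls ^ 'n) set set"
  let ?U = "{\<Lambda> \<in> ?X. (*v) h ` \<Lambda> \<notin> badset \<psi> T}"
  let ?B = "{U. U \<subseteq> ?X \<and> openin (top_of_set SL_k) {g \<in> SL_k. lattice_of g \<in> U}}"
  have "{g \<in> SL_k. lattice_of g \<in> ?U} = SL_k \<inter> (\<Union>q\<in>{q. \<forall>i. q $ i \<in> Zint}. {g. good \<psi> T (h *v (g *v q))})"
    (is "?L = ?R")
  proof (intro set_eqI)
    fix g
    show "g \<in> ?L \<longleftrightarrow> g \<in> ?R"
    proof (cases "g \<in> SL_k")
      case True
      then have "g \<in> ?L \<longleftrightarrow> \<not> bad \<psi> T (h ** g)"
        using lattice_of_badset[OF SL_k_mult[OF h True]] by (auto simp: lattice_of_mult unimodular_lattices_def)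
      then show ?thesis using True by (auto simp: bad_def matrix_vector_mul_assoc)
    qed auto
  qed
  moreover have "open (\<Union>q\<in>{q. \<forall>i. q $ i \<in> Zint}. {g :: 'a fls ^ 'n ^ 'n. good \<psi> T (h *v (g *v q))})"
  proof (rule open_UN, rule ballI)
    fix q :: "'a fls ^ 'n"
    show "open {g :: 'a fls ^ 'n ^ 'n. good \<psi> T (h *v (g *v q))}" by (rule open_good[where \<psi> = \<psi>, OF T \<psi>])
  qed
  ultimately have "openin (top_of_set SL_k) {g \<in> SL_k. lattice_of g \<in> ?U}"
    unfolding openin_open by blast
  then have U: "?U \<in> ?B" by blast
  have sets: "sets borel_lattices = sigma_sets ?X ?B"
    unfolding borel_lattices_def by (rule sets_measure_of) auto
  have "?U \<in> sets borel_lattices" unfolding sets by (rule sigma_sets.Basic[OF U])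
  then have "space borel_lattices - ?U \<in> sets borel_lattices" by (rule sets.compl_sets)
  moreover have "space borel_lattices = ?X"
    unfolding borel_lattices_def by (rule space_measure_of) auto
  moreover have "?X - ?U = {\<Lambda> \<in> ?X. (*v) h ` \<Lambda> \<in> badset \<psi> T}" by blast
  ultimately show ?thesis by simp
qed

lemma matrix_image_inverse:
  assumes "g ** h = mat 1"
  shows "(*v) g ` ((*v) h ` A) = A"
  by (simp add: image_image matrix_vector_mul_assoc assms)

text \<open>The averages \<open>f i\<close> of indicators of translates all have integral
  \<open>measure \<mu> ?B\<close>, are bounded by 1 and tend to 0 at every lattice; dominated
  convergence concludes.\<close>

lemma badset_null:
  fixes \<psi> :: "real \<Rightarrow> real" and \<mu> :: "('a::{field,finite} fls ^ 'n) set measure"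
  assumes n: "CARD('n) \<ge> 2" and \<mu>: "invariant_probability \<mu>"
    and nonneg: "\<And>x. x > 0 \<Longrightarrow> \<psi> x \<ge> 0" and noninc: "antimono_on {0<..} \<psi>"
    and div: "\<not> summable (\<lambda>m::nat. ln (real (Suc m)) ^ (CARD('n) - 2) * \<psi> (real (Suc m)))"
    and T: "T > 0"
  shows "badset \<psi> T \<in> null_sets \<mu>"
proof -
  interpret prob_space \<mu> using \<mu> by (simp add: invariant_probability_def)
  let ?X = "unimodular_lattices :: ('a fls ^ 'n) set set"
  let ?B = "badset \<psi> T :: ('a fls ^ 'n) set set"
  have sets: "sets \<mu> = sets borel_lattices" using \<mu> by (simp add: invariant_probability_def)
  have space: "space \<mu> = ?X"
    using sets_eq_imp_space_eq[OF sets] by (simp add: borel_lattices_def space_measure_of_conv)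
  have \<psi>: "\<psi> x > 0" if "x > 0" for x using psi_pos[OF nonneg noninc div that] .
  define Bh where "Bh h = {\<Lambda> \<in> ?X. (*v) h ` \<Lambda> \<in> ?B}" for h :: "'a fls ^ 'n ^ 'n"
  have Bh_sets: "Bh h \<in> sets \<mu>" if "h \<in> SL_k" for h
    unfolding sets Bh_def by (rule translate_badset_measurable[OF T \<psi> that])
  have I1: "mat 1 \<in> SL_k" by (simp add: SL_k_def det_I)
  have "Bh (mat 1) = ?B" by (auto simp: Bh_def badset_def)
  then have B_sets: "?B \<in> sets \<mu>" using Bh_sets[OF I1] by simp
  have Bh_measure: "measure \<mu> (Bh h) = measure \<mu> ?B" if h: "h \<in> SL_k" for h
  proof -
    obtain h' where h': "h ** h' = mat 1" "h' ** h = mat 1" "det h' = 1" using SL_exists_inverse h by (auto simp: SL_k_def)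
    have hS: "h' \<in> SL_k" using h' by (simp add: SL_k_def)
    \<comment> \<open>Invariance speaks of images, so the set of lattices that \<open>h\<close>
      moves into the bad set is written as the image of the bad set under the inverse of
      \<open>h\<close>.\<close>
    have "(\<lambda>\<Lambda>. (*v) h' ` \<Lambda>) ` ?B = Bh h"
    proof (intro set_eqI iffI)
      fix \<Lambda> assume "\<Lambda> \<in> (\<lambda>\<Lambda>. (*v) h' ` \<Lambda>) ` ?B"
      then obtain \<Lambda>' where L: "\<Lambda>' \<in> ?B" "\<Lambda> = (*v) h' ` \<Lambda>'" by blast
      then obtain g where g: "g \<in> SL_k" "\<Lambda>' = lattice_of g" by (auto simp: badset_def unimodular_lattices_def)
      have "\<Lambda> = lattice_of (h' ** g)" using L g by (simp add: lattice_of_mult)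
      then have "\<Lambda> \<in> ?X" using SL_k_mult[OF hS g(1)] by (auto simp: unimodular_lattices_def)
      moreover have "(*v) h ` \<Lambda> = \<Lambda>'" unfolding L(2) by (rule matrix_image_inverse[OF h'(1)])
      ultimately show "\<Lambda> \<in> Bh h" using L by (simp add: Bh_def)
    next
      fix \<Lambda> assume "\<Lambda> \<in> Bh h"
      then have "(*v) h ` \<Lambda> \<in> ?B" by (simp add: Bh_def)
      moreover have "\<Lambda> = (*v) h' ` ((*v) h ` \<Lambda>)" by (rule matrix_image_inverse[OF h'(2), symmetric])
      ultimately show "\<Lambda> \<in> (\<lambda>\<Lambda>. (*v) h' ` \<Lambda>) ` ?B" by blast
    qed
    then have "emeasure \<mu> (Bh h) = emeasure \<mu> ?B"
      using \<mu> hS B_sets unfolding invariant_probability_def by metis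
    then show ?thesis by (simp add: measure_def)
  qed
  have "\<exists>H. H \<subseteq> SL_O \<and> inj_on (trunc_mat i) H \<and> trunc_mat i ` (SL_O :: ('a fls ^ 'n ^ 'n) set) = trunc_mat i ` H" for i
    using subset_image_inj[of "trunc_mat i ` (SL_O :: ('a fls ^ 'n ^ 'n) set)" "trunc_mat i" SL_O] by auto
  then obtain H where H: "\<And>i. H i \<subseteq> SL_O" "\<And>i. inj_on (trunc_mat i) (H i)"
    "\<And>i. trunc_mat i ` (SL_O :: ('a fls ^ 'n ^ 'n) set) = trunc_mat i ` H i" by metis
  have finH: "finite (H i)" for i
    using finite_trunc_mat[of i, where 'a = 'a and 'n = 'n] H(2)[of i] unfolding H(3) by (rule finite_imageD)
  have "mat 1 \<in> (SL_O :: ('a fls ^ 'n ^ 'n) set)"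
    by (auto simp: SL_O_def det_I mvge_mat_1 intro!: exI[of _ "mat 1"])
  then have Hne: "H i \<noteq> {}" for i using H(3)[of i] by auto
  have cardH: "card (H i) > 0" for i using finH Hne by (simp add: card_gt_0_iff)
  have HSL: "h \<in> SL_k" if "h \<in> H i" for h i using H(1) that by (auto simp: SL_O_def SL_k_def)
  define f where "f i \<Lambda> = (\<Sum>h\<in>H i. indicator (Bh h) \<Lambda>) / real (card (H i))" for i and \<Lambda> :: "('a fls ^ 'n) set"
  have f_meas: "f i \<in> borel_measurable \<mu>" for i
    unfolding f_def by (intro borel_measurable_divide borel_measurable_sum borel_measurable_indicator Bh_sets HSL) auto
  have f_int: "integral\<^sup>L \<mu> (f i) = measure \<mu> ?B" for i
  proof -
    have "integral\<^sup>L \<mu> (f i) = (\<Sum>h\<in>H i. integral\<^sup>L \<mu> (indicator (Bh h))) / real (card (H i))"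
      unfolding f_def by (subst integral_divide_zero, subst Bochner_Integration.integral_sum)
        (auto intro!: integrable_real_indicator Bh_sets HSL simp: emeasure_eq_measure)
    also have "(\<Sum>h\<in>H i. integral\<^sup>L \<mu> (indicator (Bh h))) = (\<Sum>h\<in>H i. measure \<mu> ?B)"
    proof (rule sum.cong[OF refl])
      fix h assume h: "h \<in> H i"
      have "Bh h \<inter> space \<mu> = Bh h" by (auto simp: Bh_def space)
      then show "integral\<^sup>L \<mu> (indicator (Bh h)) = measure \<mu> ?B" using Bh_measure[OF HSL[OF h]] by simp
    qed
    finally show ?thesis using cardH[of i] by simp
  qed
  have f_bound: "norm (f i \<Lambda>) \<le> 1" for i \<Lambda>
  proof -
    have "(\<Sum>h\<in>H i. indicator (Bh h) \<Lambda> :: real) \<le> (\<Sum>h\<in>H i. 1)" by (rule sum_mono) (simp add: indicator_def)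
    then have "f i \<Lambda> \<le> 1" using cardH[of i] by (simp add: f_def)
    moreover have "f i \<Lambda> \<ge> 0" unfolding f_def by (intro divide_nonneg_nonneg sum_nonneg) auto
    ultimately show ?thesis by simp
  qed
  have f_lim: "(\<lambda>i. f i \<Lambda>) \<longlonglongrightarrow> 0" if L: "\<Lambda> \<in> space \<mu>" for \<Lambda>
  proof -
    have LX: "\<Lambda> \<in> ?X" using L space by simp
    then obtain g where g: "g \<in> SL_k" "\<Lambda> = lattice_of g" by (auto simp: unimodular_lattices_def)
    have f_eq: "f i \<Lambda> = real (card {h \<in> H i. bad \<psi> T (h ** g)}) / real (card (H i))" for i
    proof -
      have "indicator (Bh h) \<Lambda> = (if bad \<psi> T (h ** g) then 1 else 0 :: real)" if "h \<in> H i" for h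
        using lattice_of_badset[OF SL_k_mult[OF HSL[OF that] g(1)], of \<psi> T] LX
        by (auto simp: Bh_def g(2) lattice_of_mult indicator_def)
      then have "(\<Sum>h\<in>H i. indicator (Bh h) \<Lambda> :: real) = (\<Sum>h\<in>H i. if bad \<psi> T (h ** g) then 1 else 0)"
        by (rule sum.cong[OF refl])
      also have "\<dots> = real (card {h \<in> H i. bad \<psi> T (h ** g)})"
        using finH by (simp add: sum.inter_filter[symmetric])
      finally show ?thesis unfolding f_def by simp
    qed
    show ?thesis
    proof (rule LIMSEQ_I)
      fix r :: real assume r: "r > 0"
      have dg: "det g = 1" using g by (simp add: SL_k_def)
      have r2: "r / 2 > 0" using r by simp
      have "\<exists>i0. \<forall>i\<ge>i0. \<forall>H. finite H \<and> H \<subseteq> SL_O \<and> inj_on (trunc_mat i) H \<and> trunc_mat i ` H = trunc_mat i ` (SL_O :: ('a fls ^ 'n ^ 'n) set) \<longrightarrow>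
          real (card {h \<in> H. bad \<psi> T (h ** g)}) \<le> r / 2 * real (card H)"
        by (rule bad_fraction_small[OF n nonneg noninc div r2 dg])
      then obtain i0 where i0': "\<forall>i\<ge>i0. \<forall>H. finite H \<and> H \<subseteq> SL_O \<and> inj_on (trunc_mat i) H \<and> trunc_mat i ` H = trunc_mat i ` (SL_O :: ('a fls ^ 'n ^ 'n) set) \<longrightarrow>
          real (card {h \<in> H. bad \<psi> T (h ** g)}) \<le> r / 2 * real (card H)" ..
      have i0: "real (card {h \<in> H i. bad \<psi> T (h ** g)}) \<le> r / 2 * real (card (H i))" if "i \<ge> i0" for i
        using i0'[rule_format, OF that, of "H i"] finH[of i] H(1,2)[of i] H(3)[of i, symmetric] by (simp only: simp_thms)
      have "norm (f i \<Lambda> - 0) < r" if "i \<ge> i0" for i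
      proof -
        have "f i \<Lambda> \<le> r / 2" unfolding f_eq using i0[OF that] cardH[of i] by (simp add: pos_divide_le_eq)
        moreover have "f i \<Lambda> \<ge> 0" unfolding f_eq by simp
        ultimately show ?thesis using r by simp
      qed
      then show "\<exists>no. \<forall>i\<ge>no. norm (f i \<Lambda> - 0) < r" by blast
    qed
  qed
  have "(\<lambda>i. integral\<^sup>L \<mu> (f i)) \<longlonglongrightarrow> integral\<^sup>L \<mu> (\<lambda>_. 0)"
    by (rule integral_dominated_convergence[where w = "\<lambda>_. 1"]) (use f_meas f_lim f_bound in auto)
  then have "(\<lambda>i::nat. measure \<mu> ?B) \<longlonglongrightarrow> 0" unfolding f_int by simp
  then have "measure \<mu> ?B = 0" by (simp add: LIMSEQ_const_iff)
  then show ?thesis using B_sets by (auto simp: null_sets_def emeasure_eq_measure)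
qed

text \<open>Finitely many solutions would have bounded norm, contradicting a good vector for large
  \<open>t\<close>.\<close>

lemma mult_approximable_if_good:
  assumes "\<And>t. \<exists>v\<in>\<Lambda>. good \<psi> (real (Suc t)) v"
  shows "mult_approximable \<psi> \<Lambda>"
  unfolding mult_approximable_def
proof
  let ?G = "{v \<in> \<Lambda>. prod_k v \<le> norm_k v * \<psi> (norm_k v)}"
  assume fin: "finite ?G"
  obtain t where t: "Max (insert 0 (norm_k ` ?G)) < real t" using reals_Archimedean2 by blast
  obtain v where v: "v \<in> \<Lambda>" "good \<psi> (real (Suc t)) v" using assms by blast
  then have "v \<in> ?G" by (simp add: good_def)
  then have "norm_k v \<le> Max (insert 0 (norm_k ` ?G))" using fin by (intro Max_ge) auto
  with t v show False by (simp add: good_def)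
qed

theorem theorem5p4:
  fixes \<psi> :: "real \<Rightarrow> real"
    and \<mu> :: "('a::{field,finite} fls ^ 'n) set measure"
  assumes n: "CARD('n) \<ge> 2"
    and \<mu>: "invariant_probability \<mu>"
    and nonneg: "\<And>x. x > 0 \<Longrightarrow> \<psi> x \<ge> 0"
    and noninc: "antimono_on {0<..} \<psi>"
    and cont: "continuous_on {0<..} \<psi>"
    and div: "\<not> summable (\<lambda>m::nat. ln (real (Suc m)) ^ (CARD('n) - 2) * \<psi> (real (Suc m)))"
  shows "AE \<Lambda> in \<mu>. mult_approximable \<psi> \<Lambda>"
proof -
  have "space \<mu> = unimodular_lattices"
    using sets_eq_imp_space_eq[of \<mu> borel_lattices] \<mu>
    by (simp add: invariant_probability_def borel_lattices_def space_measure_of_conv)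
  then have "AE \<Lambda> in \<mu>. \<Lambda> \<in> unimodular_lattices" by (intro AE_I2) simp
  \<comment> \<open>Integer thresholds suffice, and their countably many exceptional sets are null
    together.\<close>
  moreover have "AE \<Lambda> in \<mu>. \<forall>t. \<Lambda> \<notin> badset \<psi> (real (Suc t))"
    unfolding AE_all_countable
    by (intro allI AE_not_in badset_null[OF n \<mu> nonneg noninc div]) auto
  ultimately show ?thesis
    by eventually_elim (rule mult_approximable_if_good, auto simp: badset_def)
qed

end
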